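(* Let $\Delta_n$ denote the maximum degree of a uniformly random labelled $2$-connected outerplanar graph with $n$ vertices. Then \[\frac{\Delta_n}{\log n}\to \frac{1}{\log(\sqrt2+1)}\quad\text{in probability},\qquad \mathbb{E}\,\Delta_n\sim \frac{\log n}{\log(\sqrt2+1)}\quad (n\to\infty).\]
   Context: Graphs are simple and vertex-labelled with labels $\{1,\dots,n\}$. A graph is outerplanar if it has a planar embedding in which all vertices are incident to the outer face. *)

theory Defs
  imports "HOL-Analysis.Analysis" "HOL-Library.Landau_Symbols"
begin

(* A simple graph on the vertex set V is given by its edge set E, a set of
   2-element subsets of V.  Labelled graphs on {1..n}: V = {1..n}. *)
definition simple_graph :: "nat set \<Rightarrow> nat set set \<Rightarrow> bool" where
  "simple_graph V E \<longleftrightarrow> (\<forall>e\<in>E. e \<subseteq> V \<and> card e = 2)"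

definition adj :: "nat set set \<Rightarrow> nat \<Rightarrow> nat \<Rightarrow> bool" where
  "adj E u v \<longleftrightarrow> {u, v} \<in> E"

(* connectedness of the graph induced on the vertex set W *)
definition connected_on :: "nat set \<Rightarrow> nat set set \<Rightarrow> bool" where
  "connected_on W E \<longleftrightarrow>
     (\<forall>u\<in>W. \<forall>v\<in>W. (u, v) \<in> {(x, y). x \<in> W \<and> y \<in> W \<and> adj E x y}\<^sup>*)"

(* 2-connected: at least 3 vertices, connected, and stays connected after
   deleting any single vertex *)
definition two_connected :: "nat set \<Rightarrow> nat set set \<Rightarrow> bool" where
  "two_connected V E \<longleftrightarrow> card V \<ge> 3 \<and> connected_on V E \<and>
     (\<forall>x\<in>V. connected_on (V - {x}) E)"

(* A planar drawing (embedding) in the plane \<complex>: distinct points for the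
   vertices, an arc for every edge joining its endpoints, arcs meeting each
   other only in common endpoints and meeting vertex points only at their
   own endpoints. *)
definition planar_drawing ::
  "nat set \<Rightarrow> nat set set \<Rightarrow> (nat \<Rightarrow> complex) \<Rightarrow> (nat set \<Rightarrow> real \<Rightarrow> complex) \<Rightarrow> bool" where
  "planar_drawing V E pos \<gamma> \<longleftrightarrow>
     inj_on pos V \<and>
     (\<forall>e\<in>E. arc (\<gamma> e) \<and>
        (\<exists>u v. e = {u, v} \<and> pathstart (\<gamma> e) = pos u \<and> pathfinish (\<gamma> e) = pos v) \<and>
        path_image (\<gamma> e) \<inter> pos ` V = pos ` e) \<and>
     (\<forall>e\<in>E. \<forall>e'\<in>E. e \<noteq> e' \<longrightarrow>
        path_image (\<gamma> e) \<inter> path_image (\<gamma> e') \<subseteq> pos ` (e \<inter> e'))"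

definition drawing_image ::
  "nat set \<Rightarrow> nat set set \<Rightarrow> (nat \<Rightarrow> complex) \<Rightarrow> (nat set \<Rightarrow> real \<Rightarrow> complex) \<Rightarrow> complex set" where
  "drawing_image V E pos \<gamma> = pos ` V \<union> (\<Union>e\<in>E. path_image (\<gamma> e))"

(* Outerplanar: there is a planar drawing such that every vertex is incident
   to (lies on the boundary of) the outer face, i.e. the unbounded connected
   component of the complement of the drawing. *)
definition outerplanar :: "nat set \<Rightarrow> nat set set \<Rightarrow> bool" where
  "outerplanar V E \<longleftrightarrow> simple_graph V E \<and>
     (\<exists>pos \<gamma>. planar_drawing V E pos \<gamma> \<and>
        (\<exists>F \<in> components (- drawing_image V E pos \<gamma>).
           \<not> bounded F \<and> (\<forall>v\<in>V. pos v \<in> closure F)))"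

(* the set of labelled 2-connected outerplanar graphs on {1..n} *)
definition TCO :: "nat \<Rightarrow> nat set set set" where
  "TCO n = {E. simple_graph {1..n} E \<and> two_connected {1..n} E \<and> outerplanar {1..n} E}"

definition degree :: "nat set set \<Rightarrow> nat \<Rightarrow> nat" where
  "degree E v = card {e\<in>E. v \<in> e}"

definition max_degree :: "nat \<Rightarrow> nat set set \<Rightarrow> nat" where
  "max_degree n E = Max (degree E ` {1..n})"

end

theory Submission
  imports Defs "HOL-Combinatorics.Permutations" "HOL-Real_Asymp.Real_Asymp"
begin

text \<open>
  In a drawing of a 2-connected outerplanar graph no cycle encloses a vertex, so theta graphs with
  three subdivided paths and crossing chords are impossible; hence such graphs are exactly the
  relabellings of dissected polygons, and every one of them arises from the same number of
  (relabelling, dissection) pairs. It remains to study a uniformly random dissection of an \<open>n\<close>-gon.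

  Let \<open>q = sqrt 2 - 1\<close>. Splitting a dissection at the last neighbour of its first vertex shows that
  dissections whose first vertex has degree \<open>j + 1\<close> have generating function \<open>x W\<^sup>j\<close>, where \<open>W\<close> has
  radius of convergence \<open>q\<^sup>2\<close> and \<open>W = q\<close> there; since \<open>n\<^sup>2 w\<^sub>n q\<^bsup>2n\<^esup>\<close> is
  nondecreasing, the degree of a fixed vertex equals \<open>j\<close> with probability at most \<open>8 j\<^sup>3 q\<^sup>j\<close>, and
  exponential moments give the upper bounds. Conversely, if all degrees towards later vertices are at
  most \<open>k\<close>, the generating function still converges at \<open>q\<^sup>2 (1 + q\<^sup>k)\<close>, so such dissections
  have probability \<open>O(n\<^sup>2 (1 + q\<^sup>k)\<^bsup>-n\<^esup>)\<close>, which tends to \<open>0\<close> for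
  \<open>k = (c - \<epsilon>) log n\<close>, where \<open>c = 1 / log (sqrt 2 + 1)\<close>.
\<close>

section \<open>Theta curves with a common accessible face\<close>

text \<open>Chains of dissected polygons, the sets \<open>NC\<close>, are counted by a series W with
  W = X + X W + W^2. Its discriminant 1 - 6 X + X^2 has the smaller root 3 - 2 sqrt 2 = q^2, where W
  takes the value (1 - q^2) / 2 = q. So each further neighbour of the root costs a factor q, about n
  q^k vertices should have degree above k, and the constant 1 / log (1 / q) comes from n q^k = 1.

  The obstacle for the lower bound is that degrees of different vertices are dependent. It is
  avoided by restricting all of them at once, which is possible for the degree towards larger
  labels: it is unaffected by gluing and bounds the degree from below. For the upper bound any
  vertex is rotated to position 1, where both degrees agree.

  Exact coefficient asymptotics are replaced by bounds on partial sums and one monotonicity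
  statement. This loses polynomial factors, which are harmless: in the lower tail they compete with
  roughly exp (-n^d / 2) for some d > 0, and in the upper tail they leave the exponential rate q^j
  intact.\<close>

definition two_arcs :: "complex \<Rightarrow> complex \<Rightarrow> (real \<Rightarrow> complex) \<Rightarrow> (real \<Rightarrow> complex) \<Rightarrow> bool" where
  "two_arcs a b c d \<longleftrightarrow> arc c \<and> arc d \<and> pathstart c = a \<and> pathfinish c = b \<and>
     pathstart d = a \<and> pathfinish d = b \<and> path_image c \<inter> path_image d = {a, b}"

lemma two_arcs_Jordan:
  assumes "two_arcs a b c d"
  defines "C \<equiv> path_image c \<union> path_image d"
  shows "inside C \<noteq> {}" "open (inside C)" "connected (inside C)" "open (outside C)"
    "connected (outside C)" "bounded (inside C)"
    "frontier (inside C) = C" "frontier (outside C) = C" "compact C"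
proof -
  let ?g = "c +++ reversepath d"
  have sp: "simple_path ?g"
    using assms by (auto simp: two_arcs_def intro!: simple_path_join_loop arc_reversepath)
  have im: "path_image ?g = C"
    using assms by (simp add: two_arcs_def C_def path_image_join)
  have "pathfinish ?g = pathstart ?g"
    using assms by (simp add: two_arcs_def)
  from Jordan_inside_outside[OF sp this] im
  show "inside C \<noteq> {}" "open (inside C)" "connected (inside C)" "open (outside C)"
    "connected (outside C)" "bounded (inside C)"
    "frontier (inside C) = C" "frontier (outside C) = C" by auto
  show "compact C"
    using compact_simple_path_image[OF sp] im by simp
qed

lemma unbounded_connected_subset_outside:
  assumes "connected F" "\<not> bounded F" "F \<inter> C = {}"
  shows "F \<subseteq> outside C"
proof
  fix x assume "x \<in> F"
  then have "F \<subseteq> connected_component_set (- C) x"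
    using assms by (intro connected_component_maximal) auto
  then show "x \<in> outside C"
    using bounded_subset[of "connected_component_set (- C) x" F] assms \<open>x \<in> F\<close>
    by (auto simp: outside_def)
qed

text \<open>If the third arc ran outside the curve formed by the first two, then Janiszewski's theorem,
  applied to the other two curves of the theta graph, would join the inside of the first curve to
  infinity.\<close>

lemma theta_inside:
  assumes t12: "two_arcs a b c1 c2" and t13: "two_arcs a b c1 c3" and t23: "two_arcs a b c2 c3"
    and F: "connected F" "\<not> bounded F" "F \<inter> (path_image c1 \<union> path_image c2 \<union> path_image c3) = {}"
    and v1: "v1 \<in> path_image c1 - {a,b}" "v1 \<in> closure F"
    and v2: "v2 \<in> path_image c2 - {a,b}" "v2 \<in> closure F"
  shows "path_image c3 - {a,b} \<subseteq> inside (path_image c1 \<union> path_image c2)"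
proof (rule ccontr)
  let ?C1 = "path_image c1" and ?C2 = "path_image c2" and ?C3 = "path_image c3"
  assume "\<not> ?thesis"
  then obtain z where z: "z \<in> ?C3" "z \<noteq> a" "z \<noteq> b" "z \<notin> inside (?C1 \<union> ?C2)" by blast
  have ints: "?C1 \<inter> ?C2 = {a,b}" "?C1 \<inter> ?C3 = {a,b}" "?C2 \<inter> ?C3 = {a,b}"
    using t12 t13 t23 by (auto simp: two_arcs_def)
  have con3: "connected (?C3 - {a,b})"
    using connected_simple_path_endless[of c3] t13 by (auto simp: two_arcs_def arc_imp_simple_path)
  have z_out: "z \<in> outside (?C1 \<union> ?C2)"
    using z ints inside_Un_outside[of "?C1 \<union> ?C2"] by blast
  have "(?C1 \<union> ?C2) \<inter> (?C3 - {a,b}) = {}"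
    using ints by blast
  with inside_outside_intersect_connected[OF con3, of "?C1 \<union> ?C2"] z_out z
  have c3_in: "inside (?C1 \<union> ?C2) \<inter> (?C3 - {a,b}) = {}" by blast
  have dis: "inside (?C1 \<union> ?C2) \<inter> (?C1 \<union> ?C2) = {}" by simp
  have ab: "a \<in> ?C1" "b \<in> ?C1" using ints by auto
  have dis3: "inside (?C1 \<union> ?C2) \<inter> ?C3 = {}"
    using c3_in dis ab by blast
  \<comment> \<open>If the two insides met, the inside of the first curve, connected and disjoint
    from the curve \<open>D \<union> ?C3\<close>, would lie within the inside of the latter. Then
    \<open>w\<close>, on the boundary of the first curve and off the second, would be strictly
    enclosed, while \<open>F\<close> stays outside.\<close>
  have key: "inside (?C1 \<union> ?C2) \<inter> inside (D \<union> ?C3) = {}"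
    if D: "two_arcs a b D' c3" "D = path_image D'" "D \<subseteq> ?C1 \<union> ?C2"
      and w: "w \<in> ?C1 \<union> ?C2" "w \<notin> D \<union> ?C3" "w \<in> closure F" for D D' w
  proof (rule ccontr)
    assume ne: "\<not> ?thesis"
    note J = two_arcs_Jordan[OF D(1), folded D(2)]
    have "inside (?C1 \<union> ?C2) \<inter> outside (D \<union> ?C3) = {}"
    proof (rule ccontr)
      assume "\<not> ?thesis"
      with inside_outside_intersect_connected[OF two_arcs_Jordan(3)[OF t12], of "D \<union> ?C3"] ne
      show False using dis dis3 D(3) by blast
    qed
    then have "inside (?C1 \<union> ?C2) \<subseteq> inside (D \<union> ?C3)"
      using inside_Un_outside[of "D \<union> ?C3"] dis dis3 D(3) by blast
    then have "closure (inside (?C1 \<union> ?C2)) \<subseteq> closure (inside (D \<union> ?C3))"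
      by (rule closure_mono)
    moreover have "w \<in> closure (inside (?C1 \<union> ?C2))"
      using w(1) two_arcs_Jordan(7)[OF t12] by (auto simp: frontier_def)
    moreover have "closure (inside (D \<union> ?C3)) = inside (D \<union> ?C3) \<union> (D \<union> ?C3)"
      using J(7,2) closure_Un_frontier by metis
    ultimately have w_in: "w \<in> inside (D \<union> ?C3)"
      using w(2) by blast
    have "F \<subseteq> outside (D \<union> ?C3)"
      using F D(3) by (intro unbounded_connected_subset_outside) auto
    then have "w \<in> closure (outside (D \<union> ?C3))"
      using w(3) closure_mono by blast
    also have "\<dots> = outside (D \<union> ?C3) \<union> (D \<union> ?C3)"
      using J(8,4) closure_Un_frontier by metis
    finally show False
      using w_in w(2) inside_Int_outside[of "D \<union> ?C3"] by blast
  qed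
  obtain x where x: "x \<in> inside (?C1 \<union> ?C2)"
    using two_arcs_Jordan(1)[OF t12] by blast
  obtain y where y: "y \<in> F" using F(2) by (metis bounded_empty ex_in_conv)
  have xo: "x \<in> outside (?C1 \<union> ?C3)"
  proof -
    have "v2 \<notin> ?C1 \<union> ?C3" using v2 ints by blast
    then have "inside (?C1 \<union> ?C2) \<inter> inside (?C1 \<union> ?C3) = {}"
      using v2 by (intro key[OF t13 refl, of v2]) auto
    then show ?thesis using x dis dis3 inside_Un_outside[of "?C1 \<union> ?C3"] by blast
  qed
  have xo2: "x \<in> outside (?C2 \<union> ?C3)"
  proof -
    have "v1 \<notin> ?C2 \<union> ?C3" using v1 ints by blast
    then have "inside (?C1 \<union> ?C2) \<inter> inside (?C2 \<union> ?C3) = {}"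
      using v1 by (intro key[OF t23 refl, of v1]) auto
    then show ?thesis using x dis dis3 inside_Un_outside[of "?C2 \<union> ?C3"] by blast
  qed
  have yo: "y \<in> outside D" if "D \<subseteq> ?C1 \<union> ?C2 \<union> ?C3" for D
    using unbounded_connected_subset_outside[OF F(1,2), of D] F(3) that y by blast
  have cc: "connected_component (- D) x y" if "connected (outside D)" "x \<in> outside D" "y \<in> outside D" for D
    unfolding connected_component_def
    using that outside_no_overlap[of D] by (intro exI[of _ "outside D"]) blast
  \<comment> \<open>The other two curves of the theta graph share exactly the connected arc
    \<open>c3\<close>, as Janiszewski's theorem demands; neither separates \<open>x\<close> from
    \<open>y\<close>, so their union does not either.\<close>
  have "(?C1 \<union> ?C3) \<inter> (?C2 \<union> ?C3) = ?C3" using ints by blast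
  moreover have "connected ?C3"
    using t13 by (simp add: two_arcs_def connected_arc_image)
  ultimately have "connected_component (- ((?C1 \<union> ?C3) \<union> (?C2 \<union> ?C3))) x y"
    using cc[OF two_arcs_Jordan(5)[OF t13] xo yo] cc[OF two_arcs_Jordan(5)[OF t23] xo2 yo]
    by (intro Janiszewski[OF two_arcs_Jordan(9)[OF t13] compact_imp_closed[OF two_arcs_Jordan(9)[OF t23]]]) auto
  then have "connected_component (- (?C1 \<union> ?C2)) x y"
    by (rule connected_component_of_subset) auto
  then have "y \<in> inside (?C1 \<union> ?C2)"
    using x by (rule inside_same_component)
  then show False using yo[of "?C1 \<union> ?C2"] inside_Int_outside by blast
qed

text \<open>By \<open>theta_inside\<close> the third arc is enclosed by the other two, so
  \<open>v3\<close> lies in an open set that \<open>F\<close>, running outside the enclosing curve,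
  cannot approach.\<close>

lemma theta_not_all_accessible:
  assumes "two_arcs a b c1 c2" "two_arcs a b c1 c3" "two_arcs a b c2 c3"
    and "connected F" "\<not> bounded F" "F \<inter> (path_image c1 \<union> path_image c2 \<union> path_image c3) = {}"
    and "v1 \<in> path_image c1 - {a,b}" "v1 \<in> closure F"
    and "v2 \<in> path_image c2 - {a,b}" "v2 \<in> closure F"
    and v3: "v3 \<in> path_image c3 - {a,b}" "v3 \<in> closure F"
  shows False
proof -
  let ?C = "path_image c1 \<union> path_image c2"
  have v: "v3 \<in> inside ?C"
    using theta_inside[OF assms(1-10)] v3 by blast
  have "F \<subseteq> outside ?C"
    using assms(4-6) by (intro unbounded_connected_subset_outside) auto
  then have "v3 \<in> closure (outside ?C)"
    using v3 closure_mono by blast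
  also have "\<dots> = outside ?C \<union> ?C"
    using two_arcs_Jordan(4,8)[OF assms(1)] closure_Un_frontier by metis
  finally show False
    using v inside_Int_outside[of ?C] inside_no_overlap[of ?C] by blast
qed

text \<open>The arc \<open>c3\<close> cuts the inside of the curve into two open regions, bounded by
  \<open>c1\<close>, \<open>c3\<close> and by \<open>c2\<close>, \<open>c3\<close>. The open arc
  \<open>c4\<close> is connected and avoids \<open>c3\<close>, so it stays in one region, whose
  closure misses one of the end points \<open>u\<close>, \<open>v\<close>.\<close>

lemma crossing_chords_not_both_inside:
  assumes t12: "two_arcs a b c1 c2" and t13: "two_arcs a b c1 c3" and t23: "two_arcs a b c2 c3"
    and in3: "path_image c3 - {a,b} \<subseteq> inside (path_image c1 \<union> path_image c2)"
    and c4: "arc c4" "pathstart c4 = u" "pathfinish c4 = v"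
    and uv: "u \<in> path_image c1 - {a,b}" "v \<in> path_image c2 - {a,b}"
    and i4: "path_image c4 \<inter> (path_image c1 \<union> path_image c2) \<subseteq> {u,v}" "path_image c4 \<inter> path_image c3 = {}"
    and in4: "path_image c4 - {u,v} \<subseteq> inside (path_image c1 \<union> path_image c2)"
  shows False
proof -
  let ?C1 = "path_image c1" and ?C2 = "path_image c2" and ?C3 = "path_image c3" and ?C4 = "path_image c4"
  have ints: "?C1 \<inter> ?C2 = {a,b}" "?C1 \<inter> ?C3 = {a,b}" "?C2 \<inter> ?C3 = {a,b}"
    using t12 t13 t23 by (auto simp: two_arcs_def)
  have arcs: "arc c1" "arc c2" "arc c3" and ends: "pathstart c1 = a" "pathstart c2 = a" "pathstart c3 = a"
      "pathfinish c1 = b" "pathfinish c2 = b" "pathfinish c3 = b"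
    using t12 t13 t23 by (auto simp: two_arcs_def)
  have "a \<noteq> b" using arc_distinct_ends[OF arcs(1)] ends by auto
  have inf: "infinite (path_image g)" if "arc g" for g :: "real \<Rightarrow> complex"
    using arc_image_uncountable[OF that] countable_finite by blast
  have "?C3 - {a,b} \<noteq> {}" "?C4 - {u,v} \<noteq> {}"
    using inf[OF arcs(3)] inf[OF c4(1)] by (metis finite.emptyI finite_insert finite_Diff2)+
  then have ne: "?C3 \<inter> inside (?C1 \<union> ?C2) \<noteq> {}"
    using in3 by blast
  obtain split: "inside (?C1 \<union> ?C3) \<inter> inside (?C2 \<union> ?C3) = {}"
     "inside (?C1 \<union> ?C3) \<union> inside (?C2 \<union> ?C3) \<union> (?C3 - {a,b}) = inside (?C1 \<union> ?C2)"
    using split_inside_simple_closed_curve[OF arc_imp_simple_path[OF arcs(1)] ends(1,4)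
        arc_imp_simple_path[OF arcs(2)] ends(2,5) arc_imp_simple_path[OF arcs(3)] ends(3,6) \<open>a \<noteq> b\<close> ints ne]
    by blast
  let ?X = "?C4 - {u,v}"
  have conX: "connected ?X"
    using connected_simple_path_endless[OF arc_imp_simple_path[OF c4(1)]] c4 by simp
  have sub: "?X \<subseteq> inside (?C1 \<union> ?C3) \<union> inside (?C2 \<union> ?C3)"
    using in4 split(2) i4(2) by blast
  \<comment> \<open>An arc is infinite and connected, hence has no isolated points, so its two ends
    remain limits of the rest.\<close>
  have clX: "u \<in> closure ?X" "v \<in> closure ?X"
  proof -
    have "?C4 \<subseteq> closure ?X"
    proof -
      have "connected ?C4" using c4 connected_arc_image by blast
      
      have "x \<in> closure ?X" if "x \<in> ?C4" "x \<in> {u,v}" for x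
      proof -
        have "x islimpt ?C4"
          using \<open>connected ?C4\<close> inf[OF c4(1)] that(1)
          by (intro connected_imp_perfect) (auto dest: finite_subset[rotated])
        then have "x islimpt ({u,v} \<union> ?X)" by (rule islimpt_subset) auto
        then have "x islimpt ?X" using islimpt_Un_finite[of "{u,v}" x ?X] by blast
        then show ?thesis by (simp add: closure_def)
      qed
      then show ?thesis using closure_subset[of ?X] by blast
    qed
    then show "u \<in> closure ?X" "v \<in> closure ?X"
      using c4 pathstart_in_path_image[of c4] pathfinish_in_path_image[of c4] by blast+
  qed
  note o1 = two_arcs_Jordan(2)[OF t13] and o2 = two_arcs_Jordan(2)[OF t23]
  have "?X \<subseteq> inside (?C1 \<union> ?C3) \<or> ?X \<subseteq> inside (?C2 \<union> ?C3)"
    using connectedD[OF conX o1 o2] sub split(1) by blast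
  moreover have cl: "closure (inside (D \<union> ?C3)) = inside (D \<union> ?C3) \<union> (D \<union> ?C3)"
    if "two_arcs a b d c3" "D = path_image d" for d D
    using two_arcs_Jordan(2,7)[OF that(1)] that(2) closure_Un_frontier by metis
  ultimately have "v \<in> inside (?C1 \<union> ?C3) \<union> (?C1 \<union> ?C3) \<or> u \<in> inside (?C2 \<union> ?C3) \<union> (?C2 \<union> ?C3)"
    using clX closure_mono[of ?X "inside (?C1 \<union> ?C3)"] closure_mono[of ?X "inside (?C2 \<union> ?C3)"]
      cl[OF t13 refl] cl[OF t23 refl] by blast
  moreover have "v \<notin> ?C1 \<union> ?C3" "u \<notin> ?C2 \<union> ?C3"
    using uv ints by blast+
  moreover have "v \<notin> inside (?C1 \<union> ?C2)" "u \<notin> inside (?C1 \<union> ?C2)"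
    using uv inside_no_overlap[of "?C1 \<union> ?C2"] by blast+
  ultimately show False
    using split(2) by blast
qed

section \<open>Paths and cycles in an outerplanar drawing\<close>

fun path_edges :: "nat list \<Rightarrow> nat set set" where
  "path_edges (a # b # r) = insert {a, b} (path_edges (b # r))"
| "path_edges _ = {}"

lemma path_edges_append: "path_edges (xs @ a # ys) = path_edges (xs @ [a]) \<union> path_edges (a # ys)"
  by (induction xs rule: path_edges.induct) auto

lemma path_edges_rev: "path_edges (rev xs) = path_edges xs"
proof (induction xs rule: path_edges.induct)
  case (1 a b r)
  have "path_edges (rev (a # b # r)) = path_edges (rev r @ b # [a])" by simp
  also have "\<dots> = path_edges (rev r @ [b]) \<union> path_edges [b, a]"
    by (rule path_edges_append)
  finally show ?case using 1 by (auto simp: insert_commute)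
qed auto

lemma Union_path_edges: "length vs \<ge> 2 \<Longrightarrow> \<Union>(path_edges vs) = set vs"
proof (induction vs rule: path_edges.induct)
  case (1 a b r) then show ?case by (cases r) auto
qed auto

lemma path_edges_subset_set: "e \<in> path_edges vs \<Longrightarrow> e \<subseteq> set vs"
  by (induction vs rule: path_edges.induct) auto

lemma path_edges_ends:
  assumes "distinct (u # xs @ [v])" "xs \<noteq> []"
  shows "{u, v} \<notin> path_edges (u # xs @ [v])"
proof
  assume "{u, v} \<in> path_edges (u # xs @ [v])"
  moreover obtain x ys where xs: "xs = x # ys" using assms(2) by (cases xs) auto
  ultimately have "{u,v} = {u,x} \<or> {u,v} \<in> path_edges (x # ys @ [v])" by simp
  then show False
    using assms(1) xs path_edges_subset_set[of "{u,v}" "x # ys @ [v]"] by (auto simp: doubleton_eq_iff)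
qed

text \<open>Length two is allowed: an edge traversed back and forth counts as a cycle and starts the
  maximality argument in \<open>hamiltonian\<close>.\<close>

definition cyc :: "nat set set \<Rightarrow> nat list \<Rightarrow> bool" where
  "cyc E vs \<longleftrightarrow> distinct vs \<and> length vs \<ge> 2 \<and> path_edges (vs @ [hd vs]) \<subseteq> E"

lemma path_edges_rotate:
  "path_edges (xs @ a # ys @ [hd (xs @ [a])]) = path_edges (a # ys @ xs @ [a])"
proof (cases xs)
  case (Cons x xs')
  have "path_edges (xs @ a # ys @ [hd (xs @ [a])]) = path_edges (xs @ [a]) \<union> path_edges (a # ys @ [x])"
    using path_edges_append[of xs a "ys @ [hd (xs @ [a])]"] Cons by simp
  moreover have "path_edges (a # ys @ xs @ [a]) = path_edges (a # ys @ [x]) \<union> path_edges (xs @ [a])"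
    using path_edges_append[of "a # ys" x "xs' @ [a]"] Cons by simp
  ultimately show ?thesis by blast
qed auto

lemma cyc_rotate: "cyc E (xs @ a # ys) \<Longrightarrow> cyc E (a # ys @ xs)"
  using path_edges_rotate[of xs a ys] by (cases xs) (auto simp: cyc_def)

lemma rtrancl_exit:
  assumes "(u, w) \<in> R\<^sup>*" "u \<in> S" "w \<notin> S"
  shows "\<exists>x y. (x, y) \<in> R \<and> x \<in> S \<and> y \<notin> S"
  using assms by (induction rule: rtrancl_induct) auto

text \<open>A walk into \<open>S\<close> is stopped at its first vertex in \<open>S\<close> and its
  loops are cut out. With the cycle's vertices as \<open>S\<close>, the list \<open>es\<close>
  becomes the interior of an ear.\<close>

lemma first_hit_path:
  assumes "(y, c) \<in> {(x, y). x \<in> W \<and> y \<in> W \<and> adj E x y}\<^sup>*" "c \<in> S" "y \<notin> S"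
  shows "\<exists>es b. es \<noteq> [] \<and> hd es = y \<and> distinct es \<and> set es \<inter> S = {} \<and> b \<in> S \<and>
    set es \<subseteq> W \<and> b \<in> W \<and> path_edges (es @ [b]) \<subseteq> E"
  using assms
proof (induction rule: converse_rtrancl_induct)
  case (step y z)
  then have yz: "y \<in> W" "z \<in> W" "{y,z} \<in> E" by (auto simp: adj_def)
  show ?case
  proof (cases "z \<in> S")
    case True
    then show ?thesis using yz step.prems by (intro exI[of _ "[y]"] exI[of _ z]) auto
  next
    case False
    with step obtain es b where es: "es \<noteq> []" "hd es = z" "distinct es" "set es \<inter> S = {}" "b \<in> S"
      "set es \<subseteq> W" "b \<in> W" "path_edges (es @ [b]) \<subseteq> E" by blast
    show ?thesis
    proof (cases "y \<in> set es")
      case True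
      then obtain p s where ps: "es = p @ y # s" by (auto simp: in_set_conv_decomp)
      have "path_edges (y # s @ [b]) \<subseteq> E"
        using es(8) path_edges_append[of p y "s @ [b]"] ps by auto
      then show ?thesis using es ps by (intro exI[of _ "y # s"] exI[of _ b]) auto
    next
      case False
      obtain es' where "es = z # es'" using es(1,2) by (cases es) auto
      then show ?thesis using es yz False step.prems by (intro exI[of _ "y # es"] exI[of _ b]) auto
    qed
  qed
qed auto

locale outerplanar_drawing =
  fixes V :: "nat set" and E pos \<gamma> F
  assumes simple: "simple_graph V E"
    and drawing: "planar_drawing V E pos \<gamma>"
    and face: "F \<in> components (- drawing_image V E pos \<gamma>)" "\<not> bounded F"
    and access: "\<And>v. v \<in> V \<Longrightarrow> pos v \<in> closure F"
begin

definition img :: "nat set set \<Rightarrow> complex set" where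
  "img es = (\<Union>e\<in>es. path_image (\<gamma> e))"

lemma img_Un: "img (A \<union> B) = img A \<union> img B"
  by (auto simp: img_def)

lemma edge_vertices: "e \<in> E \<Longrightarrow> e \<subseteq> V" "e \<in> E \<Longrightarrow> card e = 2"
  using simple by (auto simp: simple_graph_def)

lemma inj_pos: "inj_on pos V"
  using drawing by (simp add: planar_drawing_def)

lemma path_vertices: "path_edges vs \<subseteq> E \<Longrightarrow> length vs \<ge> 2 \<Longrightarrow> set vs \<subseteq> V"
  using Union_path_edges[of vs] edge_vertices(1) by blast

lemma F_img_disjoint: "es \<subseteq> E \<Longrightarrow> F \<inter> img es = {}"
  using in_components_subset[OF face(1)] unfolding drawing_image_def img_def by blast

lemma connected_F: "connected F"
  using face(1) in_components_connected by blast

lemma pos_in_img: "es \<subseteq> E \<Longrightarrow> x \<in> V \<Longrightarrow> pos x \<in> img es \<longleftrightarrow> x \<in> \<Union>es"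
proof -
  assume es: "es \<subseteq> E" "x \<in> V"
  have "pos x \<in> path_image (\<gamma> e) \<longleftrightarrow> x \<in> e" if "e \<in> es" for e
  proof -
    have "path_image (\<gamma> e) \<inter> pos ` V = pos ` e" "e \<subseteq> V"
      using drawing es that edge_vertices(1) unfolding planar_drawing_def by (meson subsetD)+
    then show ?thesis
      using es(2) inj_on_image_mem_iff[OF inj_pos es(2), of e] by blast
  qed
  then show ?thesis by (auto simp: img_def)
qed

text \<open>The bridge from combinatorics to topology: vertex-disjointness of paths becomes
  disjointness of drawn curves.\<close>

lemma img_Int:
  assumes "es \<subseteq> E" "fs \<subseteq> E" "es \<inter> fs = {}"
  shows "img es \<inter> img fs = pos ` (\<Union>es \<inter> \<Union>fs)"
proof
  show "img es \<inter> img fs \<subseteq> pos ` (\<Union>es \<inter> \<Union>fs)"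
  proof
    fix z assume "z \<in> img es \<inter> img fs"
    then obtain e f where ef: "e \<in> es" "f \<in> fs" "z \<in> path_image (\<gamma> e) \<inter> path_image (\<gamma> f)"
      by (auto simp: img_def)
    then have "e \<noteq> f" "e \<in> E" "f \<in> E" using assms by auto
    then have "z \<in> pos ` (e \<inter> f)"
      using drawing ef(3) unfolding planar_drawing_def by blast
    then show "z \<in> pos ` (\<Union>es \<inter> \<Union>fs)" using ef(1,2) by blast
  qed
  show "pos ` (\<Union>es \<inter> \<Union>fs) \<subseteq> img es \<inter> img fs"
  proof
    fix z assume "z \<in> pos ` (\<Union>es \<inter> \<Union>fs)"
    then obtain x where x: "z = pos x" "x \<in> \<Union>es" "x \<in> \<Union>fs" by blast
    then have "x \<in> V" using assms edge_vertices(1) by blast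
    then show "z \<in> img es \<inter> img fs" using x assms pos_in_img by auto
  qed
qed

lemma edge_arc:
  assumes "{u, v} \<in> E"
  shows "\<exists>g. arc g \<and> pathstart g = pos u \<and> pathfinish g = pos v \<and> path_image g = path_image (\<gamma> {u,v})"
proof -
  obtain x y where xy: "{u,v} = {x,y}" "pathstart (\<gamma> {u,v}) = pos x" "pathfinish (\<gamma> {u,v}) = pos y"
      and arc: "arc (\<gamma> {u,v})"
    using drawing assms unfolding planar_drawing_def by metis
  show ?thesis
  proof (cases "x = u")
    case True
    then have "y = v" using xy(1) by (auto simp: doubleton_eq_iff)
    then show ?thesis using True xy arc by blast
  next
    case False
    then have "y = u" "x = v" using xy(1) by (auto simp: doubleton_eq_iff)
    then show ?thesis using xy arc
      by (intro exI[of _ "reversepath (\<gamma> {u,v})"]) (simp add: arc_reversepath)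
  qed
qed

lemma path_arc:
  assumes "distinct vs" "length vs \<ge> 2" "path_edges vs \<subseteq> E"
  shows "\<exists>g. arc g \<and> pathstart g = pos (hd vs) \<and> pathfinish g = pos (last vs) \<and>
    path_image g = img (path_edges vs)"
  using assms
proof (induction vs rule: path_edges.induct)
  case (1 a b r)
  then have ab: "{a,b} \<in> E" by simp
  obtain g where g: "arc g" "pathstart g = pos a" "pathfinish g = pos b"
    "path_image g = path_image (\<gamma> {a,b})" using edge_arc[OF ab] by blast
  show ?case
  proof (cases "r = []")
    case True
    then show ?thesis using g by (intro exI[of _ g]) (auto simp: img_def)
  next
    case False
    then have len: "length (b # r) \<ge> 2" by (cases r) auto
    then obtain h where h: "arc h" "pathstart h = pos b" "pathfinish h = pos (last r)"
      "path_image h = img (path_edges (b # r))" using 1 False by auto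
    have nin: "{a,b} \<notin> path_edges (b # r)"
      using path_edges_subset_set[of "{a,b}" "b # r"] 1(2) by auto
    have "path_image g \<inter> path_image h = img {{a,b}} \<inter> img (path_edges (b # r))"
      using g h by (auto simp: img_def)
    also have "\<dots> = pos ` ({a,b} \<inter> set (b # r))"
      using 1 nin ab Union_path_edges[OF len] by (subst img_Int) auto
    also have "\<dots> = {pos b}" using 1 by auto
    finally have "arc (g +++ h)" using g h by (intro arc_join) auto
    moreover have "path_image (g +++ h) = img (path_edges (a # b # r))"
      using g h by (subst path_image_join) (auto simp: img_def)
    ultimately show ?thesis using g h False by (intro exI[of _ "g +++ h"]) auto
  qed
qed auto

lemma two_paths_arcs:
  assumes "path_edges p \<subseteq> E" "path_edges q \<subseteq> E" "hd p = hd q" "last p = last q"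
    and "distinct p" "distinct q" "length p \<ge> 2" "length q \<ge> 2"
    and "set p \<inter> set q = {hd q, last q}" "path_edges p \<inter> path_edges q = {}"
    and "arc c" "pathstart c = pos (hd p)" "pathfinish c = pos (last p)" "path_image c = img (path_edges p)"
    and "arc d" "pathstart d = pos (hd q)" "pathfinish d = pos (last q)" "path_image d = img (path_edges q)"
  shows "two_arcs (pos (hd q)) (pos (last q)) c d"
  using assms img_Int[OF assms(1,2,10)] Union_path_edges[OF assms(7)] Union_path_edges[OF assms(8)]
  by (simp add: two_arcs_def)

text \<open>A common edge would have both ends in \<open>{u, v}\<close>, but a path with an interior
  vertex does not use the edge between its own ends.\<close>

lemma internally_disjoint_edges:
  assumes "distinct (u # xs @ [v])" "xs \<noteq> []" "path_edges q \<subseteq> E" "set (u # xs @ [v]) \<inter> set q \<subseteq> {u,v}"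
  shows "path_edges (u # xs @ [v]) \<inter> path_edges q = {}"
proof (rule ccontr)
  assume "\<not> ?thesis"
  then obtain e where e: "e \<in> path_edges (u # xs @ [v])" "e \<in> path_edges q" by blast
  then have "e \<subseteq> {u,v}" "card e = 2"
    using assms(3,4) edge_vertices path_edges_subset_set by (blast, blast)
  then have "e = {u,v}" using assms(1) by (intro card_subset_eq) auto
  then show False using path_edges_ends[OF assms(1,2)] e by simp
qed

text \<open>The drawn paths form a theta graph, and the first interior vertex of each path is
  accessible from the outer face, against \<open>theta_not_all_accessible\<close>.\<close>

lemma no_three_paths:
  assumes "distinct (u # xs @ [v])" "distinct (u # ys @ [v])" "distinct (u # zs @ [v])"
    and ne: "xs \<noteq> []" "ys \<noteq> []" "zs \<noteq> []"
    and dis: "set xs \<inter> set ys = {}" "set xs \<inter> set zs = {}" "set ys \<inter> set zs = {}"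
    and E: "path_edges (u # xs @ [v]) \<subseteq> E" "path_edges (u # ys @ [v]) \<subseteq> E" "path_edges (u # zs @ [v]) \<subseteq> E"
  shows False
proof -
  let ?P = "\<lambda>xs. u # xs @ [v]"
  have arc: "\<exists>g. arc g \<and> pathstart g = pos u \<and> pathfinish g = pos v \<and> path_image g = img (path_edges (?P xs))"
    if "distinct (?P xs)" "path_edges (?P xs) \<subseteq> E" for xs
    using path_arc[of "?P xs"] that by auto
  obtain c1 c2 c3 where c: "arc c1" "pathstart c1 = pos u" "pathfinish c1 = pos v" "path_image c1 = img (path_edges (?P xs))"
     "arc c2" "pathstart c2 = pos u" "pathfinish c2 = pos v" "path_image c2 = img (path_edges (?P ys))"
     "arc c3" "pathstart c3 = pos u" "pathfinish c3 = pos v" "path_image c3 = img (path_edges (?P zs))"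
    using arc assms by metis
  have inter: "two_arcs (pos u) (pos v) c d"
    if "distinct (?P xs)" "distinct (?P ys)" "xs \<noteq> []" "set xs \<inter> set ys = {}" "path_edges (?P xs) \<subseteq> E" "path_edges (?P ys) \<subseteq> E"
      "arc c" "pathstart c = pos u" "pathfinish c = pos v" "path_image c = img (path_edges (?P xs))"
      "arc d" "pathstart d = pos u" "pathfinish d = pos v" "path_image d = img (path_edges (?P ys))"
    for xs ys c d
  proof -
    have "set (?P xs) \<inter> set (?P ys) = {u, v}" using that by auto
    then show ?thesis
      using two_paths_arcs[of "?P xs" "?P ys" c d] internally_disjoint_edges[of u xs v "?P ys"] that by simp
  qed
  have interior: "\<exists>w. w \<in> img (path_edges (?P xs)) - {pos u, pos v} \<and> w \<in> closure F"
    if xs: "distinct (?P xs)" "xs \<noteq> []" "path_edges (?P xs) \<subseteq> E" for xs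
  proof -
    have V: "set (?P xs) \<subseteq> V" using path_vertices[of "?P xs"] xs by simp
    have "hd xs \<in> set xs" using xs by simp
    then have h: "hd xs \<in> V" "hd xs \<noteq> u" "hd xs \<noteq> v" "hd xs \<in> set (?P xs)" using V xs by auto
    then have "pos (hd xs) \<noteq> pos u" "pos (hd xs) \<noteq> pos v" using inj_pos V by (auto dest: inj_onD)
    moreover have "pos (hd xs) \<in> img (path_edges (?P xs))"
      using pos_in_img[OF xs(3) h(1)] Union_path_edges[of "?P xs"] h(4) by simp
    ultimately show ?thesis using access[OF h(1)] by blast
  qed
  have F: "F \<inter> (path_image c1 \<union> path_image c2 \<union> path_image c3) = {}"
    using c F_img_disjoint E by (simp add: Int_Un_distrib)
  obtain w1 w2 w3 where "w1 \<in> path_image c1 - {pos u, pos v}" "w1 \<in> closure F"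
    "w2 \<in> path_image c2 - {pos u, pos v}" "w2 \<in> closure F" "w3 \<in> path_image c3 - {pos u, pos v}" "w3 \<in> closure F"
    using interior assms c by metis
  moreover have "two_arcs (pos u) (pos v) c1 c2" "two_arcs (pos u) (pos v) c1 c3" "two_arcs (pos u) (pos v) c2 c3"
    using inter[OF assms(1,2) ne(1) dis(1) E(1,2) c(1-8)] inter[OF assms(1,3) ne(1) dis(2) E(1,3) c(1-4,9-12)]
      inter[OF assms(2,3) ne(2) dis(3) E(2,3) c(5-12)] by blast+
  ultimately show False
    using theta_not_all_accessible[OF _ _ _ connected_F face(2) F] by blast
qed

text \<open>The chord and the two arcs of the cycle form a theta graph in which both cycle arcs
  carry an accessible interior vertex, so \<open>theta_inside\<close> applies. The arcs themselves
  are exported because the crossing argument works with them.\<close>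

lemma chord_inside:
  assumes cyc: "cyc E (a # xs @ b # ys)" and ne: "xs \<noteq> []" "ys \<noteq> []" and ab: "{a,b} \<in> E"
  shows "\<exists>c1 c2 c3. two_arcs (pos a) (pos b) c1 c2 \<and> two_arcs (pos a) (pos b) c1 c3 \<and> two_arcs (pos a) (pos b) c2 c3 \<and>
     path_image c3 = img {{a,b}} \<and> path_image c1 = img (path_edges (a # xs @ [b])) \<and>
     path_image c2 = img (path_edges (b # ys @ [a])) \<and>
     img {{a,b}} - {pos a, pos b} \<subseteq> inside (img (path_edges (a # xs @ b # ys @ [a])))"
proof -
  have d: "distinct (a # xs @ b # ys)" and pe: "path_edges (a # xs @ b # ys @ [a]) \<subseteq> E"
    using cyc by (auto simp: cyc_def)
  have split: "path_edges (a # xs @ b # ys @ [a]) = path_edges (a # xs @ [b]) \<union> path_edges (b # ys @ [a])"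
    using path_edges_append[of "a # xs" b "ys @ [a]"] by simp
  \<comment> \<open>The second arc of the cycle is traversed backwards, so that all three arcs run
    from \<open>a\<close> to \<open>b\<close>.\<close>
  have rev: "path_edges (a # rev ys @ [b]) = path_edges (b # ys @ [a])"
    using path_edges_rev[of "b # ys @ [a]"] by simp
  let ?p1 = "a # xs @ [b]" and ?p2 = "a # rev ys @ [b]" and ?p3 = "[a, b]"
  have E: "path_edges ?p1 \<subseteq> E" "path_edges ?p2 \<subseteq> E" "path_edges ?p3 \<subseteq> E"
    using pe ab rev split by auto
  obtain c1 where c1: "arc c1" "pathstart c1 = pos a" "pathfinish c1 = pos b" "path_image c1 = img (path_edges ?p1)"
    using path_arc[of ?p1] d E by auto
  obtain c2 where c2: "arc c2" "pathstart c2 = pos a" "pathfinish c2 = pos b" "path_image c2 = img (path_edges ?p2)"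
    using path_arc[of ?p2] d E by auto
  obtain c3 where c3: "arc c3" "pathstart c3 = pos a" "pathfinish c3 = pos b" "path_image c3 = img (path_edges ?p3)"
    using path_arc[of ?p3] d E by auto
  have i12: "path_edges ?p1 \<inter> path_edges ?p2 = {}" and i13: "path_edges ?p1 \<inter> path_edges ?p3 = {}"
    using d ne E by (intro internally_disjoint_edges; auto)+
  have i23: "path_edges ?p2 \<inter> path_edges ?p3 = {}"
    using d ne E by (intro internally_disjoint_edges; auto)
  have t12: "two_arcs (pos a) (pos b) c1 c2"
    using two_paths_arcs[of ?p1 ?p2 c1 c2] E d i12 c1 c2 by auto
  have t13: "two_arcs (pos a) (pos b) c1 c3"
    using two_paths_arcs[of ?p1 ?p3 c1 c3] E d i13 c1 c3 by auto
  have t23: "two_arcs (pos a) (pos b) c2 c3"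
    using two_paths_arcs[of ?p2 ?p3 c2 c3] E d i23 c2 c3 by auto
  have F: "F \<inter> (path_image c1 \<union> path_image c2 \<union> path_image c3) = {}"
    using c1 c2 c3 F_img_disjoint E by (simp add: Int_Un_distrib)
  have V: "set (a # xs @ b # ys) \<subseteq> V"
    using path_vertices[OF pe] by auto
  have x: "hd xs \<in> V" "hd xs \<noteq> a" "hd xs \<noteq> b" "hd xs \<in> set xs" using V d ne hd_in_set[of xs] by auto
  have y: "hd ys \<in> V" "hd ys \<noteq> a" "hd ys \<noteq> b" "hd ys \<in> set ys" using V d ne hd_in_set[of ys] by auto
  have "path_image c3 - {pos a, pos b} \<subseteq> inside (path_image c1 \<union> path_image c2)"
  proof (rule theta_inside[OF t12 t13 t23 connected_F face(2) F])
    show "pos (hd xs) \<in> closure F" "pos (hd ys) \<in> closure F" using access x y by auto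
    have "pos (hd xs) \<in> img (path_edges ?p1)"
      using pos_in_img[OF E(1) x(1)] Union_path_edges[of ?p1] x by auto
    moreover have "pos (hd ys) \<in> img (path_edges ?p2)"
      using pos_in_img[OF E(2) y(1)] Union_path_edges[of ?p2] y by auto
    moreover have "pos (hd xs) \<notin> {pos a, pos b}" "pos (hd ys) \<notin> {pos a, pos b}"
      using inj_pos V x y by (auto dest: inj_onD)
    ultimately show "pos (hd xs) \<in> path_image c1 - {pos a, pos b}" "pos (hd ys) \<in> path_image c2 - {pos a, pos b}"
      using c1 c2 by auto
  qed
  then show ?thesis
    using t12 t13 t23 c1 c2 c3 rev split by (intro exI[of _ c1] exI[of _ c2] exI[of _ c3]) (simp add: img_Un)
qed

text \<open>Both chords lie inside the same closed curve: for the second one the cycle is rotated to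
  start at \<open>u\<close>, which changes the list but not the set of drawn edges. Two chords with
  interleaved ends cannot both be inside.\<close>

lemma no_crossing_chords:
  assumes cyc: "cyc E (a # xs @ b # ys)" and u: "u \<in> set xs" and v: "v \<in> set ys"
    and ab: "{a,b} \<in> E" and uv: "{u,v} \<in> E"
  shows False
proof -
  have d: "distinct (a # xs @ b # ys)" and pe: "path_edges (a # xs @ b # ys @ [a]) \<subseteq> E"
    using cyc by (auto simp: cyc_def)
  have split: "path_edges (a # xs @ b # ys @ [a]) = path_edges (a # xs @ [b]) \<union> path_edges (b # ys @ [a])"
    using path_edges_append[of "a # xs" b "ys @ [a]"] by simp
  have ne: "xs \<noteq> []" "ys \<noteq> []" using u v by auto
  let ?C = "img (path_edges (a # xs @ b # ys @ [a]))"
  obtain c1 c2 c3 where c: "two_arcs (pos a) (pos b) c1 c2" "two_arcs (pos a) (pos b) c1 c3" "two_arcs (pos a) (pos b) c2 c3"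
     and im: "path_image c3 = img {{a,b}}" "path_image c1 = img (path_edges (a # xs @ [b]))"
     "path_image c2 = img (path_edges (b # ys @ [a]))"
     and ins: "img {{a,b}} - {pos a, pos b} \<subseteq> inside ?C"
    using chord_inside[OF cyc ne ab] by blast
  have C: "?C = path_image c1 \<union> path_image c2" using im split by (simp add: img_Un)
  obtain x1 x2 where xs: "xs = x1 @ u # x2" using u by (auto simp: in_set_conv_decomp)
  obtain y1 y2 where ys: "ys = y1 @ v # y2" using v by (auto simp: in_set_conv_decomp)
  have cyc': "cyc E (u # (x2 @ b # y1) @ v # (y2 @ a # x1))"
    using cyc_rotate[of E "a # x1" u "x2 @ b # ys"] cyc xs ys by simp
  have rot: "path_edges (u # (x2 @ b # y1) @ v # (y2 @ a # x1) @ [u]) = path_edges (a # xs @ b # ys @ [a])"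
    using path_edges_rotate[of "a # x1" u "x2 @ b # ys"] xs ys by simp
  have ins': "img {{u,v}} - {pos u, pos v} \<subseteq> inside ?C"
    using chord_inside[OF cyc' _ _ uv] unfolding rot by blast
  obtain c4 where c4: "arc c4" "pathstart c4 = pos u" "pathfinish c4 = pos v" "path_image c4 = img {{u,v}}"
    using edge_arc[OF uv] by (auto simp: img_def)
  have V: "set (a # xs @ b # ys) \<subseteq> V"
    using path_vertices[OF pe] by auto
  have uvne: "u \<noteq> a" "u \<noteq> b" "v \<noteq> a" "v \<noteq> b" "u \<notin> set ys" "v \<notin> set xs" "a \<noteq> b" "u \<noteq> v" using d u v by auto
  have posne: "pos u \<notin> {pos a, pos b}" "pos v \<notin> {pos a, pos b}"
    using inj_pos V u v uvne by (auto dest: inj_onD)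
  have E1: "path_edges (a # xs @ [b]) \<subseteq> E" and E2: "path_edges (b # ys @ [a]) \<subseteq> E" using pe split by auto
  show False
  proof (rule crossing_chords_not_both_inside[OF c _ c4(1-3)])
    show "path_image c3 - {pos a, pos b} \<subseteq> inside (path_image c1 \<union> path_image c2)"
      using ins C im by simp
    show "path_image c4 - {pos u, pos v} \<subseteq> inside (path_image c1 \<union> path_image c2)"
      using ins' C c4 by simp
    have "pos u \<in> img (path_edges (a # xs @ [b]))"
      using pos_in_img[OF E1, of u] Union_path_edges[of "a # xs @ [b]"] u V by auto
    then show "pos u \<in> path_image c1 - {pos a, pos b}" using im posne by simp
    have "pos v \<in> img (path_edges (b # ys @ [a]))"
      using pos_in_img[OF E2, of v] Union_path_edges[of "b # ys @ [a]"] v V by auto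
    then show "pos v \<in> path_image c2 - {pos a, pos b}" using im posne by simp
    have nin: "{{u,v}} \<inter> path_edges (a # xs @ b # ys @ [a]) = {}"
    proof -
      have "{u,v} \<notin> path_edges (a # xs @ [b])"
        using path_edges_subset_set[of "{u,v}" "a # xs @ [b]"] uvne by auto
      moreover have "{u,v} \<notin> path_edges (b # ys @ [a])"
        using path_edges_subset_set[of "{u,v}" "b # ys @ [a]"] uvne by auto
      ultimately show ?thesis using split by auto
    qed
    have "path_image c4 \<inter> ?C = pos ` ({u,v} \<inter> \<Union>(path_edges (a # xs @ b # ys @ [a])))"
      using img_Int[OF _ pe nin] c4(4) uv by simp
    then show "path_image c4 \<inter> (path_image c1 \<union> path_image c2) \<subseteq> {pos u, pos v}"
      unfolding C by auto
    have "{{u,v}} \<inter> {{a,b}} = {}" using uvne by (auto simp: doubleton_eq_iff)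
    then show "path_image c4 \<inter> path_image c3 = {}"
      using img_Int[of "{{u,v}}" "{{a,b}}"] uv ab c4(4) im uvne by simp
  qed
qed

end

section \<open>Hamiltonian cycles in 2-connected outerplanar graphs\<close>

context outerplanar_drawing
begin

lemma cyc_vertices: "cyc E vs \<Longrightarrow> set vs \<subseteq> V"
  using path_vertices[of "vs @ [hd vs]"] by (auto simp: cyc_def)

text \<open>A longest cycle is Hamiltonian. Otherwise an edge leaves it at some \<open>a\<close>,
  and since \<open>V - {a}\<close> is still connected this edge extends to an ear ending at another
  vertex \<open>b\<close> of the cycle. If \<open>a\<close> and \<open>b\<close> are neighbours on
  the cycle, the ear lengthens it; if not, the ear and the two arcs of the cycle contradict
  \<open>no_three_paths\<close>.\<close>

lemma hamiltonian:
  assumes two: "two_connected V E"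
  shows "\<exists>vs. cyc E vs \<and> set vs = V"
proof -
  have card: "card V \<ge> 3" and con: "connected_on V E" and con': "\<And>x. x \<in> V \<Longrightarrow> connected_on (V - {x}) E"
    using two by (auto simp: two_connected_def)
  have fin: "finite V" using card by (metis card.infinite not_numeral_le_zero)
  have edge_out: "\<exists>x y. {x, y} \<in> E \<and> x \<in> S \<and> y \<in> V - S" if S: "S \<subseteq> V" "S \<noteq> {}" "S \<noteq> V" for S
  proof -
    obtain u w where "u \<in> S" "w \<in> V - S" using S by blast
    then have "(u, w) \<in> {(x, y). x \<in> V \<and> y \<in> V \<and> adj E x y}\<^sup>*"
      using con S(1) unfolding connected_on_def by blast
    from rtrancl_exit[OF this, of S] show ?thesis
      using \<open>u \<in> S\<close> \<open>w \<in> V - S\<close> by (auto simp: adj_def)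
  qed
  have "\<exists>vs. cyc E vs"
  proof -
    obtain a where "a \<in> V" using card by fastforce
    then have "{a} \<subseteq> V" "{a} \<noteq> {}" "{a} \<noteq> V" using card by auto
    from edge_out[OF this] obtain y where "{a, y} \<in> E" "y \<noteq> a" by auto
    then show ?thesis by (intro exI[of _ "[a, y]"]) (auto simp: cyc_def insert_commute)
  qed
  then obtain vs0 where vs0: "cyc E vs0" by blast
  have bound: "length vs \<le> card V" if "cyc E vs" for vs
    using cyc_vertices[OF that] card_mono[OF fin, of "set vs"] distinct_card[of vs] that
    by (simp add: cyc_def)
  have "\<exists>vs. cyc E vs \<and> (\<forall>ws. cyc E ws \<longrightarrow> length ws \<le> length vs)"
    using vs0 bound by (intro Lattices_Big.ex_has_greatest_nat[of "cyc E" vs0 length "Suc (card V)"]) (auto simp: less_Suc_eq_le)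
  then obtain vs where vs: "cyc E vs" and max: "\<And>ws. cyc E ws \<Longrightarrow> length ws \<le> length vs"
    by blast
  have "set vs = V"
  proof (rule ccontr)
    assume neq: "set vs \<noteq> V"
    have "set vs \<noteq> {}" using vs by (auto simp: cyc_def)
    from edge_out[OF cyc_vertices[OF vs] this neq]
    obtain a y where ay: "{a, y} \<in> E" "a \<in> set vs" "y \<in> V" "y \<notin> set vs" by blast
    obtain xs zs where "vs = xs @ a # zs" using ay by (auto simp: in_set_conv_decomp)
    then obtain ws where ws: "cyc E (a # ws)" "length (a # ws) = length vs" "set (a # ws) = set vs"
      using cyc_rotate[of E xs a zs] vs by (intro that[of "zs @ xs"]) auto
    have V: "set (a # ws) \<subseteq> V" using cyc_vertices ws(1) by blast
    have "ws \<noteq> []" using ws(1) by (auto simp: cyc_def)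
    then have c: "hd ws \<in> set ws" by simp
    have "a \<in> V" "hd ws \<in> V - {a}" "y \<in> V - {a}" "y \<notin> set ws"
      using V c ws ay by (auto simp: cyc_def)
    then have "(y, hd ws) \<in> {(x, y). x \<in> V - {a} \<and> y \<in> V - {a} \<and> adj E x y}\<^sup>*"
      using con'[of a] unfolding connected_on_def by blast
    from first_hit_path[OF this c \<open>y \<notin> set ws\<close>] obtain es b where
      es: "es \<noteq> []" "hd es = y" "distinct es" "set es \<inter> set ws = {}" "b \<in> set ws"
        "set es \<subseteq> V - {a}" "path_edges (es @ [b]) \<subseteq> E" by blast
    \<comment> \<open>\<open>p\<close> and \<open>r\<close> are the interiors of the two arcs of the
      cycle between \<open>a\<close> and \<open>b\<close>; if one of them is empty, the ear is put
      in its place.\<close>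
    obtain p r where pr: "ws = p @ b # r" using es(5) by (auto simp: in_set_conv_decomp)
    obtain es' where es': "es = y # es'" using es(1,2) by (cases es) auto
    have ear: "path_edges (a # es @ [b]) \<subseteq> E" using es es' ay by simp
    have pe: "path_edges (a # p @ b # r @ [a]) \<subseteq> E" using ws(1) pr by (simp add: cyc_def)
    have split: "path_edges (a # p @ b # r @ [a]) = path_edges (a # p @ [b]) \<union> path_edges (b # r @ [a])"
      using path_edges_append[of "a # p" b "r @ [a]"] by simp
    have d: "distinct (a # p @ b # r)" using ws(1) pr by (simp add: cyc_def)
    have dd: "set es \<inter> set p = {}" "set es \<inter> set r = {}" "b \<notin> set es" "a \<notin> set es"
      using es pr by auto
    show False
    proof (cases "p = []")
      case True
      have "path_edges (a # es @ b # r @ [a]) \<subseteq> E"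
        using path_edges_append[of "a # es" b "r @ [a]"] ear pe split by auto
      then have "cyc E (a # es @ b # r)" using d dd es(3) True by (auto simp: cyc_def)
      from max[OF this] show False using ws(2) pr True es' by simp
    next
      case p: False
      show False
      proof (cases "r = []")
        case True
        have "path_edges (b # rev es @ [a]) = path_edges (a # es @ [b])"
          using path_edges_rev[of "a # es @ [b]"] by simp
        then have "path_edges (a # p @ b # rev es @ [a]) \<subseteq> E"
          using path_edges_append[of "a # p" b "rev es @ [a]"] ear pe split by auto
        then have "cyc E (a # p @ b # rev es)" using d dd es(3) True by (auto simp: cyc_def)
        from max[OF this] show False using ws(2) pr True es' by simp
      next
        case r: False
        have "path_edges (a # rev r @ [b]) = path_edges (b # r @ [a])"
          using path_edges_rev[of "b # r @ [a]"] by simp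
        then have "path_edges (a # rev r @ [b]) \<subseteq> E" "path_edges (a # p @ [b]) \<subseteq> E"
          using pe split by auto
        moreover have "distinct (a # p @ [b])" "distinct (a # rev r @ [b])" "distinct (a # es @ [b])"
          "set p \<inter> set (rev r) = {}" "set p \<inter> set es = {}" "set (rev r) \<inter> set es = {}" "rev r \<noteq> []"
          using d dd es(3) r by auto
        ultimately show False
          using no_three_paths[of a p b "rev r" es] ear p es(1) by blast
      qed
    qed
  qed
  then show ?thesis using vs by blast
qed

end

section \<open>Dissections as non-crossing sets of pairs\<close>

text \<open>Counting only the larger neighbours makes the degree split under gluing at a vertex
  \<open>c\<close>: in the left part \<open>c\<close> has no larger neighbour, so its degree comes
  from the right part alone.\<close>

definition rdeg :: "(nat \<times> nat) set \<Rightarrow> nat \<Rightarrow> nat" where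
  "rdeg D v = card {w. (v, w) \<in> D}"

definition crossfree :: "(nat \<times> nat) set \<Rightarrow> bool" where
  "crossfree D \<longleftrightarrow> (\<forall>i j k l. (i, j) \<in> D \<longrightarrow> (k, l) \<in> D \<longrightarrow> \<not> (i < k \<and> k < j \<and> j < l))"

definition pairs :: "nat \<Rightarrow> nat \<Rightarrow> (nat \<times> nat) set" where
  "pairs a b = {(i, j). a \<le> i \<and> i < j \<and> j \<le> b}"

text \<open>Chains of dissected polygons and single edges: all sides between consecutive vertices
  are present, the closing side \<open>(a, b)\<close> is optional and is demanded in
  \<open>Diss\<close>. Vertices from \<open>b\<close> on have right degree 0, so the set is empty
  unless \<open>0 \<in> K\<close>.\<close>

definition NC :: "nat set \<Rightarrow> nat \<Rightarrow> nat \<Rightarrow> (nat \<times> nat) set set" where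
  "NC K a b = {D. D \<subseteq> pairs a b \<and> (\<forall>i. a \<le> i \<and> i < b \<longrightarrow> (i, Suc i) \<in> D) \<and> crossfree D \<and>
     (\<forall>v. rdeg D v \<in> K)}"

definition Diss :: "nat set \<Rightarrow> nat set \<Rightarrow> nat \<Rightarrow> nat \<Rightarrow> (nat \<times> nat) set set" where
  "Diss K J a b = {D \<in> NC K a b. (a, b) \<in> D \<and> rdeg D a \<in> J}"

text \<open>Removing the closing side lowers the degree of the first vertex by one, and the
  restriction \<open>K\<close> has to survive this.\<close>

definition down_closed :: "nat set \<Rightarrow> bool" where
  "down_closed K \<longleftrightarrow> (\<forall>k\<in>K. \<forall>j\<le>k. j \<in> K)"

lemma finite_pairs: "finite (pairs a b)"
  by (rule finite_subset[of _ "{..b} \<times> {..b}"]) (auto simp: pairs_def)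

lemma finite_NC: "finite (NC K a b)"
  by (rule finite_subset[of _ "Pow (pairs a b)"]) (auto simp: NC_def finite_pairs)

lemma finite_Diss: "finite (Diss K J a b)"
  using finite_NC by (simp add: Diss_def)

lemma finite_nbrs: "D \<in> NC K a b \<Longrightarrow> finite {w. (v, w) \<in> D}"
  by (rule finite_subset[of _ "{..b}"]) (auto simp: NC_def pairs_def)

lemma NC_pairs: "D \<in> NC K a b \<Longrightarrow> (i, j) \<in> D \<Longrightarrow> a \<le> i \<and> i < j \<and> j \<le> b"
  by (auto simp: NC_def pairs_def)

lemma NC_crossfree: "D \<in> NC K a b \<Longrightarrow> (i, j) \<in> D \<Longrightarrow> (k, l) \<in> D \<Longrightarrow> i < k \<Longrightarrow> k < j \<Longrightarrow> l \<le> j"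
  unfolding NC_def crossfree_def by (auto simp: not_less) (meson not_le)

lemma NC_Suc: "D \<in> NC K a b \<Longrightarrow> a \<le> i \<Longrightarrow> i < b \<Longrightarrow> (i, Suc i) \<in> D"
  by (auto simp: NC_def)

lemma NC_rdeg: "D \<in> NC K a b \<Longrightarrow> rdeg D v \<in> K"
  by (auto simp: NC_def)

lemma rdeg_pos: "D \<in> NC K a b \<Longrightarrow> a < b \<Longrightarrow> rdeg D a > 0"
  unfolding rdeg_def using finite_nbrs[of D K a b a] NC_Suc[of D K a b a] by (subst card_gt_0_iff) auto

lemma NC_I:
  assumes "\<And>i j. (i, j) \<in> D \<Longrightarrow> a \<le> i \<and> i < j \<and> j \<le> b"
    and "\<And>i. a \<le> i \<Longrightarrow> i < b \<Longrightarrow> (i, Suc i) \<in> D"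
    and "\<And>i j k l. (i, j) \<in> D \<Longrightarrow> (k, l) \<in> D \<Longrightarrow> i < k \<Longrightarrow> k < j \<Longrightarrow> l \<le> j"
    and "\<And>v. rdeg D v \<in> K"
  shows "D \<in> NC K a b"
  unfolding NC_def pairs_def crossfree_def using assms by (auto simp: not_less) (meson not_le)

text \<open>If \<open>c\<close> is the last neighbour of \<open>a\<close>, no pair passes over
  \<open>c\<close>: starting at \<open>a\<close> it would give a later neighbour, and starting
  strictly between \<open>a\<close> and \<open>c\<close> it would cross \<open>(a, c)\<close>. So
  the configuration falls apart at \<open>c\<close>.\<close>

lemma glue_bij:
  assumes "a < c" "c < b"
  shows "bij_betw (\<lambda>(D1, D2). D1 \<union> D2) (Diss K J a c \<times> NC K c b)
     {D \<in> NC K a b. (a, c) \<in> D \<and> (\<forall>w. (a, w) \<in> D \<longrightarrow> w \<le> c) \<and> rdeg D a \<in> J}"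
    (is "bij_betw ?f ?A ?B")
proof (rule bij_betw_byWitness[where f' = "\<lambda>D. ({p \<in> D. snd p \<le> c}, {p \<in> D. c \<le> fst p})"])
  have L: "rdeg (D1 \<union> D2) v = (if v < c then rdeg D1 v else rdeg D2 v)"
    if "D1 \<in> NC K a c" "D2 \<in> NC K c b" for D1 D2 v
  proof (cases "v < c")
    case True
    then have "{w. (v, w) \<in> D1 \<union> D2} = {w. (v, w) \<in> D1}" using NC_pairs[OF that(2)] by fastforce
    then show ?thesis using True by (simp add: rdeg_def)
  next
    case False
    then have "{w. (v, w) \<in> D1 \<union> D2} = {w. (v, w) \<in> D2}" using NC_pairs[OF that(1)] by fastforce
    then show ?thesis using False by (simp add: rdeg_def)
  qed
  show "\<forall>p\<in>?A. ({q \<in> ?f p. snd q \<le> c}, {q \<in> ?f p. c \<le> fst q}) = p"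
  proof
    fix p assume "p \<in> ?A"
    then obtain D1 D2 where D: "p = (D1, D2)" "D1 \<in> NC K a c" "D2 \<in> NC K c b"
      by (auto simp: Diss_def)
    note p1 = NC_pairs[OF D(2)] and p2 = NC_pairs[OF D(3)]
    have "{q \<in> D1 \<union> D2. snd q \<le> c} = D1" using p1 p2 by fastforce
    moreover have "{q \<in> D1 \<union> D2. c \<le> fst q} = D2" using p1 p2 by fastforce
    ultimately show "({q \<in> ?f p. snd q \<le> c}, {q \<in> ?f p. c \<le> fst q}) = p" using D(1) by simp
  qed
  have split: "j \<le> c \<or> c \<le> i" if D: "D \<in> ?B" "(i, j) \<in> D" for D i j
  proof (rule ccontr)
    assume n: "\<not> ?thesis"
    have DN: "D \<in> NC K a b" using D by simp
    have "i \<noteq> a" using D n by auto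
    then have "a < i" "i < c" "c < j" using n NC_pairs[OF DN D(2)] by auto
    then show False using NC_crossfree[OF DN _ D(2), of a c] D(1) by auto
  qed
  show "\<forall>D\<in>?B. ?f ({p \<in> D. snd p \<le> c}, {p \<in> D. c \<le> fst p}) = D"
    using split by fastforce
  show "?f ` ?A \<subseteq> ?B"
  proof (rule image_subsetI)
    fix p assume "p \<in> ?A"
    then obtain D1 D2 where D: "p = (D1, D2)" "D1 \<in> Diss K J a c" "D2 \<in> NC K c b" by auto
    then have D1: "D1 \<in> NC K a c" "(a, c) \<in> D1" "rdeg D1 a \<in> J" by (auto simp: Diss_def)
    note p1 = NC_pairs[OF D1(1)] and p2 = NC_pairs[OF D(3)]
    have "D1 \<union> D2 \<in> NC K a b"
    proof (rule NC_I)
      show "a \<le> i \<and> i < j \<and> j \<le> b" if "(i, j) \<in> D1 \<union> D2" for i j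
        using that p1 p2 assms by fastforce
      show "(i, Suc i) \<in> D1 \<union> D2" if "a \<le> i" "i < b" for i
        using NC_Suc[OF D1(1), of i] NC_Suc[OF D(3), of i] that by fastforce
      show "l \<le> j" if "(i, j) \<in> D1 \<union> D2" "(k, l) \<in> D1 \<union> D2" "i < k" "k < j" for i j k l
        using that NC_crossfree[OF D1(1), of i j k l] NC_crossfree[OF D(3), of i j k l]
          p1[of i j] p2[of i j] p1[of k l] p2[of k l] by auto
      show "rdeg (D1 \<union> D2) v \<in> K" for v
        using L[OF D1(1) D(3)] NC_rdeg[OF D1(1)] NC_rdeg[OF D(3)] by simp
    qed
    moreover have "w \<le> c" if "(a, w) \<in> D1 \<union> D2" for w
      using that p1 p2 assms by fastforce
    ultimately show "?f p \<in> ?B"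
      using D1 L[OF D1(1) D(3), of a] assms D(1) by auto
  qed
  show "(\<lambda>D. ({p \<in> D. snd p \<le> c}, {p \<in> D. c \<le> fst p})) ` ?B \<subseteq> ?A"
  proof (rule image_subsetI)
    fix D assume D: "D \<in> ?B"
    then have DN: "D \<in> NC K a b" "(a, c) \<in> D" "rdeg D a \<in> J" by auto
    \<comment> \<open>The last vertex forces 0 into \<open>K\<close>; each part assigns degree 0 to
      the vertices outside its range.\<close>
    have "{w. (b, w) \<in> D} = {}" using NC_pairs[OF DN(1)] by fastforce
    then have K0: "0 \<in> K" using NC_rdeg[OF DN(1), of b] by (simp add: rdeg_def)
    note p = NC_pairs[OF DN(1)]
    let ?D1 = "{p \<in> D. snd p \<le> c}" and ?D2 = "{p \<in> D. c \<le> fst p}"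
    have r1: "rdeg ?D1 v = (if v < c then rdeg D v else 0)" for v
    proof (cases "v < c")
      case True
      then have "{w. (v, w) \<in> ?D1} = {w. (v, w) \<in> D}" using split[OF D] by fastforce
      then show ?thesis using True by (simp add: rdeg_def)
    next
      case False
      then have "{w. (v, w) \<in> ?D1} = {}" using p by fastforce
      then show ?thesis using False by (simp add: rdeg_def)
    qed
    have r2: "rdeg ?D2 v = (if v < c then 0 else rdeg D v)" for v
      by (simp add: rdeg_def)
    have "?D1 \<in> NC K a c"
    proof (rule NC_I)
      show "a \<le> i \<and> i < j \<and> j \<le> c" if "(i, j) \<in> ?D1" for i j using that p by auto
      show "(i, Suc i) \<in> ?D1" if "a \<le> i" "i < c" for i using that NC_Suc[OF DN(1)] assms by auto
      show "l \<le> j" if "(i, j) \<in> ?D1" "(k, l) \<in> ?D1" "i < k" "k < j" for i j k l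
        using NC_crossfree[OF DN(1)] that by auto
      show "rdeg ?D1 v \<in> K" for v using r1 NC_rdeg[OF DN(1)] K0 by simp
    qed
    moreover have "?D2 \<in> NC K c b"
    proof (rule NC_I)
      show "c \<le> i \<and> i < j \<and> j \<le> b" if "(i, j) \<in> ?D2" for i j using that p by auto
      show "(i, Suc i) \<in> ?D2" if "c \<le> i" "i < b" for i using that NC_Suc[OF DN(1)] assms by auto
      show "l \<le> j" if "(i, j) \<in> ?D2" "(k, l) \<in> ?D2" "i < k" "k < j" for i j k l
        using NC_crossfree[OF DN(1)] that by auto
      show "rdeg ?D2 v \<in> K" for v using r2 NC_rdeg[OF DN(1)] K0 by simp
    qed
    ultimately show "(?D1, ?D2) \<in> ?A" using DN r1[of a] assms by (simp add: Diss_def)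
  qed
qed

text \<open>Classification by the last neighbour of \<open>a\<close>: it exists because
  \<open>(a, Suc a)\<close> is present, and it is smaller than \<open>b\<close> because
  \<open>(a, b)\<close> is absent.\<close>

lemma card_unrooted:
  assumes "a < b"
  shows "card {D \<in> NC K a b. (a, b) \<notin> D \<and> rdeg D a \<in> J} = (\<Sum>c\<in>{a<..<b}. card (Diss K J a c) * card (NC K c b))"
proof -
  let ?B = "\<lambda>c. {D \<in> NC K a b. (a, c) \<in> D \<and> (\<forall>w. (a, w) \<in> D \<longrightarrow> w \<le> c) \<and> rdeg D a \<in> J}"
  have eq: "{D \<in> NC K a b. (a, b) \<notin> D \<and> rdeg D a \<in> J} = (\<Union>c\<in>{a<..<b}. ?B c)" (is "?L = ?R")
  proof
    show "?L \<subseteq> ?R"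
    proof
      fix D assume D: "D \<in> ?L"
      then have DN: "D \<in> NC K a b" by simp
      let ?S = "{w. (a, w) \<in> D}"
      have fin: "finite ?S" by (rule finite_nbrs[OF DN])
      have "Suc a \<in> ?S" using NC_Suc[OF DN] assms by simp
      then have M: "Max ?S \<in> ?S" using Max_in[OF fin] by blast
      then have "(a, Max ?S) \<in> D" by simp
      moreover from this have "a < Max ?S" "Max ?S < b"
        using NC_pairs[OF DN, of a "Max ?S"] D by (auto simp: order.strict_iff_order)
      moreover have "\<forall>w. (a, w) \<in> D \<longrightarrow> w \<le> Max ?S" using Max_ge[OF fin] by simp
      ultimately show "D \<in> ?R" using D by auto
    qed
    show "?R \<subseteq> ?L" by (auto simp: not_le[symmetric])
  qed
  have "card (\<Union>c\<in>{a<..<b}. ?B c) = (\<Sum>c\<in>{a<..<b}. card (?B c))"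
    by (intro card_UN_disjoint) (auto simp: finite_NC dest: le_antisym)
  also have "\<dots> = (\<Sum>c\<in>{a<..<b}. card (Diss K J a c) * card (NC K c b))"
  proof (intro sum.cong refl)
    fix c assume "c \<in> {a<..<b}"
    then show "card (?B c) = card (Diss K J a c) * card (NC K c b)"
      using bij_betw_same_card[OF glue_bij[of a c b K J]] by (simp add: card_cartesian_product)
  qed
  finally show ?thesis unfolding eq .
qed

text \<open>The closing side crosses nothing and, as \<open>Suc a < b\<close>, is not one of the
  compulsory sides. Deleting it is a bijection onto the unrooted configurations that lowers the root
  degree by one.\<close>

lemma card_rooted:
  assumes ab: "Suc a < b" and K: "down_closed K" and J: "\<And>j. j \<in> J \<Longrightarrow> Suc j \<in> K"
  shows "card (Diss K (Suc ` J) a b) = (\<Sum>c\<in>{a<..<b}. card (Diss K J a c) * card (NC K c b))"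
proof -
  let ?L = "{D \<in> NC K a b. (a, b) \<notin> D \<and> rdeg D a \<in> J}"
  have r: "rdeg (insert (a, b) D) v = (if v = a then Suc (rdeg D v) else rdeg D v)"
    if "D \<in> NC K a b" "(a, b) \<notin> D" for D v
  proof -
    have "{w. (v, w) \<in> insert (a, b) D} = (if v = a then insert b {w. (v, w) \<in> D} else {w. (v, w) \<in> D})"
      by auto
    then show ?thesis using that finite_nbrs[OF that(1), of v]
      by (cases "v = a") (simp_all add: rdeg_def)
  qed
  have r': "rdeg (D - {(a, b)}) v = (if v = a then rdeg D v - 1 else rdeg D v)"
    if "D \<in> NC K a b" "(a, b) \<in> D" for D v
  proof -
    have "{w. (v, w) \<in> D - {(a, b)}} = (if v = a then {w. (v, w) \<in> D} - {b} else {w. (v, w) \<in> D})"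
      by auto
    then show ?thesis using that finite_nbrs[OF that(1), of v] by (simp add: rdeg_def)
  qed
  have "bij_betw (insert (a, b)) ?L (Diss K (Suc ` J) a b)"
  proof (rule bij_betw_byWitness[where f' = "\<lambda>D. D - {(a, b)}"])
    show "insert (a, b) ` ?L \<subseteq> Diss K (Suc ` J) a b"
    proof (rule image_subsetI)
      fix D assume D: "D \<in> ?L"
      then have DN: "D \<in> NC K a b" by simp
      have "insert (a, b) D \<in> NC K a b"
      proof (rule NC_I)
        show "l \<le> j" if "(i, j) \<in> insert (a, b) D" "(k, l) \<in> insert (a, b) D" "i < k" "k < j" for i j k l
          using that NC_crossfree[OF DN, of i j k l] NC_pairs[OF DN, of k l] NC_pairs[OF DN, of i j] by auto
        show "rdeg (insert (a, b) D) v \<in> K" for v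
          using r[OF DN, of v] D J NC_rdeg[OF DN] by auto
      qed (use NC_pairs[OF DN] NC_Suc[OF DN] ab in auto)
      then show "insert (a, b) D \<in> Diss K (Suc ` J) a b"
        using r[OF DN, of a] D by (auto simp: Diss_def)
    qed
    show "(\<lambda>D. D - {(a, b)}) ` Diss K (Suc ` J) a b \<subseteq> ?L"
    proof (rule image_subsetI)
      fix D assume D: "D \<in> Diss K (Suc ` J) a b"
      then have DN: "D \<in> NC K a b" "(a, b) \<in> D" by (auto simp: Diss_def)
      have "D - {(a, b)} \<in> NC K a b"
      proof (rule NC_I)
        show "l \<le> j" if "(i, j) \<in> D - {(a, b)}" "(k, l) \<in> D - {(a, b)}" "i < k" "k < j" for i j k l
          using that NC_crossfree[OF DN(1), of i j k l] by auto
        show "rdeg (D - {(a, b)}) v \<in> K" for v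
          using r'[OF DN, of v] NC_rdeg[OF DN(1), of v] K by (auto simp: down_closed_def)
      qed (use NC_pairs[OF DN(1)] NC_Suc[OF DN(1)] ab in auto)
      then show "D - {(a, b)} \<in> ?L"
        using r'[OF DN, of a] D by (auto simp: Diss_def)
    qed
  qed (auto simp: Diss_def)
  then show ?thesis
    using card_unrooted[of a b K J] ab bij_betw_same_card by fastforce
qed

lemma card_NC:
  assumes "a < b"
  shows "card (NC K a b) = card (Diss K UNIV a b) + (\<Sum>c\<in>{a<..<b}. card (Diss K UNIV a c) * card (NC K c b))"
proof -
  have "NC K a b = Diss K UNIV a b \<union> {D \<in> NC K a b. (a, b) \<notin> D \<and> rdeg D a \<in> UNIV}"
    by (auto simp: Diss_def)
  then have "card (NC K a b) = card (Diss K UNIV a b \<union> {D \<in> NC K a b. (a, b) \<notin> D \<and> rdeg D a \<in> UNIV})"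
    by simp
  also have "\<dots> = card (Diss K UNIV a b) + card {D \<in> NC K a b. (a, b) \<notin> D \<and> rdeg D a \<in> UNIV}"
    by (intro card_Un_disjoint) (auto simp: finite_NC finite_Diss Diss_def)
  finally show ?thesis using card_unrooted[OF assms, of K UNIV] by simp
qed

lemma Diss_edge:
  assumes "0 \<in> K"
  shows "Diss K J a (Suc a) = (if 1 \<in> K \<inter> J then {{(a, Suc a)}} else {})"
proof -
  have eq: "D = {(a, Suc a)}" if "D \<in> NC K a (Suc a)" for D
    using NC_pairs[OF that] NC_Suc[OF that, of a] by fastforce
  have r: "rdeg {(a, Suc a)} v = (if v = a then 1 else 0)" for v
  proof -
    have "{w. (v, w) \<in> {(a, Suc a)}} = (if v = a then {Suc a} else {})" by auto
    then show ?thesis by (simp add: rdeg_def)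
  qed
  have "{(a, Suc a)} \<in> NC K a (Suc a) \<longleftrightarrow> 1 \<in> K"
  proof
    assume "{(a, Suc a)} \<in> NC K a (Suc a)"
    from NC_rdeg[OF this, of a] show "1 \<in> K" using r by simp
  next
    assume "1 \<in> K"
    then show "{(a, Suc a)} \<in> NC K a (Suc a)" using assms r by (intro NC_I) auto
  qed
  with eq have NC: "NC K a (Suc a) = (if 1 \<in> K then {{(a, Suc a)}} else {})"
    by (auto split: if_splits)
  show ?thesis using r[of a] by (auto simp: Diss_def NC)
qed

section \<open>Counting dissections\<close>

text \<open>The index \<open>N\<close> counts the sides other than the closing one, hence is
  additive under gluing; an \<open>n\<close>-gon has \<open>N = n - 1\<close>.\<close>

definition dcount :: "nat set \<Rightarrow> nat set \<Rightarrow> nat \<Rightarrow> real" where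
  "dcount K J N = real (card (Diss K J 0 N))"

definition ncount :: "nat set \<Rightarrow> nat \<Rightarrow> real" where
  "ncount K N = real (card (NC K 0 N))"

text \<open>Root degrees are positive and lie in \<open>K\<close>, so any \<open>J\<close> can be
  brought into the shape that \<open>card_rooted\<close> expects.\<close>

lemma Diss_Suc_image:
  assumes "a < b"
  shows "Diss K J a b = Diss K (Suc ` {j. Suc j \<in> J \<inter> K}) a b"
proof -
  have "rdeg D a \<in> J \<longleftrightarrow> rdeg D a \<in> Suc ` {j. Suc j \<in> J \<inter> K}" if D: "D \<in> NC K a b" for D
    using NC_rdeg[OF D, of a] rdeg_pos[OF D assms] by (cases "rdeg D a") auto
  then show ?thesis by (auto simp: Diss_def)
qed

lemma card_rooted':
  assumes "N \<ge> 2" "down_closed K"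
  shows "card (Diss K J a (a + N)) =
    (\<Sum>m\<in>{1..<N}. card (Diss K {j. Suc j \<in> J \<inter> K} a (a + m)) * card (NC K (a + m) (a + N)))"
proof -
  have "card (Diss K J a (a + N)) =
      (\<Sum>c\<in>{a<..<a+N}. card (Diss K {j. Suc j \<in> J \<inter> K} a c) * card (NC K c (a+N)))"
    using assms by (subst Diss_Suc_image) (auto intro!: card_rooted)
  also have "{a<..<a+N} = (+) a ` {1..<N}"
    using image_add_atLeastLessThan[of a 1 N] by auto
  finally show ?thesis by (subst (asm) sum.reindex) auto
qed

lemma card_NC':
  assumes "N \<ge> 1"
  shows "card (NC K a (a + N)) = card (Diss K UNIV a (a + N)) +
    (\<Sum>m\<in>{1..<N}. card (Diss K UNIV a (a + m)) * card (NC K (a + m) (a + N)))"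
proof -
  have "card (NC K a (a + N)) = card (Diss K UNIV a (a + N)) +
      (\<Sum>c\<in>{a<..<a+N}. card (Diss K UNIV a c) * card (NC K c (a+N)))"
    using assms by (intro card_NC) auto
  also have "{a<..<a+N} = (+) a ` {1..<N}"
    using image_add_atLeastLessThan[of a 1 N] by auto
  finally show ?thesis by (subst (asm) sum.reindex) auto
qed

text \<open>Translation invariance is read off from the recurrences by strong induction. The
  statement covers all \<open>J\<close> together because the recurrence changes
  \<open>J\<close>.\<close>

lemma card_translate:
  assumes K: "down_closed K" "0 \<in> K" and "N \<ge> 1"
  shows "(\<forall>J. card (Diss K J a (a + N)) = card (Diss K J 0 N)) \<and> card (NC K a (a + N)) = card (NC K 0 N)"
  using \<open>N \<ge> 1\<close>
proof (induction N arbitrary: a rule: less_induct)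
  case (less N)
  have NCm: "card (NC K (a + m) (a + N)) = card (NC K m N)" if "m \<in> {1..<N}" for m a
  proof -
    have "card (NC K (a + m) (a + m + (N - m))) = card (NC K 0 (N - m))"
      "card (NC K m (m + (N - m))) = card (NC K 0 (N - m))"
      using less.IH[of "N - m" "a + m"] less.IH[of "N - m" m] that by auto
    then show ?thesis using that by auto
  qed
  have D: "card (Diss K J a (a + N)) = card (Diss K J 0 N)" for J
  proof (cases "N = 1")
    case True then show ?thesis using Diss_edge[OF K(2)] by simp
  next
    case False
    then have N: "N \<ge> 2" using less.prems by simp
    show ?thesis
      using card_rooted'[OF N K(1), of J a] card_rooted'[OF N K(1), of J 0] NCm[of _ a] less.IH
      by simp
  qed
  moreover have "card (NC K a (a + N)) = card (NC K 0 N)"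
    using card_NC'[OF less.prems, of K a] card_NC'[OF less.prems, of K 0] NCm[of _ a] less.IH D by simp
  ultimately show ?case by blast
qed

lemma dcount_rec:
  assumes "down_closed K" "0 \<in> K" "N \<ge> 2"
  shows "dcount K J N = (\<Sum>m\<in>{1..<N}. dcount K {j. Suc j \<in> J \<inter> K} m * ncount K (N - m))"
proof -
  have "card (NC K m N) = card (NC K 0 (N - m))" if "m \<in> {1..<N}" for m
    using card_translate[OF assms(1,2), of "N - m" m] that by auto
  then show ?thesis
    using card_rooted'[OF assms(3,1), of J 0] by (simp add: dcount_def ncount_def)
qed

lemma ncount_rec:
  assumes "down_closed K" "0 \<in> K" "N \<ge> 1"
  shows "ncount K N = dcount K UNIV N + (\<Sum>m\<in>{1..<N}. dcount K UNIV m * ncount K (N - m))"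
proof -
  have "card (NC K m N) = card (NC K 0 (N - m))" if "m \<in> {1..<N}" for m
    using card_translate[OF assms(1,2), of "N - m" m] that by auto
  then show ?thesis
    using card_NC'[OF assms(3), of K 0] by (simp add: dcount_def ncount_def)
qed

lemma dcount_1: "0 \<in> K \<Longrightarrow> dcount K J 1 = (if 1 \<in> K \<inter> J then 1 else 0)"
  using Diss_edge[of K J 0] by (auto simp: dcount_def)

lemma dcount_nonneg [simp]: "dcount K J N \<ge> 0" and ncount_nonneg [simp]: "ncount K N \<ge> 0"
  by (simp_all add: dcount_def ncount_def)

lemma dcount_Suc:
  assumes "down_closed K" "0 \<in> K" "N \<ge> 2" "Suc j \<in> K"
  shows "dcount K {Suc j} N = (\<Sum>m\<in>{1..<N}. dcount K {j} m * ncount K (N - m))"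
proof -
  have "{i. Suc i \<in> {Suc j} \<inter> K} = {j}" using assms(4) by auto
  then show ?thesis using dcount_rec[OF assms(1-3), of "{Suc j}"] by simp
qed

lemma dcount_0: "N \<ge> 1 \<Longrightarrow> dcount K {0} N = 0"
proof -
  assume "N \<ge> 1"
  then have "Diss K {0} 0 N = {}" using rdeg_pos[of _ K 0 N] by (force simp: Diss_def)
  then show ?thesis by (simp add: dcount_def)
qed

lemma dcount_one:
  assumes "down_closed K" "0 \<in> K" "N \<ge> 2" "1 \<in> K"
  shows "dcount K {1} N = 0"
  using dcount_Suc[OF assms(1-3), of 0] assms(4) by (simp add: dcount_0)

lemma dcount_sum:
  assumes "N \<ge> 1"
  shows "dcount {..k} UNIV N = (\<Sum>j\<in>{1..k}. dcount {..k} {j} N)"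
proof -
  have "rdeg D 0 \<in> {1..k}" if "D \<in> NC {..k} 0 N" for D
    using rdeg_pos[OF that] NC_rdeg[OF that, of 0] assms by simp
  then have "Diss {..k} UNIV 0 N = (\<Union>j\<in>{1..k}. Diss {..k} {j} 0 N)"
    by (auto simp: Diss_def)
  moreover have "card (\<Union>j\<in>{1..k}. Diss {..k} {j} 0 N) = (\<Sum>j\<in>{1..k}. card (Diss {..k} {j} 0 N))"
    by (intro card_UN_disjoint) (auto simp: finite_Diss, auto simp: Diss_def)
  ultimately show ?thesis by (simp add: dcount_def)
qed

lemma rdeg_le:
  assumes "D \<in> NC K 0 N"
  shows "rdeg D v \<le> N"
proof -
  have "{w. (v, w) \<in> D} \<subseteq> {1..N}" using NC_pairs[OF assms] by fastforce
  then show ?thesis unfolding rdeg_def using card_mono[of "{1..N}"] by fastforce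
qed

lemma ncount_UNIV: "N \<le> k \<Longrightarrow> ncount UNIV N = ncount {..k} N"
proof -
  assume "N \<le> k"
  then have "NC UNIV 0 N = NC {..k} 0 N"
  proof (intro equalityI subsetI)
    fix D assume "D \<in> NC UNIV 0 N"
    then show "D \<in> NC {..k} 0 N" using rdeg_le[of D UNIV N] \<open>N \<le> k\<close>
      unfolding NC_def by (auto intro: order_trans)
  qed (auto simp: NC_def)
  then show ?thesis by (simp add: ncount_def)
qed

text \<open>Both indices \<open>i\<close> and \<open>N - i\<close> are positive, so pairs with sum
  at most \<open>Suc M\<close> consist of indices at most \<open>M\<close>. This gain of one drives
  the induction on partial sums below.\<close>

lemma Cauchy_product_le:
  fixes f g :: "nat \<Rightarrow> real"
  assumes "\<And>i. f i \<ge> 0" "\<And>i. g i \<ge> 0"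
  shows "(\<Sum>N\<in>{1..Suc M}. \<Sum>i\<in>{1..<N}. f i * g (N - i)) \<le> sum f {1..M} * sum g {1..M}"
proof -
  have "(\<Sum>N\<in>{1..Suc M}. \<Sum>i\<in>{1..<N}. f i * g (N - i)) =
      (\<Sum>(N,i)\<in>(SIGMA N:{1..Suc M}. {1..<N}). f i * g (N - i))"
    by (rule sum.Sigma) auto
  also have "\<dots> = (\<Sum>(i,l)\<in>(\<lambda>(N,i). (i, N - i)) ` (SIGMA N:{1..Suc M}. {1..<N}). f i * g l)"
    by (subst sum.reindex) (auto simp: inj_on_def intro!: sum.cong)
  also have "\<dots> \<le> (\<Sum>(i,l)\<in>{1..M} \<times> {1..M}. f i * g l)"
    using assms by (intro sum_mono2) auto
  also have "\<dots> = sum f {1..M} * sum g {1..M}"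
    by (simp add: sum_product sum.cartesian_product)
  finally show ?thesis .
qed

section \<open>Partial sums of the counting series near the critical point\<close>

definition q :: real where "q = sqrt 2 - 1"

lemma q_eq: "q\<^sup>2 + 2 * q = 1" and q_pos: "0 < q" and q_less: "q < 1/2"
proof -
  show "q\<^sup>2 + 2 * q = 1" by (simp add: q_def power2_eq_square algebra_simps)
  show "0 < q" by (simp add: q_def)
  have "sqrt 2 < 1.5" by (rule real_less_lsqrt) (auto simp: power2_eq_square)
  then show "q < 1/2" by (simp add: q_def)
qed

text \<open>A bootstrap on truncated sums. If the sum up to \<open>M\<close> is at most q, the part
  with root degree j + 1 up to \<open>Suc M\<close> is at most x q^j: the root edge gives x, each
  further neighbour a factor at most q. Summing over j < k gives at most x (1 - q^k) / (1 - q),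
  hence at most q^2 / (1 - q) by the choice of x. Multiplying by 1 + q for the remaining chain
  returns exactly q, because q^2 + 2 q = 1.\<close>

lemma ncount_partial_sum:
  assumes x: "0 \<le> x" "x * (1 - q ^ k) \<le> q\<^sup>2"
  shows "(\<Sum>N\<in>{1..M}. ncount {..k} N * x ^ N) \<le> q"
proof (induction M)
  case 0 then show ?case using q_pos by simp
next
  case (Suc M)
  let ?K = "{..k}"
  let ?S = "\<lambda>M. \<Sum>N\<in>{1..M}. ncount ?K N * x ^ N"
  let ?A = "\<lambda>J M. \<Sum>N\<in>{1..M}. dcount ?K J N * x ^ N"
  have K: "down_closed ?K" "0 \<in> ?K" by (auto simp: down_closed_def)
  have prod: "(\<Sum>N\<in>{1..Suc M}. (\<Sum>m\<in>{1..<N}. dcount ?K J m * ncount ?K (N - m)) * x ^ N) \<le> ?A J M * ?S M" for J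
  proof -
    have "(\<Sum>N\<in>{1..Suc M}. (\<Sum>m\<in>{1..<N}. dcount ?K J m * ncount ?K (N - m)) * x ^ N) =
      (\<Sum>N\<in>{1..Suc M}. (\<Sum>m\<in>{1..<N}. (dcount ?K J m * x ^ m) * (ncount ?K (N - m) * x ^ (N - m))))"
      unfolding sum_distrib_right
      by (intro sum.cong refl) (auto simp: mult_ac simp flip: power_add)
    also have "\<dots> \<le> ?A J M * ?S M"
      using x by (intro Cauchy_product_le) auto
    finally show ?thesis .
  qed
  have A_mono: "?A J M \<le> ?A J (Suc M)" for J using x by simp
  have A_nonneg: "?A J M \<ge> 0" for J M using x by (intro sum_nonneg) auto
  have S_nonneg: "?S M \<ge> 0" using x by (intro sum_nonneg) auto
  note IHM = Suc.IH
  have Aj: "?A {Suc j} (Suc M) \<le> x * q ^ j" if "Suc j \<le> k" for j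
    using that
  proof (induction j)
    case 0
    have "?A {Suc 0} (Suc M) = (\<Sum>N\<in>{1..Suc M}. if N = 1 then x else 0)"
      using dcount_1[OF K(2), of "{1}"] dcount_one[OF K] 0 by (intro sum.cong refl) (auto simp: not_le)
    then show ?case by simp
  next
    case (Suc j)
    have "?A {Suc (Suc j)} (Suc M) \<le> (\<Sum>N\<in>{1..Suc M}. (\<Sum>m\<in>{1..<N}. dcount ?K {Suc j} m * ncount ?K (N - m)) * x ^ N)"
    proof (intro sum_mono)
      fix N assume N: "N \<in> {1..Suc M}"
      show "dcount ?K {Suc (Suc j)} N * x ^ N \<le> (\<Sum>m\<in>{1..<N}. dcount ?K {Suc j} m * ncount ?K (N - m)) * x ^ N"
      proof (cases "N = 1")
        case True then show ?thesis using dcount_1[OF K(2)] by simp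
      next
        case False
        then show ?thesis using N dcount_Suc[OF K, of N "Suc j"] Suc.prems by simp
      qed
    qed
    also have "\<dots> \<le> ?A {Suc j} M * ?S M" by (rule prod)
    also have "\<dots> \<le> (x * q ^ j) * q"
    proof (rule mult_mono)
      show "?A {Suc j} M \<le> x * q ^ j"
        using Suc.IH Suc.prems A_mono[of "{Suc j}"] by linarith
    qed (use IHM S_nonneg x q_pos in auto)
    finally show ?case by (simp add: mult_ac)
  qed
  have "?A UNIV (Suc M) = (\<Sum>j\<in>{1..k}. ?A {j} (Suc M))"
    by (subst sum.swap) (auto simp: dcount_sum sum_distrib_right intro!: sum.cong)
  also have "{1..k} = Suc ` {..<k}" by (simp add: image_Suc_lessThan)
  also have "(\<Sum>j\<in>Suc ` {..<k}. ?A {j} (Suc M)) = (\<Sum>j<k. ?A {Suc j} (Suc M))"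
    by (subst sum.reindex) auto
  also have "\<dots> \<le> (\<Sum>j<k. x * q ^ j)"
    using Aj by (intro sum_mono) auto
  also have "\<dots> = x * (1 - q ^ k) / (1 - q)"
    using q_less by (simp add: sum_gp_strict flip: sum_distrib_left)
  also have "\<dots> \<le> q\<^sup>2 / (1 - q)"
    using x q_less by (intro divide_right_mono) auto
  finally have A: "?A UNIV (Suc M) \<le> q\<^sup>2 / (1 - q)" .
  have "?S (Suc M) = ?A UNIV (Suc M) +
      (\<Sum>N\<in>{1..Suc M}. (\<Sum>m\<in>{1..<N}. dcount ?K UNIV m * ncount ?K (N - m)) * x ^ N)"
    unfolding sum.distrib[symmetric] using ncount_rec[OF K]
    by (intro sum.cong refl) (simp add: distrib_right)
  also have "\<dots> \<le> ?A UNIV (Suc M) + ?A UNIV M * ?S M"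
    using prod by simp
  also have "\<dots> \<le> ?A UNIV (Suc M) + ?A UNIV (Suc M) * q"
    using A_mono[of UNIV] IHM A_nonneg S_nonneg by (intro add_left_mono mult_mono) auto
  also have "\<dots> = ?A UNIV (Suc M) * (1 + q)" by (simp add: algebra_simps)
  also have "\<dots> \<le> q\<^sup>2 / (1 - q) * (1 + q)"
    using A q_pos by (intro mult_right_mono) auto
  also have "\<dots> = q"
  proof -
    have "q\<^sup>2 * (1 + q) = q * (q\<^sup>2 + 2 * q) - q\<^sup>2" by (simp add: power2_eq_square algebra_simps)
    also have "\<dots> = q * (1 - q)" unfolding q_eq by (simp add: power2_eq_square algebra_simps)
    finally show ?thesis using q_less by simp
  qed
  finally show ?case .
qed

text \<open>The point q^2 (1 + q^k) is admissible because (1 + q^k) (1 - q^k) is at most 1; a single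
  term is then at most the whole sum, which is below 1.\<close>

lemma restricted_count_bound:
  assumes "N \<ge> 1"
  shows "dcount {..k} UNIV N \<le> (1 / (q\<^sup>2 * (1 + q ^ k))) ^ N"
proof -
  let ?x = "q\<^sup>2 * (1 + q ^ k)"
  have x: "?x > 0" using q_pos by (simp add: add_pos_nonneg)
  have "?x * (1 - q ^ k) = q\<^sup>2 * (1 - (q ^ k)\<^sup>2)" by (simp add: power2_eq_square algebra_simps)
  also have "\<dots> \<le> q\<^sup>2" using q_pos by (simp add: mult_le_cancel_left1)
  finally have "(\<Sum>N\<in>{1..N}. ncount {..k} N * ?x ^ N) \<le> q"
    using x by (intro ncount_partial_sum) auto
  moreover have "ncount {..k} N * ?x ^ N \<le> (\<Sum>N\<in>{1..N}. ncount {..k} N * ?x ^ N)"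
    using x assms by (intro member_le_sum) auto
  moreover have "dcount {..k} UNIV N \<le> ncount {..k} N"
    unfolding dcount_def ncount_def by (auto intro!: card_mono finite_NC simp: Diss_def)
  then have "dcount {..k} UNIV N * ?x ^ N \<le> ncount {..k} N * ?x ^ N"
    using x by (intro mult_right_mono) auto
  ultimately have "dcount {..k} UNIV N * ?x ^ N \<le> 1" using q_less by linarith
  then show ?thesis using x by (simp add: power_one_over field_simps)
qed

text \<open>Up to index \<open>M\<close> the degree restriction \<open>{..M}\<close> is
  vacuous.\<close>

lemma ncount_UNIV_partial_sum: "(\<Sum>N\<in>{1..M}. ncount UNIV N * (q\<^sup>2) ^ N) \<le> q"
proof -
  have "(\<Sum>N\<in>{1..M}. ncount {..M} N * (q\<^sup>2) ^ N) \<le> q"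
    using q_pos by (intro ncount_partial_sum) auto
  then show ?thesis using ncount_UNIV[of _ M] by simp
qed

section \<open>Recurrence and growth of the unrestricted counts\<close>

lemma down_closed_UNIV: "down_closed UNIV" by (simp add: down_closed_def)

lemma UNIV_1: "dcount UNIV UNIV 1 = 1" "ncount UNIV 1 = 1"
proof -
  show "dcount UNIV UNIV 1 = 1" using dcount_1[of UNIV UNIV] by simp
  then show "ncount UNIV 1 = 1" using ncount_rec[OF down_closed_UNIV, of 1] by simp
qed

lemma UNIV_conv:
  assumes "N \<ge> 2"
  shows "(\<Sum>m\<in>{1..<N}. dcount UNIV UNIV m * ncount UNIV (N - m)) = dcount UNIV UNIV N"
  using dcount_rec[OF down_closed_UNIV _ assms, of UNIV] by simp

text \<open>For \<open>N \<ge> 2\<close> inserting or deleting the closing side pairs off the chains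
  with and without it.\<close>

lemma UNIV_double: "N \<ge> 2 \<Longrightarrow> ncount UNIV N = 2 * dcount UNIV UNIV N"
  using ncount_rec[OF down_closed_UNIV, of N] UNIV_conv[of N] by simp

text \<open>The generating function \<open>W\<close> of \<open>ncount UNIV\<close> satisfies \<open>W = X + X W + W\<^sup>2\<close>, so
  \<open>S = 1 - X - 2 W\<close> is a square root of \<open>1 - 6 X + X\<^sup>2\<close>; comparing coefficients in
  \<open>(1 - 6 X + X\<^sup>2) S' = (X - 3) S\<close> gives the recurrence.\<close>

lemma ncount_three_term:
  assumes "n \<ge> 2"
  shows "(real n + 1) * ncount UNIV (Suc n) = (6 * real n - 3) * ncount UNIV n - (real n - 2) * ncount UNIV (n - 1)"
proof -
  define W where "W = Abs_fps (\<lambda>N. if N = 0 then 0 else ncount UNIV N)"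
  define B where "B = Abs_fps (\<lambda>N. if N = 0 then 0 else dcount UNIV UNIV N)"
  have conv: "fps_nth (B * W) N = (if N \<ge> 2 then dcount UNIV UNIV N else 0)" for N
  proof -
    have "fps_nth (B * W) N = (\<Sum>i=0..N. (if i = 0 then 0 else dcount UNIV UNIV i) * (if N - i = 0 then 0 else ncount UNIV (N - i)))"
      by (simp add: fps_mult_nth W_def B_def)
    also have "\<dots> = (\<Sum>i\<in>{1..<N}. dcount UNIV UNIV i * ncount UNIV (N - i))"
      by (rule sum.mono_neutral_cong_right) auto
    finally show ?thesis using UNIV_conv[of N] by (cases "N \<ge> 2") auto
  qed
  have B: "B = fps_X + B * W"
  proof (rule fps_ext)
    fix n :: nat
    have "fps_nth (fps_X + B * W) n = (if n = 1 then 1 else 0) + fps_nth (B * W) n"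
      by (simp add: fps_X_def)
    also have "\<dots> = fps_nth B n"
    proof -
      have "n = 0 \<or> n = 1 \<or> n \<ge> 2" by linarith
      then show ?thesis unfolding conv using UNIV_1 by (auto simp: B_def)
    qed
    finally show "fps_nth B n = fps_nth (fps_X + B * W) n" by simp
  qed
  have WB: "W + fps_X = 2 * B"
  proof (rule fps_ext)
    fix n :: nat
    have "n = 0 \<or> n = 1 \<or> n \<ge> 2" by linarith
    then show "fps_nth (W + fps_X) n = fps_nth (2 * B) n"
      using UNIV_1 UNIV_double[of n] by (auto simp: W_def B_def fps_X_def numeral_fps_const)
  qed
  define S where "S = 1 - fps_X - 2 * W"
  have "2 * B = 2 * fps_X + (2 * B) * W" using B by (metis distrib_left mult.assoc)
  then have "W + fps_X = 2 * fps_X + (W + fps_X) * W" using WB by simp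
  then have W: "W * W = W - fps_X - fps_X * W" by (simp add: algebra_simps)
  have "S * S = (1 - fps_X) * (1 - fps_X) - 4 * (1 - fps_X) * W + 4 * (W * W)"
    by (simp add: S_def algebra_simps)
  also have "\<dots> = 1 - 6 * fps_X + fps_X * fps_X" unfolding W by (simp add: algebra_simps)
  finally have SS: "S * S = 1 - 6 * fps_X + fps_X * fps_X" .
  have "fps_deriv (S * S) = 2 * (S * fps_deriv S)" by (simp add: mult.commute)
  then have "2 * (S * fps_deriv S) = 2 * (fps_X - 3)" unfolding SS by (simp add: algebra_simps)
  then have d: "S * fps_deriv S = fps_X - 3" by (subst (asm) mult_left_cancel) auto
  have "(1 - 6 * fps_X + fps_X * fps_X) * fps_deriv S = S * (S * fps_deriv S)"
    using SS by (simp add: mult.assoc)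
  then have ode: "fps_deriv S - 6 * (fps_X * fps_deriv S) + fps_X * (fps_X * fps_deriv S) = fps_X * S - 3 * S"
    unfolding d by (simp add: algebra_simps)
  have "fps_nth (fps_deriv S - 6 * (fps_X * fps_deriv S) + fps_X * (fps_X * fps_deriv S)) n = fps_nth (fps_X * S - 3 * S) n"
    using ode by simp
  then have eq: "(real n + 1) * fps_nth S (Suc n) - 6 * (real n * fps_nth S n) + (real n - 1) * fps_nth S (n - 1) = fps_nth S (n - 1) - 3 * fps_nth S n"
    using assms by (cases n; cases "n - 1") (auto simp: numeral_fps_const fps_mult_left_const_nth add.commute)
  have Sn: "fps_nth S m = - 2 * ncount UNIV m" if "m \<ge> 2" for m
    using that by (auto simp: S_def W_def fps_X_def numeral_fps_const)
  \<comment> \<open>The linear coefficient of \<open>S\<close> is -3, not -2, owing to the summand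
    \<open>fps_X\<close>; it enters only for \<open>n = 2\<close>, where its factor
    \<open>n - 2\<close> vanishes.\<close>
  show ?thesis
  proof (cases "n = 2")
    case True
    then show ?thesis using eq Sn[of 2] Sn[of 3] by simp
  next
    case False
    then show ?thesis using eq Sn[of n] Sn[of "Suc n"] Sn[of "n - 1"] assms by (simp add: algebra_simps)
  qed
qed

text \<open>The square-root singularity at q^2 suggests growth like q^(-2n) n^(-3/2); the weight n^2
  overcompensates and leaves the slack that closes the induction. The induction hypothesis bounds
  the subtracted term of the three-term recurrence.\<close>

lemma ncount_ratio:
  assumes "n \<ge> 1"
  shows "ncount UNIV n > 0 \<and> (real n)\<^sup>2 * ncount UNIV n \<le> (real n + 1)\<^sup>2 * q\<^sup>2 * ncount UNIV (Suc n)"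
proof -
  let ?w = "ncount UNIV"
  have w2: "?w 2 = 2"
    using UNIV_double[of 2] UNIV_conv[of 2] UNIV_1 by (simp add: numeral_2_eq_2)
  have w3: "?w (Suc 2) = 6"
    using ncount_three_term[of 2] w2 by simp
  have w2': "?w (Suc (Suc 0)) = 2" and w1: "?w (Suc 0) = 1"
    using w2 UNIV_1 by (simp_all add: numeral_2_eq_2)
  have qq: "q\<^sup>2 = 3 - 2 * sqrt 2" by (simp add: q_def power2_eq_square algebra_simps)
  have s: "1.414 \<le> sqrt 2" "sqrt 2 \<le> 1.415"
    by (rule real_le_rsqrt, simp add: power2_eq_square) (rule real_le_lsqrt, auto simp: power2_eq_square)
  consider "n = 1" | "n = 2" | "n \<ge> 2" using assms by linarith
  then show ?thesis
  proof cases
    case 1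
    then show ?thesis using w1 w2' s by (simp add: qq)
  next
    case 2
    then show ?thesis using w2 w3 s by (simp add: qq)
  next
    case 3
    then show ?thesis
    proof (induction n rule: dec_induct)
      case base
      then show ?case using w2 w3 s by (simp add: qq)
    next
      case (step n)
      define r where "r = q\<^sup>2"
      define l where "l = 1 / r"
      have r: "r > 0" "r = 3 - 2 * sqrt 2" using q_pos by (simp add: r_def, simp add: r_def qq)
      have l: "l = 3 + 2 * sqrt 2"
      proof -
        have "r * (3 + 2 * sqrt 2) = 1" unfolding r(2) by (simp add: algebra_simps)
        then show ?thesis using r(1) by (simp add: l_def divide_eq_eq mult.commute)
      qed
      have rl: "r + l = 6" "r * l = 1" using r(1) by (simp add: r(2) l, simp add: l_def)
      define m where "m = real n"
      have m: "m \<ge> 2" using step by (simp add: m_def)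
      have rec: "(m + 2) * ?w (Suc (Suc n)) = (6 * m + 3) * ?w (Suc n) - (m - 1) * ?w n"
        using ncount_three_term[of "Suc n"] step by (simp add: m_def algebra_simps)
      have IH: "?w n > 0" "m\<^sup>2 * ?w n \<le> (m + 1)\<^sup>2 * r * ?w (Suc n)"
        using step by (auto simp: m_def r_def)
      have pos: "?w (Suc n) > 0"
      proof -
        have "0 < m\<^sup>2 * ?w n" using IH m by auto
        then have "0 < ((m + 1)\<^sup>2 * r) * ?w (Suc n)" using IH by linarith
        moreover have "(m + 1)\<^sup>2 * r > 0" using r m by auto
        ultimately show ?thesis by (simp add: zero_less_mult_iff)
      qed
      \<comment> \<open>The polynomial inequality left after eliminating \<open>?w n\<close>.
        Replacing \<open>r\<close> by \<open>6 - l\<close> makes the difference linear in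
        \<open>l\<close>, with nonnegative coefficient \<open>(m - 2) * (m + 1)\<^sup>2\<close>; 5.8
        is a rational lower bound for \<open>l\<close>.\<close>
      have key: "(m + 1)\<^sup>2 * l * m\<^sup>2 + (m - 1) * (m + 2) * (m + 1)\<^sup>2 * r \<le> (6 * m + 3) * (m + 2) * m\<^sup>2"
      proof -
        have "(6 * m + 3) * (m + 2) * m\<^sup>2 - ((m + 1)\<^sup>2 * l * m\<^sup>2 + (m - 1) * (m + 2) * (m + 1)\<^sup>2 * (6 - l))
          = (m - 2) * (m + 1)\<^sup>2 * (l - 5.8) + (2.8 * m ^ 3 + 0.6 * m + 0.4)"
          by (simp add: power2_eq_square power3_eq_cube field_simps)
        moreover have "(m - 2) * (m + 1)\<^sup>2 * (l - 5.8) \<ge> 0"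
          using m l s by (intro mult_nonneg_nonneg) auto
        moreover have "2.8 * m ^ 3 + 0.6 * m + 0.4 \<ge> 0" using m by simp
        moreover have "r = 6 - l" using rl by simp
        ultimately show ?thesis by simp
      qed
      have "m\<^sup>2 * ((m + 1)\<^sup>2 * l * ?w (Suc n)) \<le> m\<^sup>2 * ((m + 2)\<^sup>2 * ?w (Suc (Suc n)))"
      proof -
        have "m\<^sup>2 * ((m + 1)\<^sup>2 * l * ?w (Suc n)) + (m - 1) * (m + 2) * (m\<^sup>2 * ?w n)
           \<le> m\<^sup>2 * ((m + 1)\<^sup>2 * l * ?w (Suc n)) + (m - 1) * (m + 2) * ((m + 1)\<^sup>2 * r * ?w (Suc n))"
          using IH m by (intro add_left_mono mult_left_mono) auto
        also have "\<dots> = ((m + 1)\<^sup>2 * l * m\<^sup>2 + (m - 1) * (m + 2) * (m + 1)\<^sup>2 * r) * ?w (Suc n)"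
          by (simp add: algebra_simps)
        also have "\<dots> \<le> ((6 * m + 3) * (m + 2) * m\<^sup>2) * ?w (Suc n)"
          using key pos by (intro mult_right_mono) auto
        finally have "m\<^sup>2 * ((m + 1)\<^sup>2 * l * ?w (Suc n)) \<le> (m + 2) * m\<^sup>2 * ((6 * m + 3) * ?w (Suc n) - (m - 1) * ?w n)"
          by (simp add: algebra_simps)
        then show ?thesis unfolding rec[symmetric] by (simp add: power2_eq_square mult_ac)
      qed
      then have "(m + 1)\<^sup>2 * l * ?w (Suc n) \<le> (m + 2)\<^sup>2 * ?w (Suc (Suc n))"
        using m by (simp add: mult_le_cancel_left_pos)
      then have "r * ((m + 1)\<^sup>2 * l * ?w (Suc n)) \<le> r * ((m + 2)\<^sup>2 * ?w (Suc (Suc n)))"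
        using r by (intro mult_left_mono) auto
      also have "r * ((m + 1)\<^sup>2 * l * ?w (Suc n)) = (r * l) * ((m + 1)\<^sup>2 * ?w (Suc n))"
        by (simp add: mult_ac)
      also have "\<dots> = (m + 1)\<^sup>2 * ?w (Suc n)" unfolding rl(2) by simp
      finally show ?case using pos by (simp add: m_def r_def mult_ac add.commute)
    qed
  qed
qed

definition scaled :: "nat \<Rightarrow> real" where "scaled N = ncount UNIV N * (q\<^sup>2) ^ N"

lemma scaled_nonneg [simp]: "scaled n \<ge> 0"
  by (simp add: scaled_def)

text \<open>The substitute for asymptotics: \<open>scaled m\<close> exceeds \<open>scaled n\<close>
  by at most the factor (n / m)^2.\<close>

lemma scaled_regular:
  assumes "1 \<le> m" "m \<le> n"
  shows "(real m)\<^sup>2 * scaled m \<le> (real n)\<^sup>2 * scaled n"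
  using assms(2,1)
proof (induction n rule: dec_induct)
  case (step n)
  have "(real n)\<^sup>2 * scaled n = ((real n)\<^sup>2 * ncount UNIV n) * (q\<^sup>2) ^ n" by (simp add: scaled_def)
  also have "\<dots> \<le> ((real n + 1)\<^sup>2 * q\<^sup>2 * ncount UNIV (Suc n)) * (q\<^sup>2) ^ n"
    using ncount_ratio[of n] step by (intro mult_right_mono) auto
  also have "\<dots> = (real (Suc n))\<^sup>2 * scaled (Suc n)" by (simp add: scaled_def add.commute)
  finally show ?case using step by linarith
qed auto

text \<open>Comparison with index 1, where \<open>scaled\<close> equals q^2; the 2 in the
  denominator comes from \<open>UNIV_double\<close>.\<close>

lemma dissection_count_lower:
  assumes "N \<ge> 2"
  shows "dcount UNIV UNIV N * (q\<^sup>2) ^ N \<ge> q\<^sup>2 / (2 * (real N)\<^sup>2)"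
proof -
  have "q\<^sup>2 = (real 1)\<^sup>2 * scaled 1" using UNIV_1 by (simp add: scaled_def)
  also have "\<dots> \<le> (real N)\<^sup>2 * scaled N" using assms by (intro scaled_regular) auto
  also have "\<dots> = (real N)\<^sup>2 * (2 * (dcount UNIV UNIV N * (q\<^sup>2) ^ N))"
    using UNIV_double[OF assms] by (simp add: scaled_def)
  finally show ?thesis using assms by (simp add: divide_le_eq mult_ac)
qed

lemma dissections_pos:
  assumes "N \<ge> 2"
  shows "dcount UNIV UNIV N > 0"
  using ncount_ratio[of N] UNIV_double[OF assms] assms by simp

text \<open>The coefficient of X^m in W^j, scaled by q^(2m). The series for root degree j + 1 is X
  W^j, whence the shift to \<open>Suc m\<close> in the count but not in the power.\<close>

definition rooted_weight :: "nat \<Rightarrow> nat \<Rightarrow> real" where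
  "rooted_weight j m = dcount UNIV {Suc j} (Suc m) * (q\<^sup>2) ^ m"

lemma rooted_weight_nonneg [simp]: "rooted_weight j m \<ge> 0"
  by (simp add: rooted_weight_def)

text \<open>Only the single edge has root degree 1, so the convolution collapses to its first
  term.\<close>

lemma rooted_weight_1: "m \<ge> 1 \<Longrightarrow> rooted_weight 1 m = scaled m"
proof -
  assume m: "m \<ge> 1"
  have "dcount UNIV {Suc 1} (Suc m) = (\<Sum>i\<in>{1..<Suc m}. dcount UNIV {1} i * ncount UNIV (Suc m - i))"
    using dcount_Suc[OF down_closed_UNIV, of "Suc m" 1] m by simp
  also have "\<dots> = (\<Sum>i\<in>{1}. dcount UNIV {1} i * ncount UNIV (Suc m - i))"
    using m dcount_one[OF down_closed_UNIV] by (intro sum.mono_neutral_right) auto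
  also have "\<dots> = ncount UNIV m" using dcount_1[of UNIV "{1}"] by simp
  finally show ?thesis by (simp add: rooted_weight_def scaled_def)
qed

lemma rooted_weight_Suc:
  assumes "j \<ge> 1" "m \<ge> 1"
  shows "rooted_weight (Suc j) m = (\<Sum>i\<in>{1..<m}. rooted_weight j i * scaled (m - i))"
proof -
  \<comment> \<open>The single edge has root degree 1 < \<open>Suc j\<close>; dropping the first
    term makes both index ranges match after the shift.\<close>
  have 1: "dcount UNIV {Suc j} 1 = 0" using dcount_1[of UNIV "{Suc j}"] assms by simp
  have "dcount UNIV {Suc (Suc j)} (Suc m) = (\<Sum>i\<in>{1..<Suc m}. dcount UNIV {Suc j} i * ncount UNIV (Suc m - i))"
    using dcount_Suc[OF down_closed_UNIV, of "Suc m" "Suc j"] assms by simp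
  also have "\<dots> = (\<Sum>i\<in>{Suc 1..<Suc m}. dcount UNIV {Suc j} i * ncount UNIV (Suc m - i))"
  proof (intro sum.mono_neutral_right ballI)
    fix i assume "i \<in> {1..<Suc m} - {Suc 1..<Suc m}"
    then have "i = 1" by auto
    then show "dcount UNIV {Suc j} i * ncount UNIV (Suc m - i) = 0" using 1 by simp
  qed auto
  also have "\<dots> = (\<Sum>i\<in>{1..<m}. dcount UNIV {Suc j} (Suc i) * ncount UNIV (m - i))"
    by (subst sum.shift_bounds_Suc_ivl) simp
  finally have "rooted_weight (Suc j) m = (\<Sum>i\<in>{1..<m}. dcount UNIV {Suc j} (Suc i) * ncount UNIV (m - i) * (q\<^sup>2) ^ m)"
    by (simp add: rooted_weight_def sum_distrib_right)
  also have "\<dots> = (\<Sum>i\<in>{1..<m}. rooted_weight j i * scaled (m - i))"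
  proof (rule sum.cong[OF refl])
    fix i assume "i \<in> {1..<m}"
    then have "(q\<^sup>2) ^ m = (q\<^sup>2) ^ i * (q\<^sup>2) ^ (m - i)" by (simp flip: power_add)
    then show "dcount UNIV {Suc j} (Suc i) * ncount UNIV (m - i) * (q\<^sup>2) ^ m = rooted_weight j i * scaled (m - i)"
      by (simp add: rooted_weight_def scaled_def)
  qed
  finally show ?thesis .
qed

lemma scaled_partial_sum: "(\<Sum>i\<in>{1..M}. scaled i) \<le> q"
  using ncount_UNIV_partial_sum by (simp add: scaled_def)

lemma rooted_weight_partial_sum:
  assumes "j \<ge> 1"
  shows "(\<Sum>i\<in>{1..M}. rooted_weight j i) \<le> q ^ j"
  using assms
proof (induction j arbitrary: M rule: dec_induct)
  case base
  have "(\<Sum>i\<in>{1..M}. rooted_weight 1 i) = (\<Sum>i\<in>{1..M}. scaled i)"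
    using rooted_weight_1 by (intro sum.cong) auto
  then show ?case using scaled_partial_sum by simp
next
  case (step j)
  have "(\<Sum>i\<in>{1..M}. rooted_weight (Suc j) i) = (\<Sum>N\<in>{1..M}. \<Sum>i\<in>{1..<N}. rooted_weight j i * scaled (N - i))"
    using rooted_weight_Suc step by (intro sum.cong) auto
  also have "\<dots> \<le> (\<Sum>N\<in>{1..Suc M}. \<Sum>i\<in>{1..<N}. rooted_weight j i * scaled (N - i))"
    by (intro sum_mono2) (auto intro!: sum_nonneg)
  also have "\<dots> \<le> sum (rooted_weight j) {1..M} * sum scaled {1..M}"
    by (rule Cauchy_product_le) auto
  also have "\<dots> \<le> q ^ j * q"
    using step scaled_partial_sum q_pos by (intro mult_mono) (auto intro!: sum_nonneg)
  finally show ?case by (simp add: mult.commute)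
qed

text \<open>In the convolution for \<open>j + 1\<close> either the new factor has index at least \<open>m / (j + 1)\<close>, or the
  old one has index at least \<open>m j / (j + 1)\<close>; in both cases the monotonicity of \<open>n\<^sup>2 scaled n\<close> compares the large factor
  with \<open>scaled m\<close>.\<close>

lemma rooted_weight_bound:
  assumes "j \<ge> 1" "m \<ge> 1"
  shows "rooted_weight j m \<le> real j ^ 3 * q ^ (j - 1) * scaled m"
  using assms
proof (induction j arbitrary: m rule: dec_induct)
  case base
  then show ?case using rooted_weight_1[of m] by simp
next
  case (step j)
  have j: "real j \<ge> 1" using step by simp
  have summand: "rooted_weight j i * scaled (m - i) \<le>
      rooted_weight j i * ((real j + 1)\<^sup>2 * scaled m) + (real j * (real j + 1)\<^sup>2 * q ^ (j - 1) * scaled m) * scaled (m - i)"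
    if i: "i \<in> {1..<m}" for i
  proof (cases "m \<le> (m - i) * (j + 1)")
    case True
    have m: "real m \<le> real (m - i) * (real j + 1)"
      using True by (metis (mono_tags) of_nat_mono of_nat_mult of_nat_add of_nat_1)
    have "(real m)\<^sup>2 * scaled (m - i) \<le> (real (m - i) * (real j + 1))\<^sup>2 * scaled (m - i)"
      using m by (intro mult_right_mono power_mono) auto
    also have "\<dots> = (real j + 1)\<^sup>2 * ((real (m - i))\<^sup>2 * scaled (m - i))" by (simp add: power_mult_distrib)
    also have "\<dots> \<le> (real j + 1)\<^sup>2 * ((real m)\<^sup>2 * scaled m)"
      using i by (intro mult_left_mono scaled_regular) auto
    finally have "(real m)\<^sup>2 * scaled (m - i) \<le> (real m)\<^sup>2 * ((real j + 1)\<^sup>2 * scaled m)" by (simp add: mult_ac)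
    then have "scaled (m - i) \<le> (real j + 1)\<^sup>2 * scaled m"
      using i by simp
    then have "rooted_weight j i * scaled (m - i) \<le> rooted_weight j i * ((real j + 1)\<^sup>2 * scaled m)"
      by (intro mult_left_mono) auto
    moreover have "(real j * (real j + 1)\<^sup>2 * q ^ (j - 1) * scaled m) * scaled (m - i) \<ge> 0" using q_pos by simp
    ultimately show ?thesis by linarith
  next
    case False
    then have "(m - i) * (j + 1) \<le> m" by linarith
    then have "real ((m - i) * (j + 1)) \<le> real m" by (rule of_nat_mono)
    then have m: "real m * real j \<le> real i * (real j + 1)"
    proof -
      have "real ((m - i) * (j + 1)) = (real m - real i) * (real j + 1)"
      proof -
        have "real (m - i) = real m - real i" using i by (simp add: of_nat_diff)
        then show ?thesis unfolding of_nat_mult by simp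
      qed
      with \<open>real ((m - i) * (j + 1)) \<le> real m\<close> have "(real m - real i) * (real j + 1) \<le> real m" by linarith
      then show ?thesis by (simp add: algebra_simps)
    qed
    have "(real m)\<^sup>2 * rooted_weight j i \<le> (real m)\<^sup>2 * (real j ^ 3 * q ^ (j - 1) * scaled i)"
      using step.IH[of i] i by (intro mult_left_mono) auto
    also have "\<dots> = real j * q ^ (j - 1) * ((real m * real j)\<^sup>2 * scaled i)"
      by (simp add: power2_eq_square power3_eq_cube)
    also have "\<dots> \<le> real j * q ^ (j - 1) * ((real i * (real j + 1))\<^sup>2 * scaled i)"
      using m q_pos by (intro mult_left_mono mult_right_mono power_mono) auto
    also have "\<dots> = real j * q ^ (j - 1) * (real j + 1)\<^sup>2 * ((real i)\<^sup>2 * scaled i)" by (simp add: power_mult_distrib)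
    also have "\<dots> \<le> real j * q ^ (j - 1) * (real j + 1)\<^sup>2 * ((real m)\<^sup>2 * scaled m)"
      using i q_pos by (intro mult_left_mono scaled_regular) auto
    finally have "(real m)\<^sup>2 * rooted_weight j i \<le> (real m)\<^sup>2 * (real j * (real j + 1)\<^sup>2 * q ^ (j - 1) * scaled m)"
      by (simp add: mult_ac)
    then have "rooted_weight j i \<le> real j * (real j + 1)\<^sup>2 * q ^ (j - 1) * scaled m"
      using i by simp
    then have "rooted_weight j i * scaled (m - i) \<le> (real j * (real j + 1)\<^sup>2 * q ^ (j - 1) * scaled m) * scaled (m - i)"
      by (intro mult_right_mono) auto
    moreover have "rooted_weight j i * ((real j + 1)\<^sup>2 * scaled m) \<ge> 0" by simp
    ultimately show ?thesis by linarith
  qed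
  have s1: "(\<Sum>i\<in>{1..<m}. rooted_weight j i) \<le> q ^ j"
    using rooted_weight_partial_sum[of j "m - 1"] step by (cases m) (auto simp: atLeastLessThanSuc_atLeastAtMost)
  have s2: "(\<Sum>i\<in>{1..<m}. scaled (m - i)) \<le> q"
  proof -
    have "(\<Sum>i\<in>{1..<m}. scaled (m - i)) = (\<Sum>i\<in>{1..<m}. scaled i)"
      by (rule sum.reindex_bij_witness[of _ "\<lambda>i. m - i" "\<lambda>i. m - i"]) auto
    then show ?thesis
      using scaled_partial_sum[of "m - 1"] by (cases m) (auto simp: atLeastLessThanSuc_atLeastAtMost)
  qed
  have "rooted_weight (Suc j) m = (\<Sum>i\<in>{1..<m}. rooted_weight j i * scaled (m - i))"
    using step by (intro rooted_weight_Suc) auto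
  also have "\<dots> \<le> (\<Sum>i\<in>{1..<m}. rooted_weight j i * ((real j + 1)\<^sup>2 * scaled m) + (real j * (real j + 1)\<^sup>2 * q ^ (j - 1) * scaled m) * scaled (m - i))"
    using summand by (rule sum_mono)
  also have "\<dots> = (\<Sum>i\<in>{1..<m}. rooted_weight j i) * ((real j + 1)\<^sup>2 * scaled m) +
      (real j * (real j + 1)\<^sup>2 * q ^ (j - 1) * scaled m) * (\<Sum>i\<in>{1..<m}. scaled (m - i))"
    by (simp only: sum.distrib sum_distrib_left sum_distrib_right)
  also have "\<dots> \<le> q ^ j * ((real j + 1)\<^sup>2 * scaled m) + (real j * (real j + 1)\<^sup>2 * q ^ (j - 1) * scaled m) * q"
    using s1 s2 q_pos by (intro add_mono mult_left_mono mult_right_mono) auto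
  \<comment> \<open>The two cases contribute (j + 1)^2 q^j and j (j + 1)^2 q^j, which add up to the
    cube.\<close>
  also have "\<dots> = real (Suc j) ^ 3 * q ^ (Suc j - 1) * scaled m"
  proof -
    have "q ^ (j - 1) * q = q ^ j" using step by (cases j) auto
    then have "(real j * (real j + 1)\<^sup>2 * q ^ (j - 1) * scaled m) * q = real j * (real j + 1)\<^sup>2 * q ^ j * scaled m"
      by (metis (no_types, lifting) mult.assoc mult.commute)
    then show ?thesis by (simp add: power2_eq_square power3_eq_cube algebra_simps)
  qed
  finally show ?case .
qed

text \<open>The constant is 8 = 4 * 2: a factor 4 from passing from index m to N = m + 1, which is
  at most 2 m, and a factor 2 from \<open>UNIV_double\<close>. The step from m to N also supplies
  the q^2 that completes q^(j - 2) to q^j.\<close>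

lemma root_degree_bound:
  assumes "N \<ge> 2"
  shows "dcount UNIV {j} N \<le> 8 * real j ^ 3 * q ^ j * dcount UNIV UNIV N"
proof -
  consider "j = 0" | "j = 1" | "j \<ge> 2" by linarith
  then show ?thesis
  proof cases
    case 1 then show ?thesis using dcount_0[of N UNIV] assms by simp
  next
    case 2 then show ?thesis using dcount_one[OF down_closed_UNIV, of N] assms q_pos by simp
  next
    case 3
    obtain i m where ij: "j = Suc i" "N = Suc m" using 3 assms by (metis Suc_le_D numeral_2_eq_2)
    then have i: "i \<ge> 1" "m \<ge> 1" using 3 assms by auto
    have "(real m)\<^sup>2 * scaled m \<le> (real N)\<^sup>2 * scaled N" using i ij by (intro scaled_regular) auto
    also have "\<dots> \<le> (2 * real m)\<^sup>2 * scaled N" using i ij by (intro mult_right_mono power_mono) auto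
    also have "\<dots> = (real m)\<^sup>2 * (4 * scaled N)" by (simp add: power_mult_distrib)
    finally have um: "scaled m \<le> 4 * scaled N" using i by simp
    have "dcount UNIV {j} N * (q\<^sup>2) ^ m \<le> real i ^ 3 * q ^ (i - 1) * scaled m"
      using rooted_weight_bound[of i m] i ij by (simp add: rooted_weight_def)
    also have "\<dots> \<le> real j ^ 3 * q ^ (i - 1) * (4 * scaled N)"
      using ij um q_pos by (intro mult_mono power_mono) auto
    also have "\<dots> = real j ^ 3 * q ^ (i - 1) * (8 * dcount UNIV UNIV N * q\<^sup>2 * (q\<^sup>2) ^ m)"
      using UNIV_double[OF assms] ij by (simp add: scaled_def)
    also have "\<dots> = (8 * real j ^ 3 * (q ^ (i - 1) * q\<^sup>2) * dcount UNIV UNIV N) * (q\<^sup>2) ^ m" by simp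
    also have "q ^ (i - 1) * q\<^sup>2 = q ^ j"
    proof -
      have "j = (i - 1) + 2" using i ij by simp
      then show ?thesis by (metis power_add)
    qed
    finally show ?thesis using q_pos by simp
  qed
qed

section \<open>Dissected polygons are outerplanar\<close>

definition relabel :: "(nat \<Rightarrow> nat) \<Rightarrow> (nat \<times> nat) set \<Rightarrow> nat set set" where
  "relabel \<sigma> D = (\<lambda>(i, j). {\<sigma> i, \<sigma> j}) ` D"

definition polygon :: "nat \<Rightarrow> (nat \<times> nat) set" where
  "polygon n = insert (1, n) {(i, Suc i) |i. 1 \<le> i \<and> i < n}"

abbreviation dissections :: "nat \<Rightarrow> (nat \<times> nat) set set" where
  "dissections n \<equiv> Diss UNIV UNIV 1 n"

lemma dissections_iff: "D \<in> dissections n \<longleftrightarrow> D \<subseteq> pairs 1 n \<and> polygon n \<subseteq> D \<and> crossfree D"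
  by (auto simp: Diss_def NC_def polygon_def)

lemma relabel_edge: "(i, j) \<in> D \<Longrightarrow> {\<sigma> i, \<sigma> j} \<in> relabel \<sigma> D"
  by (force simp: relabel_def)

lemma relabelE:
  assumes "e \<in> relabel \<sigma> D"
  obtains i j where "(i, j) \<in> D" "e = {\<sigma> i, \<sigma> j}"
  using assms by (auto simp: relabel_def)

text \<open>A cycle without one vertex is a path. The value \<open>k = 0\<close> deletes nothing, so
  connectedness of the whole graph is included.\<close>

lemma connected_minus_one:
  assumes \<sigma>: "\<sigma> permutes {1..n}" and E: "relabel \<sigma> (polygon n) \<subseteq> E" and n: "n \<ge> 1"
    and W: "W = \<sigma> ` ({1..n} - {k})"
  shows "connected_on W E"
proof -
  define R where "R = {(x, y). x \<in> W \<and> y \<in> W \<and> adj E x y}"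
  have inW: "\<sigma> i \<in> W" if "1 \<le> i" "i \<le> n" "i \<noteq> k" for i using that W by auto
  have step: "(\<sigma> i, \<sigma> (Suc i)) \<in> R" if "1 \<le> i" "i < n" "i \<noteq> k" "Suc i \<noteq> k" for i
  proof -
    have "{\<sigma> i, \<sigma> (Suc i)} \<in> E"
      using that E relabel_edge[of i "Suc i" "polygon n" \<sigma>] by (auto simp: polygon_def)
    then show ?thesis using that inW by (auto simp: R_def adj_def)
  qed
  have chain: "(\<sigma> a, \<sigma> b) \<in> R\<^sup>*" if "a \<le> b" "1 \<le> a" "b \<le> n" "k \<notin> {a..b}" for a b
    using that
  proof (induction b rule: dec_induct)
    case (step b)
    then show ?case using \<open>1 \<le> a\<close> \<open>\<And>i. 1 \<le> i \<Longrightarrow> i < n \<Longrightarrow> i \<noteq> k \<Longrightarrow> Suc i \<noteq> k \<Longrightarrow> (\<sigma> i, \<sigma> (Suc i)) \<in> R\<close>[of b]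
      by (auto intro: rtrancl_into_rtrancl)
  qed auto
  have "sym R" by (auto simp: sym_def R_def adj_def insert_commute)
  then have sym: "(x, y) \<in> R\<^sup>* \<Longrightarrow> (y, x) \<in> R\<^sup>*" for x y by (meson sym_rtrancl symD)
  have last: "(\<sigma> 1, \<sigma> n) \<in> R\<^sup>*" if "k \<noteq> 1" "k \<noteq> n"
  proof -
    have "{\<sigma> 1, \<sigma> n} \<in> E"
      using E relabel_edge[of 1 n "polygon n" \<sigma>] by (auto simp: polygon_def)
    then have "(\<sigma> 1, \<sigma> n) \<in> R" using that inW n by (auto simp: R_def adj_def)
    then show ?thesis by blast
  qed
  \<comment> \<open>A surviving base vertex: positions below \<open>k\<close> are reached from 1
    directly, those above \<open>k\<close> through the closing edge and then downwards from
    \<open>n\<close>.\<close>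
  define b where "b = (if k = 1 then n else 1)"
  have base: "(\<sigma> b, \<sigma> i) \<in> R\<^sup>*" if "i \<in> {1..n} - {k}" for i
  proof (cases "k = 1")
    case True
    then show ?thesis using chain[of i n] sym that by (auto simp: b_def)
  next
    case False
    show ?thesis
    proof (cases "i < k")
      case True
      then show ?thesis using chain[of 1 i] that False by (auto simp: b_def)
    next
      case F: False
      show ?thesis
      proof (cases "k = n")
        case True then show ?thesis using F that by auto
      next
        case Fn: False
        have "(\<sigma> n, \<sigma> i) \<in> R\<^sup>*" using chain[of i n] sym that F by auto
        then show ?thesis using last False Fn by (auto simp: b_def intro: rtrancl_trans)
      qed
    qed
  qed
  show ?thesis
    unfolding connected_on_def R_def[symmetric]
  proof (intro ballI)
    fix x y assume "x \<in> W" "y \<in> W"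
    then obtain i j where "x = \<sigma> i" "y = \<sigma> j" "i \<in> {1..n} - {k}" "j \<in> {1..n} - {k}"
      unfolding W by blast
    then show "(x, y) \<in> R\<^sup>*" using base[of i] base[of j] sym by (auto intro: rtrancl_trans)
  qed
qed

lemma relabel_two_connected:
  assumes \<sigma>: "\<sigma> permutes {1..n}" and E: "relabel \<sigma> (polygon n) \<subseteq> E" and n: "n \<ge> 3"
  shows "two_connected {1..n} E"
  unfolding two_connected_def
proof (intro conjI ballI)
  have "{1..n} = \<sigma> ` ({1..n} - {0})"
    using permutes_image[OF \<sigma>] by simp
  then show "connected_on {1..n} E" using n by (intro connected_minus_one[OF \<sigma> E, of _ 0]) auto
  fix x assume "x \<in> {1..n}"
  have "{1..n} - {x} = \<sigma> ` ({1..n} - {inv \<sigma> x})"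
    unfolding image_set_diff[OF permutes_inj[OF \<sigma>]] permutes_image[OF \<sigma>]
    by (simp add: permutes_inverses(1)[OF \<sigma>])
  then show "connected_on ({1..n} - {x}) E" using n by (intro connected_minus_one[OF \<sigma> E]) auto
qed (use n in auto)

section \<open>Straight-line drawings with vertices on a parabola\<close>

definition parab :: "nat \<Rightarrow> complex" where
  "parab t = Complex (real t) ((real t)\<^sup>2)"

lemma segment_parab:
  assumes "z \<in> closed_segment (parab a) (parab c)"
  obtains s where "0 \<le> s" "s \<le> 1" "Re z = (1 - s) * real a + s * real c"
    "Im z = (1 - s) * (real a)\<^sup>2 + s * (real c)\<^sup>2"
  using assms by (auto simp: closed_segment_def parab_def)

lemma segment_parab_above:
  assumes "z \<in> closed_segment (parab a) (parab c)"
  shows "(Re z)\<^sup>2 \<le> Im z"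
proof -
  obtain s where s: "0 \<le> s" "s \<le> 1" "Re z = (1 - s) * real a + s * real c"
    "Im z = (1 - s) * (real a)\<^sup>2 + s * (real c)\<^sup>2" using segment_parab[OF assms] .
  have "Im z - (Re z)\<^sup>2 = s * (1 - s) * (real a - real c)\<^sup>2"
    unfolding s by (simp add: power2_eq_square algebra_simps)
  moreover have "s * (1 - s) * (real a - real c)\<^sup>2 \<ge> 0" using s by simp
  ultimately show ?thesis by linarith
qed

text \<open>The equation of the chord. At \<open>parab t\<close> its left-hand side is (t - a) (t -
  c), which turns incidence and crossing into sign questions.\<close>

lemma segment_parab_line:
  assumes "z \<in> closed_segment (parab a) (parab c)"
  shows "Im z - (real a + real c) * Re z + real a * real c = 0"
proof -
  obtain s where s: "0 \<le> s" "s \<le> 1" "Re z = (1 - s) * real a + s * real c"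
    "Im z = (1 - s) * (real a)\<^sup>2 + s * (real c)\<^sup>2" using segment_parab[OF assms] .
  show ?thesis unfolding s by (simp add: power2_eq_square algebra_simps)
qed

lemma parab_in_segment:
  assumes "parab t \<in> closed_segment (parab a) (parab c)"
  shows "t = a \<or> t = c"
proof -
  have "(real t - real a) * (real t - real c) = 0"
    using segment_parab_line[OF assms] by (simp add: parab_def power2_eq_square algebra_simps)
  then show ?thesis by simp
qed

text \<open>The form (t - a) (t - c) is nonpositive between \<open>a\<close> and \<open>c\<close>
  and nonnegative elsewhere. As the pairs do not cross, its values at \<open>b\<close> and
  \<open>d\<close> have a common weak sign, while a convex combination of them vanishes at
  \<open>z\<close>. So both terms vanish, and since the pairs differ, \<open>z\<close> is an end of
  both segments.\<close>

lemma parab_segments: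
  assumes z: "z \<in> closed_segment (parab a) (parab c)" "z \<in> closed_segment (parab b) (parab d)"
    and o: "a < c" "b < d" "(a, c) \<noteq> (b, d)"
    and nc: "\<not> (a < b \<and> b < c \<and> c < d)" "\<not> (b < a \<and> a < d \<and> d < c)"
  shows "\<exists>t\<in>{a,c} \<inter> {b,d}. z = parab t"
proof -
  obtain s where s: "0 \<le> s" "s \<le> 1" "Re z = (1 - s) * real b + s * real d"
    "Im z = (1 - s) * (real b)\<^sup>2 + s * (real d)\<^sup>2" using segment_parab[OF z(2)] .
  let ?f = "\<lambda>t. (real t - real a) * (real t - real c)"
  have sum: "(1 - s) * ?f b + s * ?f d = 0"
    using segment_parab_line[OF z(1)] unfolding s by (simp add: power2_eq_square algebra_simps)
  have inside: "?f t \<le> 0" if "a \<le> t" "t \<le> c" for t using that by (simp add: mult_nonneg_nonpos)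
  have outside: "?f t \<ge> 0" if "t \<le> a \<or> c \<le> t" for t
    using that o by (auto intro: mult_nonneg_nonneg mult_nonpos_nonpos)
  have "(a \<le> b \<and> b \<le> c \<and> a \<le> d \<and> d \<le> c) \<or> ((b \<le> a \<or> c \<le> b) \<and> (d \<le> a \<or> c \<le> d))"
    using o nc by linarith
  then have "(?f b \<le> 0 \<and> ?f d \<le> 0) \<or> (?f b \<ge> 0 \<and> ?f d \<ge> 0)"
    using inside outside by blast
  then have 0: "(1 - s) * ?f b = 0 \<and> s * ?f d = 0"
  proof
    assume "?f b \<le> 0 \<and> ?f d \<le> 0"
    then have "(1 - s) * ?f b \<le> 0" "s * ?f d \<le> 0" using s by (auto intro: mult_nonneg_nonpos)
    then show ?thesis using sum by linarith
  next
    assume "?f b \<ge> 0 \<and> ?f d \<ge> 0"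
    then have "(1 - s) * ?f b \<ge> 0" "s * ?f d \<ge> 0" using s by (auto intro: mult_nonneg_nonneg)
    then show ?thesis using sum by linarith
  qed
  have fz: "t = a \<or> t = c" if "?f t = 0" for t using that by simp
  consider "s = 0" | "s = 1" | "s \<noteq> 0" "s \<noteq> 1" by blast
  then show ?thesis
  proof cases
    case 1
    then have "z = parab b" using s by (simp add: complex_eq_iff parab_def)
    then show ?thesis using fz[of b] 0 1 by auto
  next
    case 2
    then have "z = parab d" using s by (simp add: complex_eq_iff parab_def)
    then show ?thesis using fz[of d] 0 2 by auto
  next
    case 3
    then have "b = a \<or> b = c" "d = a \<or> d = c" using 0 fz by auto
    then show ?thesis using o by auto
  qed
qed

text \<open>The region is not convex, but every point is joined to the lower half plane by a
  vertical segment going down, which stays in the region.\<close>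

lemma connected_below_parabola: "connected {z. Im z < (Re z)\<^sup>2}"
proof -
  let ?H = "{z. Im z < 0}"
  let ?s = "\<lambda>z. closed_segment z (Complex (Re z) (- \<bar>Im z\<bar> - 1))"
  have s_iff: "\<exists>t. 0 \<le> t \<and> t \<le> 1 \<and> Re w = Re z \<and> Im w = (1 - t) * Im z + t * (- \<bar>Im z\<bar> - 1)" if w: "w \<in> ?s z" for w z
  proof -
    obtain t where t: "0 \<le> t" "t \<le> 1" "w = (1 - t) *\<^sub>R z + t *\<^sub>R Complex (Re z) (- \<bar>Im z\<bar> - 1)"
      using w unfolding closed_segment_def by blast
    have "Re w = (1 - t) * Re z + t * Re z" unfolding t(3) by simp
    moreover have "Im w = (1 - t) * Im z + t * (- \<bar>Im z\<bar> - 1)" unfolding t(3) by simp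
    ultimately show ?thesis using t(1,2) by (intro exI[of _ t]) (simp add: algebra_simps)
  qed
  have below: "Re w = Re z \<and> Im w \<le> Im z" if w: "w \<in> ?s z" for w z
  proof -
    obtain t where t: "0 \<le> t" "t \<le> 1" "Re w = Re z" "Im w = (1 - t) * Im z + t * (- \<bar>Im z\<bar> - 1)"
      using s_iff[OF w] by blast
    have "t * (- \<bar>Im z\<bar> - 1) \<le> t * Im z" using t by (intro mult_left_mono) auto
    then show ?thesis using t by (simp add: algebra_simps)
  qed
  have eq: "{z. Im z < (Re z)\<^sup>2} = (\<Union>z\<in>{z. Im z < (Re z)\<^sup>2}. ?H \<union> ?s z)"
  proof
    show "(\<Union>z\<in>{z. Im z < (Re z)\<^sup>2}. ?H \<union> ?s z) \<subseteq> {z. Im z < (Re z)\<^sup>2}"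
      using below by (auto intro: order_less_le_trans) (smt (verit, best))
  qed auto
  have conH: "connected ?H" by (intro convex_connected convex_halfspace_Im_lt)
  have "connected (\<Union>z\<in>{z. Im z < (Re z)\<^sup>2}. ?H \<union> ?s z)"
  proof (rule connected_Union)
    show "connected S" if S: "S \<in> (\<lambda>z. ?H \<union> ?s z) ` {z. Im z < (Re z)\<^sup>2}" for S
    proof -
      obtain z where z: "S = ?H \<union> ?s z" using S by blast
      have "Complex (Re z) (- \<bar>Im z\<bar> - 1) \<in> ?H \<inter> ?s z" by auto
      then show ?thesis unfolding z by (intro connected_Un conH connected_segment) blast
    qed
    have "- \<i> \<in> \<Inter>((\<lambda>z. ?H \<union> ?s z) ` {z. Im z < (Re z)\<^sup>2})" by simp
    then show "\<Inter>((\<lambda>z. ?H \<union> ?s z) ` {z. Im z < (Re z)\<^sup>2}) \<noteq> {}" by blast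
  qed
  then show ?thesis using eq by simp
qed

text \<open>All chords lie on or above the parabola, so the connected region below it is contained
  in a single unbounded face, and every vertex is a limit of points just beneath it.\<close>

lemma relabel_outerplanar:
  assumes \<sigma>: "\<sigma> permutes {1..n}" and D: "D \<subseteq> pairs 1 n" "crossfree D"
  shows "outerplanar {1..n} (relabel \<sigma> D)"
proof -
  let ?V = "{1..n}" and ?E = "relabel \<sigma> D"
  define pos where "pos v = parab (inv \<sigma> v)" for v
  \<comment> \<open>\<open>Min\<close> and \<open>Max\<close> merely choose an orientation of the
    unordered edge.\<close>
  define \<gamma> where "\<gamma> e = linepath (pos (Min e)) (pos (Max e))" for e
  have inj: "inj \<sigma>" using permutes_inj[OF \<sigma>] .
  have pos_\<sigma>: "pos (\<sigma> i) = parab i" for i using inj by (simp add: pos_def)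
  have parab_inj: "parab i = parab j \<longleftrightarrow> i = j" for i j by (auto simp: parab_def)
  have mem: "1 \<le> i \<and> i < j \<and> j \<le> n" if "(i, j) \<in> D" for i j using D that by (auto simp: pairs_def)
  have \<sigma>V: "\<sigma> i \<in> ?V \<longleftrightarrow> i \<in> ?V" for i using permutes_in_image[OF \<sigma>] .
  have simple: "simple_graph ?V ?E"
    unfolding simple_graph_def
  proof
    fix e assume "e \<in> ?E"
    then obtain i j where ij: "(i, j) \<in> D" "e = {\<sigma> i, \<sigma> j}" by (rule relabelE)
    then have "\<sigma> i \<noteq> \<sigma> j" using mem inj by (metis injD less_irrefl)
    then show "e \<subseteq> ?V \<and> card e = 2" using ij mem[of i j] \<sigma>V[of i] \<sigma>V[of j] by auto
  qed
  have \<gamma>: "(\<exists>x y. e = {x, y} \<and> \<gamma> e = linepath (pos x) (pos y)) \<and>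
     path_image (\<gamma> e) = closed_segment (parab i) (parab j) \<and> arc (\<gamma> e)"
    if ij: "(i, j) \<in> D" "e = {\<sigma> i, \<sigma> j}" for e i j
  proof -
    have ne: "i \<noteq> j" "\<sigma> i \<noteq> \<sigma> j" using mem[OF ij(1)] inj by (auto dest: injD)
    have "\<gamma> e = linepath (pos (\<sigma> i)) (pos (\<sigma> j)) \<or> \<gamma> e = linepath (pos (\<sigma> j)) (pos (\<sigma> i))"
      by (auto simp: \<gamma>_def ij(2) min_def max_def)
    moreover have "closed_segment (parab j) (parab i) = closed_segment (parab i) (parab j)"
      by (rule closed_segment_commute)
    moreover have "arc (linepath (parab i) (parab j))" "arc (linepath (parab j) (parab i))"
      using ne by (auto simp: parab_inj intro!: arc_linepath)
    moreover have "e = {\<sigma> j, \<sigma> i}" using ij(2) by (simp add: insert_commute)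
    ultimately show ?thesis using ij(2) unfolding pos_\<sigma>[symmetric] path_image_linepath[symmetric]
      by metis
  qed
  have drawing: "planar_drawing ?V ?E pos \<gamma>"
    unfolding planar_drawing_def
  proof (intro conjI ballI impI)
    show "inj_on pos ?V"
      unfolding pos_def inj_on_def parab_inj using permutes_inj[OF permutes_inv[OF \<sigma>]] by (auto dest: injD)
  next
    fix e assume "e \<in> ?E"
    then obtain i j where ij: "(i, j) \<in> D" "e = {\<sigma> i, \<sigma> j}" by (rule relabelE)
    note g = \<gamma>[OF ij]
    show "arc (\<gamma> e)" using g by blast
    show "\<exists>u v. e = {u, v} \<and> pathstart (\<gamma> e) = pos u \<and> pathfinish (\<gamma> e) = pos v"
      using g by (metis pathstart_linepath pathfinish_linepath)
    show "path_image (\<gamma> e) \<inter> pos ` ?V = pos ` e"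
    proof
      show "path_image (\<gamma> e) \<inter> pos ` ?V \<subseteq> pos ` e"
      proof
        fix z assume "z \<in> path_image (\<gamma> e) \<inter> pos ` ?V"
        then obtain v where v: "z = pos v" "z \<in> closed_segment (parab i) (parab j)" using g by auto
        then have "inv \<sigma> v = i \<or> inv \<sigma> v = j" using parab_in_segment by (simp add: pos_def)
        then show "z \<in> pos ` e" using v ij pos_\<sigma> by (auto simp: pos_def)
      qed
      show "pos ` e \<subseteq> path_image (\<gamma> e) \<inter> pos ` ?V"
      proof -
        have "pos (\<sigma> i) \<in> pos ` ?V" "pos (\<sigma> j) \<in> pos ` ?V"
          using mem[OF ij(1)] \<sigma>V[of i] \<sigma>V[of j] by (auto intro!: imageI)
        then show ?thesis using g ij(2) pos_\<sigma> by auto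
      qed
    qed
  next
    fix e e' assume e: "e \<in> ?E" "e' \<in> ?E" "e \<noteq> e'"
    from e(1) obtain i j where ij: "(i, j) \<in> D" "e = {\<sigma> i, \<sigma> j}" by (rule relabelE)
    from e(2) obtain k l where kl: "(k, l) \<in> D" "e' = {\<sigma> k, \<sigma> l}" by (rule relabelE)
    have nc: "\<not> (i < k \<and> k < j \<and> j < l)" "\<not> (k < i \<and> i < l \<and> l < j)"
      using D(2) ij kl by (auto simp: crossfree_def)
    show "path_image (\<gamma> e) \<inter> path_image (\<gamma> e') \<subseteq> pos ` (e \<inter> e')"
    proof
      fix z assume "z \<in> path_image (\<gamma> e) \<inter> path_image (\<gamma> e')"
      then have z: "z \<in> closed_segment (parab i) (parab j)" "z \<in> closed_segment (parab k) (parab l)"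
        using \<gamma>[OF ij] \<gamma>[OF kl] by auto
      have "(i, j) \<noteq> (k, l)" using e(3) ij kl by auto
      from parab_segments[OF z _ _ this nc] mem[OF ij(1)] mem[OF kl(1)]
      obtain t where "t \<in> {i, j} \<inter> {k, l}" "z = parab t" by auto
      then show "z \<in> pos ` (e \<inter> e')"
        using ij kl pos_\<sigma>[of t] by (intro image_eqI[of _ _ "\<sigma> t"]) auto
    qed
  qed
  let ?U = "{z. Im z < (Re z)\<^sup>2}" and ?I = "drawing_image ?V ?E pos \<gamma>"
  have disj: "?U \<subseteq> - ?I"
  proof -
    have "(Re z)\<^sup>2 \<le> Im z" if "z \<in> ?I" for z
    proof -
      have "z \<in> pos ` ?V \<or> (\<exists>e\<in>?E. z \<in> path_image (\<gamma> e))" using that by (auto simp: drawing_image_def)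
      then show ?thesis
      proof
        assume "z \<in> pos ` ?V" then show ?thesis by (auto simp: pos_def parab_def)
      next
        assume "\<exists>e\<in>?E. z \<in> path_image (\<gamma> e)"
        then obtain e where "e \<in> ?E" "z \<in> path_image (\<gamma> e)" by blast
        from \<open>e \<in> ?E\<close> obtain i j where "(i, j) \<in> D" "e = {\<sigma> i, \<sigma> j}" by (rule relabelE)
        then show ?thesis using \<gamma>[of i j e] \<open>z \<in> path_image (\<gamma> e)\<close> segment_parab_above by auto
      qed
    qed
    then show ?thesis by force
  qed
  define F where "F = connected_component_set (- ?I) (- \<i>)"
  have iU: "- \<i> \<in> ?U" by simp
  have F: "F \<in> components (- ?I)"
    unfolding F_def using iU disj by (intro componentsI) blast
  have UF: "?U \<subseteq> F"
    unfolding F_def using iU disj connected_below_parabola by (intro connected_component_maximal) auto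
  have "\<not> bounded F"
  proof
    assume "bounded F"
    then obtain B where B: "\<And>z. z \<in> F \<Longrightarrow> norm z \<le> B" by (auto simp: bounded_iff)
    have "Complex 0 (- \<bar>B\<bar> - 1) \<in> F" using UF by auto
    from B[OF this] show False by (simp add: cmod_def)
  qed
  moreover have "pos v \<in> closure F" for v
    unfolding closure_approachable
  proof (intro allI impI)
    fix e :: real assume "e > 0"
    let ?y = "pos v - Complex 0 (e / 2)"
    have "?y \<in> F" using UF \<open>e > 0\<close> by (auto simp: pos_def parab_def)
    moreover have "dist ?y (pos v) < e" using \<open>e > 0\<close> by (simp add: dist_norm cmod_def)
    ultimately show "\<exists>y\<in>F. dist y (pos v) < e" by blast
  qed
  ultimately show ?thesis
    unfolding outerplanar_def using simple drawing F by blast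
qed

lemma relabel_in_TCO:
  assumes "\<sigma> permutes {1..n}" "D \<in> dissections n" "n \<ge> 3"
  shows "relabel \<sigma> D \<in> TCO n"
proof -
  have D: "D \<subseteq> pairs 1 n" "polygon n \<subseteq> D" "crossfree D"
    using assms(2) dissections_iff by blast+
  have "relabel \<sigma> (polygon n) \<subseteq> relabel \<sigma> D"
    using D(2) unfolding relabel_def by (rule image_mono)
  then show ?thesis
    using relabel_outerplanar[OF assms(1) D(1,3)] relabel_two_connected[OF assms(1) _ assms(3)]
    unfolding TCO_def outerplanar_def by blast
qed

section \<open>The outer Hamiltonian cycle\<close>

lemma path_edges_nth: "path_edges vs = {{vs ! i, vs ! Suc i} |i. Suc i < length vs}"
proof (induction vs rule: path_edges.induct)
  case (1 a b r)
  have "{{(a # b # r) ! i, (a # b # r) ! Suc i} |i. Suc i < length (a # b # r)} =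
      insert {a, b} {{(b # r) ! i, (b # r) ! Suc i} |i. Suc i < length (b # r)}" (is "?L = insert _ ?R")
  proof
    show "?L \<subseteq> insert {a, b} ?R"
    proof
      fix e assume "e \<in> ?L"
      then obtain i where "e = {(a # b # r) ! i, (a # b # r) ! Suc i}" "Suc i < length (a # b # r)" by blast
      then show "e \<in> insert {a, b} ?R" by (cases i) auto
    qed
    show "insert {a, b} ?R \<subseteq> ?L"
    proof
      fix e assume "e \<in> insert {a, b} ?R"
      then show "e \<in> ?L"
      proof
        assume "e = {a, b}" then show ?thesis by (intro CollectI exI[of _ 0]) auto
      next
        assume "e \<in> ?R"
        then obtain i where "e = {(b # r) ! i, (b # r) ! Suc i}" "Suc i < length (b # r)" by blast
        then show ?thesis by (intro CollectI exI[of _ "Suc i"]) auto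
      qed
    qed
  qed
  then show ?case using 1 by simp
qed auto

lemma relabel_polygon_subset:
  "relabel \<sigma> (polygon n) \<subseteq> E \<longleftrightarrow> {\<sigma> 1, \<sigma> n} \<in> E \<and> (\<forall>i. 1 \<le> i \<and> i < n \<longrightarrow> {\<sigma> i, \<sigma> (Suc i)} \<in> E)"
  by (auto simp: relabel_def polygon_def)

lemma TCO_hamiltonian:
  assumes "E \<in> TCO n"
  shows "\<exists>\<sigma>. \<sigma> permutes {1..n} \<and> relabel \<sigma> (polygon n) \<subseteq> E"
proof -
  obtain pos \<gamma> F where "planar_drawing {1..n} E pos \<gamma>" "F \<in> components (- drawing_image {1..n} E pos \<gamma>)"
    "\<not> bounded F" "\<forall>v\<in>{1..n}. pos v \<in> closure F" "simple_graph {1..n} E"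
    using assms unfolding TCO_def outerplanar_def by blast
  then interpret outerplanar_drawing "{1..n}" E pos \<gamma> F by unfold_locales auto
  obtain vs where vs: "cyc E vs" "set vs = {1..n}"
    using hamiltonian assms unfolding TCO_def by blast
  have len: "length vs = n" using vs distinct_card[of vs] by (simp add: cyc_def)
  have n: "n \<ge> 2" using vs len by (simp add: cyc_def)
  define \<sigma> where "\<sigma> i = (if i \<in> {1..n} then vs ! (i - 1) else i)" for i
  have "bij_betw (\<lambda>i. vs ! (i - 1)) {1..n} {1..n}"
  proof -
    have "bij_betw (\<lambda>i. i - 1) {1..n} {..<n}"
      by (rule bij_betw_byWitness[where f' = Suc]) auto
    moreover have "bij_betw ((!) vs) {..<n} {1..n}"
      using bij_betw_nth[of vs "{..<n}" "{1..n}"] vs len by (auto simp: cyc_def)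
    ultimately show ?thesis using bij_betw_trans by (fastforce simp: o_def)
  qed
  then have "bij_betw \<sigma> {1..n} {1..n}"
    by (rule bij_betw_cong[THEN iffD1, rotated]) (simp add: \<sigma>_def)
  then have perm: "\<sigma> permutes {1..n}"
    by (rule bij_imp_permutes) (auto simp: \<sigma>_def)
  have edge: "{(vs @ [hd vs]) ! i, (vs @ [hd vs]) ! Suc i} \<in> E" if "i < n" for i
    using vs(1) that len unfolding cyc_def path_edges_nth by auto
  have "hd vs = vs ! 0" using len n by (intro hd_conv_nth) auto
  then have "{\<sigma> 1, \<sigma> n} \<in> E"
    using edge[of "n - 1"] n len by (simp add: \<sigma>_def nth_append insert_commute)
  moreover have "{\<sigma> i, \<sigma> (Suc i)} \<in> E" if "1 \<le> i" "i < n" for i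
    using edge[of "i - 1"] that len by (simp add: \<sigma>_def nth_append)
  ultimately show ?thesis using perm relabel_polygon_subset by blast
qed

lemma upt_split: "a \<le> i \<Longrightarrow> i < b \<Longrightarrow> [a..<b] = [a..<i] @ i # [Suc i..<b]"
  using upt_add_eq_append[of a i "b - i"] by (simp add: upt_conv_Cons)

lemma TCO_dissection:
  assumes E: "E \<in> TCO n" and \<sigma>: "\<sigma> permutes {1..n}" and P: "relabel \<sigma> (polygon n) \<subseteq> E"
  shows "\<exists>D\<in>dissections n. E = relabel \<sigma> D"
proof -
  obtain pos \<gamma> F where "planar_drawing {1..n} E pos \<gamma>" "F \<in> components (- drawing_image {1..n} E pos \<gamma>)"
    "\<not> bounded F" "\<forall>v\<in>{1..n}. pos v \<in> closure F" "simple_graph {1..n} E"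
    using E unfolding TCO_def outerplanar_def by blast
  then interpret outerplanar_drawing "{1..n}" E pos \<gamma> F by unfold_locales auto
  have n: "n \<ge> 3" using E by (simp add: TCO_def two_connected_def)
  have inj: "inj \<sigma>" using permutes_inj[OF \<sigma>] .
  define D where "D = {(i, j). (i, j) \<in> pairs 1 n \<and> {\<sigma> i, \<sigma> j} \<in> E}"
  have cyc: "cyc E (map \<sigma> [1..<Suc n])"
  proof -
    have hd: "hd (map \<sigma> [1..<Suc n]) = \<sigma> 1" using n by (simp add: upt_rec)
    have "{(map \<sigma> [1..<Suc n] @ [\<sigma> 1]) ! i, (map \<sigma> [1..<Suc n] @ [\<sigma> 1]) ! Suc i} \<in> E" if "i < n" for i
    proof (cases "Suc i = n")
      case True
      then show ?thesis using P relabel_polygon_subset[of \<sigma> n E]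
        by (simp add: nth_append insert_commute del: upt_Suc)
    next
      case False
      then show ?thesis using P relabel_polygon_subset[of \<sigma> n E] that
        by (simp add: nth_append del: upt_Suc)
    qed
    then have "path_edges (map \<sigma> [1..<Suc n] @ [\<sigma> 1]) \<subseteq> E"
      unfolding path_edges_nth by (auto simp del: upt_Suc)
    then show ?thesis
      unfolding cyc_def hd using n inj_on_subset[OF inj subset_UNIV] by (simp add: distinct_map del: upt_Suc)
  qed
  have nocross: False if "1 \<le> i" "i < k" "k < j" "j < l" "l \<le> n" "{\<sigma> i, \<sigma> j} \<in> E" "{\<sigma> k, \<sigma> l} \<in> E" for i j k l
  proof -
    have "[1..<Suc n] = [1..<i] @ i # [Suc i..<Suc n]"
      using that by (intro upt_split) auto
    also have "[Suc i..<Suc n] = [Suc i..<j] @ j # [Suc j..<Suc n]"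
      using that by (intro upt_split) auto
    finally have "cyc E (map \<sigma> [1..<i] @ \<sigma> i # (map \<sigma> [Suc i..<j] @ \<sigma> j # map \<sigma> [Suc j..<Suc n]))"
      using cyc by simp
    from cyc_rotate[OF this]
    have "cyc E (\<sigma> i # map \<sigma> [Suc i..<j] @ \<sigma> j # (map \<sigma> [Suc j..<Suc n] @ map \<sigma> [1..<i]))"
      by simp
    then show False
      by (rule no_crossing_chords[of _ _ _ _ "\<sigma> k" "\<sigma> l"]) (use that in \<open>auto simp del: upt_Suc\<close>)
  qed
  have "D \<in> dissections n"
    unfolding dissections_iff
  proof (intro conjI)
    show "polygon n \<subseteq> D"
      using P n unfolding D_def relabel_polygon_subset by (auto simp: polygon_def pairs_def)
    show "crossfree D"
      unfolding crossfree_def D_def pairs_def using nocross by auto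
  qed (auto simp: D_def)
  moreover have "E = relabel \<sigma> D"
  proof
    show "relabel \<sigma> D \<subseteq> E" by (auto simp: relabel_def D_def)
    show "E \<subseteq> relabel \<sigma> D"
    proof
      fix e assume e: "e \<in> E"
      then have e2: "e \<subseteq> {1..n}" "card e = 2" using edge_vertices by auto
      then obtain x y where xy: "e = {x, y}" "x \<noteq> y" by (auto simp: card_2_iff)
      have x: "x = \<sigma> (inv \<sigma> x)" "y = \<sigma> (inv \<sigma> y)" using permutes_inverses(1)[OF \<sigma>] by auto
      have "inv \<sigma> x \<in> {1..n}" "inv \<sigma> y \<in> {1..n}"
        using e2 xy permutes_in_image[OF permutes_inv[OF \<sigma>]] by auto
      moreover have "inv \<sigma> x \<noteq> inv \<sigma> y" using xy x by metis
      ultimately have "(inv \<sigma> x, inv \<sigma> y) \<in> D \<or> (inv \<sigma> y, inv \<sigma> x) \<in> D"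
        using e xy x by (auto simp: D_def pairs_def insert_commute)
      then show "e \<in> relabel \<sigma> D"
        using relabel_edge[of _ _ D \<sigma>] x xy by (metis insert_commute)
    qed
  qed
  ultimately show ?thesis by blast
qed

lemma relabel_inj_on:
  assumes "\<sigma> permutes {1..n}"
  shows "inj_on (\<lambda>(i, j). {\<sigma> i, \<sigma> j}) (pairs 1 n)"
proof (rule inj_onI, clarify)
  fix i j k l assume *: "(i, j) \<in> pairs 1 n" "(k, l) \<in> pairs 1 n" "{\<sigma> i, \<sigma> j} = {\<sigma> k, \<sigma> l}"
  then have "(i = k \<and> j = l) \<or> (i = l \<and> j = k)"
    using permutes_inj[OF assms] by (auto simp: doubleton_eq_iff dest: injD)
  then show "i = k \<and> j = l" using * by (auto simp: pairs_def)
qed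

lemma polygon_pairs: "n \<ge> 2 \<Longrightarrow> polygon n \<subseteq> pairs 1 n"
  by (auto simp: polygon_def pairs_def)

lemma relabel_injD:
  assumes "\<sigma> permutes {1..n}" "A \<subseteq> pairs 1 n" "B \<subseteq> pairs 1 n" "relabel \<sigma> A = relabel \<sigma> B"
  shows "A = B"
  using inj_on_image_eq_iff[OF relabel_inj_on[OF assms(1)] assms(2,3)] assms(4) by (simp add: relabel_def)

text \<open>Relabelling is injective on pairs, so both sets have as many elements as the
  polygon.\<close>

lemma relabel_polygon_eqI:
  assumes "\<sigma> permutes {1..n}" "\<tau> permutes {1..n}" "n \<ge> 2" "relabel \<sigma> (polygon n) \<subseteq> relabel \<tau> (polygon n)"
  shows "relabel \<sigma> (polygon n) = relabel \<tau> (polygon n)"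
proof (rule card_subset_eq[OF _ assms(4)])
  have "card (relabel \<sigma> (polygon n)) = card (polygon n)" if "\<sigma> permutes {1..n}" for \<sigma>
    unfolding relabel_def using inj_on_subset[OF relabel_inj_on[OF that] polygon_pairs[OF assms(3)]]
    by (rule card_image)
  then show "card (relabel \<sigma> (polygon n)) = card (relabel \<tau> (polygon n))" using assms by simp
  show "finite (relabel \<tau> (polygon n))"
    unfolding relabel_def using finite_subset[OF polygon_pairs[OF assms(3)] finite_pairs] by simp
qed

section \<open>Cyclic positions and uniqueness of the Hamiltonian cycle\<close>

definition cpos :: "nat \<Rightarrow> nat \<Rightarrow> nat" where
  "cpos n m = m mod n + 1"

lemma cpos_in: "n > 0 \<Longrightarrow> cpos n m \<in> {1..n}"
  by (simp add: cpos_def Suc_leI)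

lemma cpos_edge: "n \<ge> 2 \<Longrightarrow> {\<tau> (cpos n m), \<tau> (cpos n (Suc m))} \<in> relabel \<tau> (polygon n)"
proof (cases "Suc (m mod n) = n")
  case True
  assume "n \<ge> 2"
  from True have "{\<tau> (cpos n m), \<tau> (cpos n (Suc m))} = {\<tau> 1, \<tau> n}"
    by (simp add: cpos_def mod_Suc insert_commute)
  then show ?thesis using relabel_edge[of 1 n "polygon n" \<tau>] by (simp add: polygon_def)
next
  case False
  assume "n \<ge> 2"
  then have "m mod n < n" by simp
  then have "(cpos n m, cpos n (Suc m)) \<in> polygon n"
    using False by (auto simp: cpos_def mod_Suc polygon_def)
  then show ?thesis by (rule relabel_edge)
qed

lemma polygon_cpos:
  assumes "n \<ge> 2" "e \<in> relabel \<tau> (polygon n)"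
  shows "\<exists>m. e = {\<tau> (cpos n m), \<tau> (cpos n (Suc m))}"
proof -
  have "e = {\<tau> 1, \<tau> n} \<or> (\<exists>i. 1 \<le> i \<and> i < n \<and> e = {\<tau> i, \<tau> (Suc i)})"
    using assms(2) by (auto simp: relabel_def polygon_def)
  then show ?thesis
  proof
    assume "e = {\<tau> 1, \<tau> n}"
    then show ?thesis using assms(1) by (intro exI[of _ "n - 1"]) (auto simp: cpos_def insert_commute)
  next
    assume "\<exists>i. 1 \<le> i \<and> i < n \<and> e = {\<tau> i, \<tau> (Suc i)}"
    then obtain i where "1 \<le> i" "i < n" "e = {\<tau> i, \<tau> (Suc i)}" by blast
    then show ?thesis by (intro exI[of _ "i - 1"]) (auto simp: cpos_def)
  qed
qed

lemma cpos_covers: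
  assumes "i \<in> {1..n}"
  shows "\<exists>k<n. cpos n (m + k) = i"
proof -
  let ?k = "(i - 1 + (n - m mod n)) mod n"
  have "m mod n < n" using assms by (auto intro!: mod_less_divisor)
  then have "(m + ?k) mod n = (m mod n + (i - 1 + (n - m mod n))) mod n"
    by (metis mod_add_eq mod_add_left_eq mod_add_right_eq)
  also have "m mod n + (i - 1 + (n - m mod n)) = i - 1 + n" using \<open>m mod n < n\<close> by simp
  also have "(i - 1 + n) mod n = i - 1" using assms by (simp only: mod_add_self2) auto
  finally have "cpos n (m + ?k) = i" using assms by (simp add: cpos_def)
  moreover have "?k < n" using assms by (auto intro!: mod_less_divisor)
  ultimately show ?thesis by blast
qed

text \<open>Removing the two ends of a chord separates a dissected polygon, whereas removing two
  consecutive vertices of a Hamiltonian cycle leaves a path.\<close>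

lemma polygon_unique:
  assumes D: "D \<in> dissections n" and n: "n \<ge> 3" and \<tau>: "\<tau> permutes {1..n}"
    and sub: "relabel \<tau> (polygon n) \<subseteq> relabel id D"
  shows "relabel \<tau> (polygon n) = relabel id (polygon n)"
proof (rule relabel_polygon_eqI[OF \<tau> permutes_id])
  show "relabel \<tau> (polygon n) \<subseteq> relabel id (polygon n)"
  proof (rule ccontr)
    assume "\<not> ?thesis"
    then obtain e where e: "e \<in> relabel \<tau> (polygon n)" "e \<notin> relabel id (polygon n)" by blast
    from e(1) sub obtain a c where ac: "(a, c) \<in> D" "e = {a, c}"
      by (metis relabelE id_apply subsetD)
    obtain m where m: "e = {\<tau> (cpos n m), \<tau> (cpos n (Suc m))}" using polygon_cpos e(1) n by fastforce
    have Dp: "D \<subseteq> pairs 1 n" "crossfree D" using D dissections_iff by auto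
    have acp: "1 \<le> a" "a < c" "c \<le> n" using ac Dp by (auto simp: pairs_def)
    have "(a, c) \<notin> polygon n" using e(2) ac relabel_edge[of a c "polygon n" id] by auto
    then have nadj: "Suc a \<noteq> c" "a \<noteq> 1 \<or> c \<noteq> n" using acp by (auto simp: polygon_def)
    \<comment> \<open>\<open>f\<close> lists the vertices along the second cycle, beginning with the
      two ends of the supposed chord.\<close>
    define f where "f k = \<tau> (cpos n (m + k))" for k
    have inj: "f k \<noteq> f l" if "k < l" "l < n" for k l
    proof
      assume "f k = f l"
      then have "(m + k) mod n = (m + l) mod n"
        using permutes_inj[OF \<tau>] by (auto simp: f_def cpos_def dest: injD)
      then have "n dvd (m + l) - (m + k)" using that by (metis mod_eq_dvd_iff_nat add_le_cancel_left less_imp_le)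
      then have "n dvd l - k" by simp
      then show False using that by (auto dest!: dvd_imp_le)
    qed
    have f01: "{f 0, f 1} = {a, c}" using m ac by (simp add: f_def)
    have notac: "f k \<notin> {a, c}" if "2 \<le> k" "k < n" for k
      using inj[of 0 k] inj[of 1 k] that f01 by (auto simp: doubleton_eq_iff)
    let ?in = "\<lambda>x. a < x \<and> x < c"
    \<comment> \<open>An edge of \<open>D\<close> avoiding \<open>a\<close> and \<open>c\<close>
      cannot join the two sides of the chord, so the side is constant along the path
      \<open>f 2\<close>, ..., \<open>f (n - 1)\<close>.\<close>
    have same: "?in (f k) \<longleftrightarrow> ?in (f 2)" if "2 \<le> k" "k < n" for k
      using that
    proof (induction k rule: dec_induct)
      case (step k)
      have "{f k, f (Suc k)} \<in> relabel id D"
        using sub cpos_edge[of n \<tau> "m + k"] n by (auto simp: f_def)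
      then have "(f k, f (Suc k)) \<in> D \<or> (f (Suc k), f k) \<in> D"
        by (auto elim!: relabelE simp: doubleton_eq_iff)
      moreover have side: "?in x \<longleftrightarrow> ?in y" if "(x, y) \<in> D" "x \<notin> {a, c}" "y \<notin> {a, c}" for x y
      proof -
        have "x < y" using that Dp by (auto simp: pairs_def)
        moreover have "\<not> (a < x \<and> x < c \<and> c < y)" "\<not> (x < a \<and> a < y \<and> y < c)"
          using Dp(2) that(1) ac(1) by (auto simp: crossfree_def)
        ultimately show ?thesis using that by auto
      qed
      moreover have "f k \<notin> {a, c}" "f (Suc k) \<notin> {a, c}"
        using notac[of k] notac[of "Suc k"] step.hyps step.prems by auto
      ultimately have "?in (f k) \<longleftrightarrow> ?in (f (Suc k))" by blast
      then show ?case using step by simp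
    qed auto
    have cover: "\<exists>k. 2 \<le> k \<and> k < n \<and> f k = x" if x: "x \<in> {1..n}" "x \<notin> {a, c}" for x
    proof -
      have "inv \<tau> x \<in> {1..n}" using x permutes_in_image[OF permutes_inv[OF \<tau>]] by blast
      from cpos_covers[OF this, of m] obtain k where k: "k < n" "cpos n (m + k) = inv \<tau> x" by blast
      then have fk: "f k = x" using permutes_inverses(1)[OF \<tau>] by (simp add: f_def)
      have "f 0 \<in> {a, c}" "f 1 \<in> {a, c}" unfolding f01[symmetric] by simp_all
      then have "k \<noteq> 0" "k \<noteq> 1" using fk x(2) by metis+
      then show ?thesis using k fk by (intro exI[of _ k]) auto
    qed
    \<comment> \<open>Both sides of the chord are nonempty because it is not a polygon side:
      \<open>Suc a\<close> lies on one of them, 1 or \<open>n\<close> on the other.\<close>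
    have "Suc a \<in> {1..n}" "Suc a \<notin> {a, c}" "?in (Suc a)" using acp nadj by auto
    then have in2: "?in (f 2)" using cover same by metis
    define y where "y = (if a \<noteq> 1 then 1 else n)"
    have "y \<in> {1..n}" "y \<notin> {a, c}" "\<not> ?in y" using acp nadj n by (auto simp: y_def)
    then show False using cover same in2 by metis
  qed
qed (use n in auto)

section \<open>Averaging over labelled graphs\<close>

lemma relabel_comp: "relabel (\<sigma> \<circ> \<tau>) D = (`) \<sigma> ` relabel \<tau> D"
  by (force simp: relabel_def image_image split: prod.splits)

lemma relabel_id_image: "relabel \<sigma> D = (`) \<sigma> ` relabel id D"
  using relabel_comp[of \<sigma> id D] by simp

lemma relabel_mono: "A \<subseteq> B \<Longrightarrow> relabel \<sigma> A \<subseteq> relabel \<sigma> B"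
  by (auto simp: relabel_def)

text \<open>The symmetry group of the polygon. Its order is the common fibre size and cancels in the
  averages.\<close>

definition polygon_auts :: "nat \<Rightarrow> (nat \<Rightarrow> nat) set" where
  "polygon_auts n = {\<tau>. \<tau> permutes {1..n} \<and> relabel \<tau> (polygon n) = relabel id (polygon n)}"

text \<open>For a permutation in the fibre, \<open>D\<close> is determined by injectivity of the
  relabelling. The permutations themselves are those tracing a Hamiltonian cycle of
  \<open>E\<close>; as this cycle is unique, they form the coset of \<open>polygon_auts\<close>
  through \<open>\<sigma>0\<close>.\<close>

lemma fibre_card:
  assumes n: "n \<ge> 3" and E: "E \<in> TCO n"
  shows "card {p \<in> {\<sigma>. \<sigma> permutes {1..n}} \<times> dissections n. (case p of (\<sigma>, D) \<Rightarrow> relabel \<sigma> D) = E} = card (polygon_auts n)"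
    (is "card ?F = _")
proof -
  obtain \<sigma>0 where \<sigma>0: "\<sigma>0 permutes {1..n}" "relabel \<sigma>0 (polygon n) \<subseteq> E"
    using TCO_hamiltonian[OF E] by blast
  obtain D0 where D0: "D0 \<in> dissections n" "E = relabel \<sigma>0 D0" using TCO_dissection[OF E \<sigma>0] by blast
  have sub: "D \<subseteq> pairs 1 n" "polygon n \<subseteq> D" if "D \<in> dissections n" for D using that dissections_iff by auto
  have inj: "inj_on fst ?F"
  proof (rule inj_onI)
    fix x y assume x: "x \<in> ?F" and y: "y \<in> ?F" and xy: "fst x = fst y"
    obtain \<sigma> D \<sigma>' D' where "x = (\<sigma>, D)" "y = (\<sigma>', D')" by (metis surj_pair)
    then show "x = y" using x y xy relabel_injD[of \<sigma> n D D'] sub(1) by auto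
  qed
  have img: "fst ` ?F = (\<lambda>\<tau>. \<sigma>0 \<circ> \<tau>) ` polygon_auts n"
  proof
    show "fst ` ?F \<subseteq> (\<lambda>\<tau>. \<sigma>0 \<circ> \<tau>) ` polygon_auts n"
    proof
      fix \<sigma> assume "\<sigma> \<in> fst ` ?F"
      then obtain D where D: "\<sigma> permutes {1..n}" "D \<in> dissections n" "relabel \<sigma> D = E" by auto
      let ?\<tau> = "inv \<sigma>0 \<circ> \<sigma>"
      have \<tau>: "?\<tau> permutes {1..n}" by (intro permutes_compose D permutes_inv \<sigma>0)
      have "relabel ?\<tau> (polygon n) \<subseteq> relabel ?\<tau> D" by (intro relabel_mono sub D)
      also have "\<dots> = (`) (inv \<sigma>0) ` relabel \<sigma>0 D0" using D D0 by (simp add: relabel_comp)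
      also have "\<dots> = relabel id D0" unfolding relabel_comp[symmetric]
        using permutes_inv_o(2)[OF \<sigma>0(1)] by simp
      finally have "?\<tau> \<in> polygon_auts n"
        using polygon_unique[OF D0(1) n \<tau>] \<tau> by (simp add: polygon_auts_def)
      moreover have "\<sigma> = \<sigma>0 \<circ> ?\<tau>" using permutes_inv_o(1)[OF \<sigma>0(1)] by (simp add: o_assoc)
      ultimately show "\<sigma> \<in> (\<lambda>\<tau>. \<sigma>0 \<circ> \<tau>) ` polygon_auts n" by blast
    qed
    show "(\<lambda>\<tau>. \<sigma>0 \<circ> \<tau>) ` polygon_auts n \<subseteq> fst ` ?F"
    proof (rule image_subsetI)
      fix \<tau> assume \<tau>: "\<tau> \<in> polygon_auts n"
      then have p: "\<sigma>0 \<circ> \<tau> permutes {1..n}"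
        unfolding polygon_auts_def by (intro permutes_compose \<sigma>0) auto
      have "relabel (\<sigma>0 \<circ> \<tau>) (polygon n) = relabel \<sigma>0 (polygon n)"
        using \<tau> relabel_id_image[of \<sigma>0 "polygon n"] by (simp add: relabel_comp polygon_auts_def)
      then obtain D where "D \<in> dissections n" "E = relabel (\<sigma>0 \<circ> \<tau>) D"
        using TCO_dissection[OF E p] \<sigma>0 by auto
      then have "(\<sigma>0 \<circ> \<tau>, D) \<in> ?F" using p by simp
      then show "\<sigma>0 \<circ> \<tau> \<in> fst ` ?F" by (rule image_eqI[rotated]) simp
    qed
  qed
  have "inj_on (\<lambda>\<tau>. \<sigma>0 \<circ> \<tau>) (polygon_auts n)"
    using permutes_inj[OF \<sigma>0(1)] by (auto simp: inj_on_def fun_eq_iff dest: injD)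
  then have "card (fst ` ?F) = card (polygon_auts n)" unfolding img by (rule card_image)
  then show ?thesis using card_image[OF inj] by simp
qed

section \<open>Transfer of maximum-degree statistics to dissections\<close>

lemma degree_image:
  assumes "inj \<sigma>"
  shows "degree ((`) \<sigma> ` E) (\<sigma> v) = degree E v"
proof -
  have "{e \<in> (`) \<sigma> ` E. \<sigma> v \<in> e} = (`) \<sigma> ` {e \<in> E. v \<in> e}"
    using inj_image_mem_iff[OF assms, of v] by blast
  moreover have "inj_on ((`) \<sigma>) {e \<in> E. v \<in> e}"
    using assms by (auto simp: inj_on_def inj_image_eq_iff)
  ultimately show ?thesis by (simp add: degree_def card_image)
qed

definition mdeg :: "nat \<Rightarrow> (nat \<times> nat) set \<Rightarrow> nat" where
  "mdeg n D = max_degree n (relabel id D)"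

lemma max_degree_relabel:
  assumes "\<sigma> permutes {1..n}"
  shows "max_degree n (relabel \<sigma> D) = mdeg n D"
proof -
  have "degree (relabel \<sigma> D) ` {1..n} = degree (relabel \<sigma> D) ` \<sigma> ` {1..n}"
    by (simp only: permutes_image[OF assms])
  also have "\<dots> = degree (relabel id D) ` {1..n}"
    unfolding image_image relabel_id_image[of \<sigma>] by (simp add: degree_image[OF permutes_inj[OF assms]])
  finally show ?thesis by (simp add: max_degree_def mdeg_def)
qed

text \<open>Double counting of pairs of a permutation and a dissection: grouped by graph, all fibres
  have the same size; grouped by dissection, the maximum degree does not depend on the permutation.
  Constant 1 in \<open>key\<close> gives the ratio of the denominators.\<close>

lemma TCO_average:
  fixes f :: "nat \<Rightarrow> real"
  assumes n: "n \<ge> 3"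
  shows "(\<Sum>E\<in>TCO n. f (max_degree n E)) / real (card (TCO n)) =
    (\<Sum>D\<in>dissections n. f (mdeg n D)) / real (card (dissections n))"
proof -
  let ?P = "{\<sigma>. \<sigma> permutes {1..n}}" and ?K = "real (card (polygon_auts n))"
  let ?r = "\<lambda>(\<sigma>, D). relabel \<sigma> D"
  have finP: "finite ?P" by (rule finite_permutations) simp
  have fin: "finite (?P \<times> dissections n)" using finP finite_Diss by simp
  have img: "?r ` (?P \<times> dissections n) = TCO n"
  proof
    show "?r ` (?P \<times> dissections n) \<subseteq> TCO n"
    proof (rule image_subsetI)
      fix p assume "p \<in> ?P \<times> dissections n"
      then show "?r p \<in> TCO n" using relabel_in_TCO[OF _ _ n] by (cases p) auto
    qed
    show "TCO n \<subseteq> ?r ` (?P \<times> dissections n)"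
    proof
      fix E assume E: "E \<in> TCO n"
      obtain \<sigma> where \<sigma>: "\<sigma> permutes {1..n}" "relabel \<sigma> (polygon n) \<subseteq> E" using TCO_hamiltonian[OF E] by blast
      obtain D where "D \<in> dissections n" "E = relabel \<sigma> D" using TCO_dissection[OF E \<sigma>] by blast
      then show "E \<in> ?r ` (?P \<times> dissections n)" using \<sigma> by (intro image_eqI[of _ _ "(\<sigma>, D)"]) auto
    qed
  qed
  have key: "?K * (\<Sum>E\<in>TCO n. g (max_degree n E)) = real (card ?P) * (\<Sum>D\<in>dissections n. g (mdeg n D))"
    for g :: "nat \<Rightarrow> real"
  proof -
    have "(\<Sum>p\<in>?P \<times> dissections n. g (max_degree n (?r p))) =
       (\<Sum>E\<in>TCO n. \<Sum>p\<in>{p \<in> ?P \<times> dissections n. ?r p = E}. g (max_degree n (?r p)))"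
      using sum.image_gen[OF fin, of "\<lambda>p. g (max_degree n (?r p))" ?r] unfolding img .
    also have "\<dots> = (\<Sum>E\<in>TCO n. \<Sum>p\<in>{p \<in> ?P \<times> dissections n. ?r p = E}. g (max_degree n E))"
      by (intro sum.cong refl) auto
    also have "\<dots> = (\<Sum>E\<in>TCO n. ?K * g (max_degree n E))"
    proof (rule sum.cong[OF refl])
      fix E assume "E \<in> TCO n"
      from fibre_card[OF n this]
      show "(\<Sum>p\<in>{p \<in> ?P \<times> dissections n. ?r p = E}. g (max_degree n E)) = ?K * g (max_degree n E)"
        by simp
    qed
    finally have 1: "(\<Sum>p\<in>?P \<times> dissections n. g (max_degree n (?r p))) = ?K * (\<Sum>E\<in>TCO n. g (max_degree n E))"
      by (simp add: sum_distrib_left)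
    have "(\<Sum>p\<in>?P \<times> dissections n. g (max_degree n (?r p))) =
        (\<Sum>\<sigma>\<in>?P. \<Sum>D\<in>dissections n. g (max_degree n (relabel \<sigma> D)))"
      by (simp add: sum.cartesian_product case_prod_beta)
    also have "\<dots> = (\<Sum>\<sigma>\<in>?P. \<Sum>D\<in>dissections n. g (mdeg n D))"
      using max_degree_relabel by (intro sum.cong refl) auto
    finally show ?thesis using 1 by simp
  qed
  have id: "id \<in> polygon_auts n" by (simp add: polygon_auts_def permutes_id)
  have "polygon_auts n \<subseteq> ?P" by (auto simp: polygon_auts_def)
  then have K: "?K > 0" using id finite_subset[OF _ finP] by (auto simp: card_gt_0_iff)
  have P: "real (card ?P) > 0" using finP permutes_id[of "{1..n}"] by (auto simp: card_gt_0_iff simp del: permutes_id)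
  have "?K * real (card (TCO n)) = real (card ?P) * real (card (dissections n))"
    using key[of "\<lambda>_. 1"] by simp
  then have "(\<Sum>E\<in>TCO n. f (max_degree n E)) / real (card (TCO n)) =
     (?K * (\<Sum>E\<in>TCO n. f (max_degree n E))) / (real (card ?P) * real (card (dissections n)))"
    using K by (metis mult_divide_mult_cancel_left less_irrefl)
  also have "\<dots> = (\<Sum>D\<in>dissections n. f (mdeg n D)) / real (card (dissections n))"
    unfolding key using P by simp
  finally show ?thesis .
qed

lemma finite_TCO: "finite (TCO n)"
  by (rule finite_subset[of _ "Pow (Pow {1..n})"]) (auto simp: TCO_def simple_graph_def)

lemma TCO_frequency:
  assumes n: "n \<ge> 3"
  shows "real (card {E \<in> TCO n. Q (max_degree n E)}) / real (card (TCO n)) =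
    real (card {D \<in> dissections n. Q (mdeg n D)}) / real (card (dissections n))"
proof -
  have eq: "real (card {x \<in> A. Q (h x)}) = (\<Sum>x\<in>A. if Q (h x) then 1 else 0)" if "finite A" for A and h :: "'z \<Rightarrow> nat"
    using that by (simp add: sum.If_cases Int_def)
  show ?thesis
    unfolding eq[OF finite_TCO] eq[OF finite_Diss]
    by (rule TCO_average[OF n, of "\<lambda>d. if Q d then 1 else 0"])
qed

lemma finite_relabel: "D \<subseteq> pairs 1 n \<Longrightarrow> finite (relabel \<sigma> D)"
  unfolding relabel_def using finite_subset[OF _ finite_pairs] by blast

text \<open>The first vertex has no smaller neighbour.\<close>

lemma degree_first:
  assumes "D \<subseteq> pairs 1 n"
  shows "degree (relabel id D) 1 = rdeg D 1"
proof -
  have "{e \<in> relabel id D. 1 \<in> e} = (\<lambda>w. {1, w}) ` {w. (1, w) \<in> D}"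
  proof
    show "{e \<in> relabel id D. 1 \<in> e} \<subseteq> (\<lambda>w. {1, w}) ` {w. (1, w) \<in> D}"
      using assms by (fastforce simp: relabel_def pairs_def)
    show "(\<lambda>w. {1, w}) ` {w. (1, w) \<in> D} \<subseteq> {e \<in> relabel id D. 1 \<in> e}"
      using relabel_edge[of 1 _ D id] by auto
  qed
  moreover have "inj_on (\<lambda>w. {1, w}) {w. (1, w) \<in> D}" by (auto simp: inj_on_def doubleton_eq_iff)
  ultimately show ?thesis by (simp add: degree_def rdeg_def card_image)
qed

lemma rdeg_le_degree:
  assumes "D \<subseteq> pairs 1 n"
  shows "rdeg D v \<le> degree (relabel id D) v"
proof -
  have "inj_on (\<lambda>w. {v, w}) {w. (v, w) \<in> D}" by (auto simp: inj_on_def doubleton_eq_iff)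
  then have "rdeg D v = card ((\<lambda>w. {v, w}) ` {w. (v, w) \<in> D})" by (simp add: rdeg_def card_image)
  also have "\<dots> \<le> degree (relabel id D) v"
    unfolding degree_def using finite_relabel[OF assms, of id] relabel_edge[of v _ D id]
    by (intro card_mono) auto
  finally show ?thesis .
qed

lemma degree_le_mdeg: "v \<in> {1..n} \<Longrightarrow> degree (relabel id D) v \<le> mdeg n D"
  by (simp add: mdeg_def max_degree_def)

lemma mdeg_attained: "n \<ge> 1 \<Longrightarrow> \<exists>v\<in>{1..n}. mdeg n D = degree (relabel id D) v"
proof -
  assume "n \<ge> 1"
  then have "mdeg n D \<in> degree (relabel id D) ` {1..n}"
    unfolding mdeg_def max_degree_def by (intro Max_in) auto
  then show ?thesis by blast
qed

section \<open>Rotating an arbitrary vertex to the first position\<close>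

definition rotation :: "nat \<Rightarrow> nat \<Rightarrow> nat \<Rightarrow> nat" where
  "rotation n v i = (if i \<in> {1..n} then cpos n (v - 1 + (i - 1)) else i)"

lemma rotation_permutes:
  assumes "n \<ge> 1"
  shows "rotation n v permutes {1..n}"
proof (rule bij_imp_permutes)
  have "rotation n v ` {1..n} = {1..n}"
  proof
    show "rotation n v ` {1..n} \<subseteq> {1..n}" using cpos_in[of n] assms by (auto simp: rotation_def)
    show "{1..n} \<subseteq> rotation n v ` {1..n}"
    proof
      fix i assume "i \<in> {1..n}"
      then obtain k where "k < n" "cpos n (v - 1 + k) = i" using cpos_covers by blast
      then show "i \<in> rotation n v ` {1..n}" by (intro image_eqI[of _ _ "Suc k"]) (auto simp: rotation_def)
    qed
  qed
  then show "bij_betw (rotation n v) {1..n} {1..n}"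
    by (auto simp: bij_betw_def intro: eq_card_imp_inj_on)
qed (auto simp: rotation_def)

lemma rotation_polygon:
  assumes "n \<ge> 2"
  shows "relabel (rotation n v) (polygon n) \<subseteq> relabel id (polygon n)"
  unfolding relabel_polygon_subset
proof (intro conjI allI impI)
  have "cpos n (Suc (v - 1 + (n - 1))) = cpos n (v - 1)" using assms by (simp add: cpos_def)
  then show "{rotation n v 1, rotation n v n} \<in> relabel id (polygon n)"
    using cpos_edge[OF assms, of id "v - 1 + (n - 1)"] assms by (simp add: rotation_def insert_commute)
  fix i assume "1 \<le> i \<and> i < n"
  then show "{rotation n v i, rotation n v (Suc i)} \<in> relabel id (polygon n)"
    using cpos_edge[OF assms, of id "v - 1 + (i - 1)"] by (simp add: rotation_def)
qed

text \<open>Read along the polygon starting at \<open>v\<close>, a dissection is again a dissection,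
  and the degree of \<open>v\<close> becomes the right degree of the first vertex. This reading is
  injective.\<close>

lemma degree_count_le:
  assumes n: "n \<ge> 3" and v: "v \<in> {1..n}"
  shows "card {D \<in> dissections n. degree (relabel id D) v = j} \<le> card (Diss UNIV {j} 1 n)"
proof -
  let ?r = "rotation n v"
  have perm: "?r permutes {1..n}" using rotation_permutes n by simp
  have sub: "D \<subseteq> pairs 1 n" "polygon n \<subseteq> D" if "D \<in> dissections n" for D using that dissections_iff by auto
  have ex: "\<exists>D'\<in>dissections n. relabel id D = relabel ?r D'" if D: "D \<in> dissections n" for D
  proof (rule TCO_dissection[OF _ perm])
    show "relabel id D \<in> TCO n" by (rule relabel_in_TCO[OF permutes_id D n])
    show "relabel ?r (polygon n) \<subseteq> relabel id D"
      using rotation_polygon[of n v] n relabel_mono[OF sub(2)[OF D], of id] by auto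
  qed
  then obtain g where g: "\<And>D. D \<in> dissections n \<Longrightarrow> g D \<in> dissections n \<and> relabel id D = relabel ?r (g D)"
    by metis
  have r1: "?r 1 = v" using v by (auto simp: rotation_def cpos_def)
  show ?thesis
  proof (rule card_inj_on_le[where f = g])
    show "inj_on g {D \<in> dissections n. degree (relabel id D) v = j}"
    proof (rule inj_onI)
      fix A B assume "A \<in> {D \<in> dissections n. degree (relabel id D) v = j}"
        "B \<in> {D \<in> dissections n. degree (relabel id D) v = j}" "g A = g B"
      then have "A \<in> dissections n" "B \<in> dissections n" "relabel id A = relabel id B" using g by auto
      then show "A = B" using relabel_injD[OF permutes_id] sub(1) by blast
    qed
    show "g ` {D \<in> dissections n. degree (relabel id D) v = j} \<subseteq> Diss UNIV {j} 1 n"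
    proof (rule image_subsetI)
      fix D assume D: "D \<in> {D \<in> dissections n. degree (relabel id D) v = j}"
      then have gD: "g D \<in> dissections n" "relabel id D = relabel ?r (g D)" using g by auto
      have "j = degree ((`) ?r ` relabel id (g D)) (?r 1)"
        using D gD r1 relabel_id_image[of ?r "g D"] by simp
      also have "\<dots> = rdeg (g D) 1"
        using degree_image[OF permutes_inj[OF perm]] degree_first[OF sub(1)[OF gD(1)]] by simp
      finally show "g D \<in> Diss UNIV {j} 1 n" using gD(1) by (simp add: Diss_def)
    qed
  qed (rule finite_Diss)
qed

lemma Diss_dcount:
  assumes "down_closed K" "0 \<in> K" "n \<ge> 2"
  shows "real (card (Diss K J 1 n)) = dcount K J (n - 1)"
  using card_translate[OF assms(1,2), of "n - 1" 1] assms(3) by (simp add: dcount_def)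

text \<open>A bound on all degrees is weakened to one on all right degrees, which the decomposition
  can count.\<close>

lemma mdeg_le_count:
  assumes "n \<ge> 2"
  shows "real (card {D \<in> dissections n. mdeg n D \<le> k}) \<le> dcount {..k} UNIV (n - 1)"
proof -
  have "{D \<in> dissections n. mdeg n D \<le> k} \<subseteq> Diss {..k} UNIV 1 n"
  proof
    fix D assume D: "D \<in> {D \<in> dissections n. mdeg n D \<le> k}"
    then have sub: "D \<subseteq> pairs 1 n" using dissections_iff by auto
    have "rdeg D v \<le> k" for v
    proof (cases "v \<in> {1..n}")
      case True
      then show ?thesis using rdeg_le_degree[OF sub, of v] degree_le_mdeg[OF True, of D] D by simp
    next
      case False
      then have "{w. (v, w) \<in> D} = {}" using sub by (auto simp: pairs_def)
      then show ?thesis by (simp add: rdeg_def)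
    qed
    then show "D \<in> Diss {..k} UNIV 1 n" using D by (auto simp: Diss_def NC_def)
  qed
  then have "card {D \<in> dissections n. mdeg n D \<le> k} \<le> card (Diss {..k} UNIV 1 n)"
    by (rule card_mono[OF finite_Diss])
  then show ?thesis using Diss_dcount[of "{..k}" n UNIV] assms by (simp add: down_closed_def)
qed

section \<open>Concentration of the maximum degree\<close>

text \<open>With r = s^4 three factors s^j absorb the cube, since j s^j is bounded, and the fourth
  is summable.\<close>

lemma cube_geometric_bounded:
  fixes r :: real
  assumes "0 < r" "r < 1"
  shows "\<exists>M>0. \<forall>J. finite J \<longrightarrow> (\<Sum>j\<in>J. real j ^ 3 * r ^ j) \<le> M"
proof -
  define s where "s = root 4 r"
  have s: "0 < s" "s < 1" "s ^ 4 = r" using assms by (auto simp: s_def)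
  have "(\<lambda>j. real j * s ^ j) \<longlonglongrightarrow> 0" using powser_times_n_limit_0[of s] s by simp
  then have "Bseq (\<lambda>j. real j * s ^ j)" by (intro convergent_imp_Bseq convergentI)
  then obtain B where B: "B > 0" "\<And>j. norm (real j * s ^ j) \<le> B" by (auto elim!: BseqE)
  have summand: "real j ^ 3 * r ^ j \<le> B ^ 3 * s ^ j" for j
  proof -
    have "real j ^ 3 * r ^ j = (real j * s ^ j) ^ 3 * s ^ j"
      by (simp add: s(3)[symmetric] power_mult_distrib flip: power_mult power_add)
    also have "\<dots> \<le> B ^ 3 * s ^ j"
      using B(2)[of j] s by (intro mult_right_mono power_mono) auto
    finally show ?thesis .
  qed
  have sum: "summable (\<lambda>j. B ^ 3 * s ^ j)" using s by (intro summable_mult summable_geometric) auto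
  have "(\<Sum>j\<in>J. real j ^ 3 * r ^ j) \<le> (\<Sum>j. B ^ 3 * s ^ j) + 1" if J: "finite J" for J
  proof -
    have "(\<Sum>j\<in>J. real j ^ 3 * r ^ j) \<le> (\<Sum>j\<in>J. B ^ 3 * s ^ j)" using summand by (rule sum_mono)
    also have "\<dots> \<le> (\<Sum>j. B ^ 3 * s ^ j)" using sum J B s by (intro sum_le_suminf) auto
    finally show ?thesis by simp
  qed
  moreover have "(\<Sum>j. B ^ 3 * s ^ j) + 1 > 0" using sum B s by (intro add_nonneg_pos suminf_nonneg) auto
  ultimately show ?thesis by blast
qed

section \<open>Moment and tail bounds for the maximum degree\<close>

lemma card_dissections_pos:
  assumes "n \<ge> 3"
  shows "real (card (dissections n)) > 0"
  using dissections_pos[of "n - 1"] Diss_dcount[OF down_closed_UNIV, of n UNIV] assms by simp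

text \<open>The maximum is replaced by the sum over all vertices, which costs the factor n. For one
  vertex the series of j^3 (z q)^j converges, so \<open>ln z\<close> may be any positive number
  below ln (sqrt 2 + 1).\<close>

lemma exp_moment:
  assumes z: "1 < z" "z * q < 1"
  shows "\<exists>M>0. \<forall>n\<ge>3. (\<Sum>D\<in>dissections n. z ^ mdeg n D) \<le> real n * M * real (card (dissections n))"
proof -
  obtain M where M: "M > 0" "\<And>J. finite J \<Longrightarrow> (\<Sum>j\<in>J. real j ^ 3 * (z * q) ^ j) \<le> M"
    using cube_geometric_bounded[of "z * q"] z q_pos by auto
  have "(\<Sum>D\<in>dissections n. z ^ mdeg n D) \<le> real n * (8 * M) * real (card (dissections n))" if n: "n \<ge> 3" for n
  proof -
    let ?b = "real (card (dissections n))" and ?d = "\<lambda>v D. degree (relabel id D) v"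
    have one: "(\<Sum>D\<in>dissections n. z ^ ?d v D) \<le> 8 * M * ?b" if v: "v \<in> {1..n}" for v
    proof -
      have cnt: "real (card {D \<in> dissections n. ?d v D = j}) \<le> 8 * real j ^ 3 * q ^ j * ?b" for j
      proof -
        have "real (card {D \<in> dissections n. ?d v D = j}) \<le> real (card (Diss UNIV {j} 1 n))"
          using degree_count_le[OF n v] by simp
        also have "\<dots> = dcount UNIV {j} (n - 1)" using Diss_dcount[OF down_closed_UNIV, of n] n by simp
        also have "\<dots> \<le> 8 * real j ^ 3 * q ^ j * dcount UNIV UNIV (n - 1)" using n by (intro root_degree_bound) auto
        also have "dcount UNIV UNIV (n - 1) = ?b" using Diss_dcount[OF down_closed_UNIV, of n] n by simp
        finally show ?thesis .
      qed
      have "(\<Sum>D\<in>dissections n. z ^ ?d v D) = (\<Sum>j\<in>?d v ` dissections n. \<Sum>D\<in>{D \<in> dissections n. ?d v D = j}. z ^ ?d v D)"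
        by (rule sum.image_gen[OF finite_Diss])
      also have "\<dots> = (\<Sum>j\<in>?d v ` dissections n. z ^ j * real (card {D \<in> dissections n. ?d v D = j}))"
        by (intro sum.cong refl) (simp add: mult.commute)
      also have "\<dots> \<le> (\<Sum>j\<in>?d v ` dissections n. z ^ j * (8 * real j ^ 3 * q ^ j * ?b))"
        using cnt z by (intro sum_mono mult_left_mono) auto
      also have "\<dots> = 8 * ?b * (\<Sum>j\<in>?d v ` dissections n. real j ^ 3 * (z * q) ^ j)"
        by (simp add: sum_distrib_left power_mult_distrib mult_ac)
      also have "\<dots> \<le> 8 * ?b * M"
        using M(2)[of "?d v ` dissections n"] finite_Diss by (intro mult_left_mono) auto
      finally show ?thesis by (simp add: mult_ac)
    qed
    have "(\<Sum>D\<in>dissections n. z ^ mdeg n D) \<le> (\<Sum>D\<in>dissections n. \<Sum>v\<in>{1..n}. z ^ ?d v D)"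
    proof (rule sum_mono)
      fix D
      obtain v where v: "v \<in> {1..n}" "mdeg n D = ?d v D" using mdeg_attained[of n D] n by auto
      have "z ^ ?d v D \<le> (\<Sum>v\<in>{1..n}. z ^ ?d v D)" using v z by (intro member_le_sum) auto
      then show "z ^ mdeg n D \<le> (\<Sum>v\<in>{1..n}. z ^ ?d v D)" using v by simp
    qed
    also have "\<dots> = (\<Sum>v\<in>{1..n}. \<Sum>D\<in>dissections n. z ^ ?d v D)" by (rule sum.swap)
    also have "\<dots> \<le> (\<Sum>v\<in>{1..n}. 8 * M * ?b)" using one by (rule sum_mono)
    finally show ?thesis by simp
  qed
  then show ?thesis using M(1) by (intro exI[of _ "8 * M"]) auto
qed

text \<open>Markov's inequality for \<open>z ^ mdeg n D\<close>.\<close>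

lemma upper_tail:
  assumes z: "1 < z" and n: "n \<ge> 3"
    and M: "(\<Sum>D\<in>dissections n. z ^ mdeg n D) \<le> real n * M * real (card (dissections n))"
  shows "real (card {D \<in> dissections n. real (mdeg n D) > x}) / real (card (dissections n)) \<le> real n * M * z powr (- x)"
proof -
  let ?b = "real (card (dissections n))"
  have "real (card {D \<in> dissections n. real (mdeg n D) > x}) * z powr x =
      (\<Sum>D\<in>{D \<in> dissections n. real (mdeg n D) > x}. z powr x)" by simp
  also have "\<dots> \<le> (\<Sum>D\<in>{D \<in> dissections n. real (mdeg n D) > x}. z ^ mdeg n D)"
    using z by (intro sum_mono) (auto simp flip: powr_realpow)
  also have "\<dots> \<le> (\<Sum>D\<in>dissections n. z ^ mdeg n D)"
    using z finite_Diss by (intro sum_mono2) auto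
  also have "\<dots> \<le> real n * M * ?b" by (rule M)
  finally show ?thesis using z card_dissections_pos[OF n] by (simp add: powr_minus field_simps)
qed

text \<open>Jensen's inequality for \<open>z\<^sup>x\<close>, via the tangent at \<open>x = log\<^sub>z (n M)\<close>.\<close>

lemma mean_upper:
  assumes z: "1 < z" and n: "n \<ge> 3" and M0: "M > 0"
    and M: "(\<Sum>D\<in>dissections n. z ^ mdeg n D) \<le> real n * M * real (card (dissections n))"
  shows "(\<Sum>D\<in>dissections n. real (mdeg n D)) / real (card (dissections n)) \<le> ln (real n * M) / ln z"
proof -
  let ?b = "real (card (dissections n))"
  define a where "a = ln (real n * M)"
  have nM: "real n * M > 0" using n M0 by simp
  have lz: "ln z > 0" using z by simp
  have "1 + (real d * ln z - a) \<le> z ^ d / (real n * M)" for d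
  proof -
    have "1 + (real d * ln z - a) \<le> exp (real d * ln z - a)" by (rule exp_ge_add_one_self)
    also have "\<dots> = z ^ d / (real n * M)"
      using z nM by (simp add: exp_diff a_def exp_of_nat_mult)
    finally show ?thesis .
  qed
  then have "(\<Sum>D\<in>dissections n. 1 + (real (mdeg n D) * ln z - a)) \<le> (\<Sum>D\<in>dissections n. z ^ mdeg n D / (real n * M))"
    by (intro sum_mono) auto
  also have "\<dots> \<le> ?b"
    using M nM by (simp add: divide_le_eq mult_ac flip: sum_divide_distrib)
  finally have "(\<Sum>D\<in>dissections n. real (mdeg n D)) * ln z \<le> a * ?b"
    by (simp add: sum.distrib sum_subtractf sum_distrib_right mult.commute[of a])
  then show ?thesis
    using lz card_dissections_pos[OF n] by (simp add: a_def field_simps)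
qed

text \<open>The restricted count is divided by the polynomial lower bound for all dissections, and
  the powers of q^2 cancel. What remains is (1 + y)^(-N) with y = q^k, and exp (y / 2) \<le> 1 + y
  on the unit interval makes it exponential.\<close>

lemma lower_tail:
  assumes n: "n \<ge> 3"
  shows "real (card {D \<in> dissections n. mdeg n D \<le> k}) / real (card (dissections n)) \<le>
    2 * (real n)\<^sup>2 / q\<^sup>2 * exp (- (real n - 1) * q ^ k / 2)"
proof -
  let ?b = "real (card (dissections n))"
  define N where "N = n - 1"
  have N: "N \<ge> 2" "real N = real n - 1" using n by (auto simp: N_def of_nat_diff)
  define y where "y = q ^ k"
  have y: "0 < y" "y \<le> 1" using q_pos q_less by (auto simp: y_def power_le_one)
  have b: "?b = dcount UNIV UNIV N" using Diss_dcount[OF down_closed_UNIV, of n UNIV] n by (simp add: N_def)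
  have lo: "q\<^sup>2 / (2 * (real n)\<^sup>2) \<le> ?b * (q\<^sup>2) ^ N"
  proof -
    have "q\<^sup>2 / (2 * (real n)\<^sup>2) \<le> q\<^sup>2 / (2 * (real N)\<^sup>2)"
      using N n by (intro divide_left_mono) (auto intro!: power_mono)
    then show ?thesis using dissection_count_lower[OF N(1)] b by simp
  qed
  have "exp (y / 2) \<le> 1 + y"
  proof -
    have "exp (y / 2) \<le> 1 + y / 2 + (y / 2)\<^sup>2" using y by (intro exp_bound) auto
    also have "(y / 2)\<^sup>2 \<le> y / 2" using y by (simp add: power2_eq_square mult_le_one)
    finally show ?thesis by simp
  qed
  then have "exp (y / 2) ^ N \<le> (1 + y) ^ N" by (intro power_mono) auto
  then have ey: "(1 + y) ^ N * exp (- (real n - 1) * y / 2) \<ge> 1"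
  proof -
    have "exp (y / 2) ^ N = exp ((real n - 1) * y / 2)"
      using N(2) by (simp flip: exp_of_nat_mult)
    moreover have "- (real n - 1) * y / 2 = - ((real n - 1) * y / 2)"
      by (simp only: minus_mult_left minus_divide_left)
    moreover from this have "exp (- (real n - 1) * y / 2) = inverse (exp ((real n - 1) * y / 2))"
      by (simp only: exp_minus)
    ultimately have e: "exp (- (real n - 1) * y / 2) = inverse (exp (y / 2) ^ N)" by simp
    have "exp (y / 2) ^ N * inverse (exp (y / 2) ^ N) \<le> (1 + y) ^ N * inverse (exp (y / 2) ^ N)"
      using \<open>exp (y / 2) ^ N \<le> (1 + y) ^ N\<close> by (intro mult_right_mono) auto
    then show ?thesis unfolding e by simp
  qed
  have "real (card {D \<in> dissections n. mdeg n D \<le> k}) \<le> (1 / (q\<^sup>2 * (1 + y))) ^ N"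
    using mdeg_le_count[of n k] restricted_count_bound[of N k] n N by (simp add: N_def y_def)
  also have "\<dots> = 1 / ((q\<^sup>2) ^ N * (1 + y) ^ N)" by (simp add: power_one_over power_mult_distrib)
  also have "\<dots> \<le> 1 / ((q\<^sup>2) ^ N * (1 + y) ^ N) * ((1 + y) ^ N * exp (- (real n - 1) * y / 2))"
    using mult_left_mono[OF ey, of "1 / ((q\<^sup>2) ^ N * (1 + y) ^ N)"] y by simp
  also have "\<dots> = exp (- (real n - 1) * y / 2) * (1 / (q\<^sup>2) ^ N)" using y by simp
  also have "1 / (q\<^sup>2) ^ N \<le> 2 * (real n)\<^sup>2 / q\<^sup>2 * ?b"
    using lo q_pos n by (simp add: field_simps)
  finally show ?thesis
    using card_dissections_pos[OF n] by (simp add: y_def field_simps)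
qed

section \<open>Limits\<close>

lemma ln_q: "ln q = - ln (sqrt 2 + 1)"
proof -
  have "q * (sqrt 2 + 1) = 1" by (simp add: q_def algebra_simps)
  moreover have "sqrt 2 + 1 > 0" by (intro add_nonneg_pos) auto
  ultimately show ?thesis using ln_mult[of q "sqrt 2 + 1"] q_pos by simp
qed

lemma ln_silver_pos: "ln (sqrt 2 + 1) > 0"
  by (intro ln_gt_zero) simp

lemma upper_probability:
  assumes "c > 1 / ln (sqrt 2 + 1)"
  shows "(\<lambda>n. real (card {D \<in> dissections n. real (mdeg n D) > c * ln (real n)}) / real (card (dissections n))) \<longlonglongrightarrow> 0"
proof -
  let ?L = "ln (sqrt 2 + 1)"
  have "0 < 1 / ?L" using ln_silver_pos by simp
  then have c: "c > 0" using assms by linarith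
  then have "1 / c < ?L" using assms ln_silver_pos by (simp add: field_simps)
  \<comment> \<open>With z = exp t, the bound t < \<open>?L\<close> gives z q < 1, so the moment is
    finite, and c t > 1 makes n z^(-c ln n) = n^(1 - c t) vanish.\<close>
  obtain t where t: "1 / c < t" "t < ?L" using dense[OF \<open>1 / c < ?L\<close>] by blast
  have t0: "t > 0" using t(1) c by (meson divide_pos_pos less_trans zero_less_one)
  define z where "z = exp t"
  have "z * q = exp (t + ln q)" using q_pos by (simp add: z_def exp_add)
  then have z: "1 < z" "z * q < 1" using t0 t(2) ln_q by (auto simp: z_def)
  obtain M where M: "M > 0" "\<And>n. n \<ge> 3 \<Longrightarrow> (\<Sum>D\<in>dissections n. z ^ mdeg n D) \<le> real n * M * real (card (dissections n))"
    using exp_moment[OF z] by blast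
  have ct: "1 - c * t < 0" using t(1) c by (simp add: field_simps)
  have "(\<lambda>n. real n powr (1 - c * t)) \<longlonglongrightarrow> 0"
    by (rule tendsto_neg_powr[OF ct filterlim_real_sequentially])
  then have lim: "(\<lambda>n. M * real n powr (1 - c * t)) \<longlonglongrightarrow> 0"
    using tendsto_mult_right_zero by blast
  show ?thesis
  proof (rule tendsto_sandwich[OF _ _ tendsto_const lim])
    show "\<forall>\<^sub>F n in sequentially. 0 \<le> real (card {D \<in> dissections n. real (mdeg n D) > c * ln (real n)}) / real (card (dissections n))"
      by simp
    show "\<forall>\<^sub>F n in sequentially. real (card {D \<in> dissections n. real (mdeg n D) > c * ln (real n)}) / real (card (dissections n))
        \<le> M * real n powr (1 - c * t)"
    proof (rule eventually_sequentiallyI[of 3])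
      fix n :: nat assume n: "n \<ge> 3"
      have "real n * M * z powr (- (c * ln (real n))) = M * (real n * exp (- (c * t) * ln (real n)))"
        by (simp add: z_def powr_def mult_ac)
      also have "exp (- (c * t) * ln (real n)) = real n powr (- (c * t))" using n by (simp add: powr_def)
      also have "real n * real n powr (- (c * t)) = real n powr (1 - c * t)"
        using n powr_add[of "real n" 1 "- (c * t)"] by simp
      finally have eq: "real n * M * z powr (- (c * ln (real n))) = M * real n powr (1 - c * t)" .
      show "real (card {D \<in> dissections n. real (mdeg n D) > c * ln (real n)}) / real (card (dissections n))
        \<le> M * real n powr (1 - c * t)"
        using upper_tail[OF z(1) n M(2)[OF n], of "c * ln (real n)"] unfolding eq .
    qed
  qed
qed

lemma lower_probability:
  assumes "0 < c" "c < 1 / ln (sqrt 2 + 1)"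
  shows "(\<lambda>n. real (card {D \<in> dissections n. real (mdeg n D) \<le> c * ln (real n)}) / real (card (dissections n))) \<longlonglongrightarrow> 0"
proof -
  let ?L = "ln (sqrt 2 + 1)"
  \<comment> \<open>The exponent with n q^(c ln n) = n^d. It is positive, so exp (-n^d / 2)
    outweighs the polynomial factor n^2.\<close>
  define d where "d = 1 - ?L * c"
  have d: "0 < d" "d < 1" using assms ln_silver_pos by (auto simp: d_def field_simps)
  have "(\<lambda>n. 2 * (real n)\<^sup>2 * exp (- (real n - 1) * real n powr (d - 1) / 2)) \<longlonglongrightarrow> 0"
    using d by real_asymp
  then have lim: "(\<lambda>n. 2 * (real n)\<^sup>2 * exp (- (real n - 1) * real n powr (d - 1) / 2) / q\<^sup>2) \<longlonglongrightarrow> 0"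
    using tendsto_divide_zero by blast
  show ?thesis
  proof (rule tendsto_sandwich[OF _ _ tendsto_const lim])
    show "\<forall>\<^sub>F n in sequentially. 0 \<le> real (card {D \<in> dissections n. real (mdeg n D) \<le> c * ln (real n)}) / real (card (dissections n))"
      by simp
    show "\<forall>\<^sub>F n in sequentially. real (card {D \<in> dissections n. real (mdeg n D) \<le> c * ln (real n)}) / real (card (dissections n))
        \<le> 2 * (real n)\<^sup>2 * exp (- (real n - 1) * real n powr (d - 1) / 2) / q\<^sup>2"
    proof (rule eventually_sequentiallyI[of 3])
      fix n :: nat assume n: "n \<ge> 3"
      let ?x = "c * ln (real n)"
      define k where "k = nat \<lfloor>?x\<rfloor>"
      have x0: "?x \<ge> 0" using n assms by simp
      have "{D \<in> dissections n. real (mdeg n D) \<le> ?x} \<subseteq> {D \<in> dissections n. mdeg n D \<le> k}"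
        by (auto simp: k_def le_nat_floor)
      then have "card {D \<in> dissections n. real (mdeg n D) \<le> ?x} \<le> card {D \<in> dissections n. mdeg n D \<le> k}"
        by (intro card_mono) (auto simp: finite_Diss)
      then have "real (card {D \<in> dissections n. real (mdeg n D) \<le> ?x}) / real (card (dissections n))
          \<le> real (card {D \<in> dissections n. mdeg n D \<le> k}) / real (card (dissections n))"
        by (intro divide_right_mono) auto
      also have "\<dots> \<le> 2 * (real n)\<^sup>2 / q\<^sup>2 * exp (- (real n - 1) * q ^ k / 2)"
        by (rule lower_tail[OF n])
      also have "\<dots> \<le> 2 * (real n)\<^sup>2 / q\<^sup>2 * exp (- (real n - 1) * real n powr (d - 1) / 2)"
      proof -
        have "real k \<le> ?x" using x0 by (simp add: k_def)
        have "real n powr (d - 1) = exp (?x * ln q)"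
          using n by (simp add: powr_def d_def ln_q mult_ac)
        also have "\<dots> \<le> exp (real k * ln q)"
          using \<open>real k \<le> ?x\<close> ln_silver_pos by (simp add: ln_q mult_right_mono)
        also have "\<dots> = q ^ k" using q_pos by (simp add: exp_of_nat_mult)
        finally have "(real n - 1) * real n powr (d - 1) \<le> (real n - 1) * q ^ k"
          using n by (intro mult_left_mono) auto
        then have "- (real n - 1) * q ^ k / 2 \<le> - (real n - 1) * real n powr (d - 1) / 2" by linarith
        then show ?thesis by (intro mult_left_mono iffD2[OF exp_le_cancel_iff]) auto
      qed
      finally show "real (card {D \<in> dissections n. real (mdeg n D) \<le> ?x}) / real (card (dissections n))
        \<le> 2 * (real n)\<^sup>2 * exp (- (real n - 1) * real n powr (d - 1) / 2) / q\<^sup>2" by simp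
    qed
  qed
qed

lemma concentration:
  assumes "e > 0"
  shows "(\<lambda>n. real (card {D \<in> dissections n. \<bar>real (mdeg n D) / ln (real n) - 1 / ln (sqrt 2 + 1)\<bar> > e})
     / real (card (dissections n))) \<longlonglongrightarrow> 0"
proof -
  let ?L = "ln (sqrt 2 + 1)" and ?b = "\<lambda>n. real (card (dissections n))"
  \<comment> \<open>The cap at half of 1 / \<open>?L\<close> keeps the lower threshold positive when
    e is large.\<close>
  define h where "h = min e (1 / (2 * ?L))"
  have h: "0 < h" "h \<le> e" "0 < 1 / ?L - h"
    using assms ln_silver_pos by (auto simp: h_def min_def field_simps)
  let ?U = "\<lambda>n. {D \<in> dissections n. real (mdeg n D) > (1 / ?L + e) * ln (real n)}"
  let ?W = "\<lambda>n. {D \<in> dissections n. real (mdeg n D) \<le> (1 / ?L - h) * ln (real n)}"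
  have lim: "(\<lambda>n. real (card (?U n)) / ?b n + real (card (?W n)) / ?b n) \<longlonglongrightarrow> 0"
    using tendsto_add[OF upper_probability[of "1 / ?L + e"] lower_probability[of "1 / ?L - h"]] assms h by simp
  show ?thesis
  proof (rule tendsto_sandwich[OF _ _ tendsto_const lim])
    show "\<forall>\<^sub>F n in sequentially. real (card {D \<in> dissections n. \<bar>real (mdeg n D) / ln (real n) - 1 / ?L\<bar> > e}) / ?b n
       \<le> real (card (?U n)) / ?b n + real (card (?W n)) / ?b n"
    proof (rule eventually_sequentiallyI[of 3])
      fix n :: nat assume n: "n \<ge> 3"
      then have ln: "ln (real n) > 0" by simp
      have "{D \<in> dissections n. \<bar>real (mdeg n D) / ln (real n) - 1 / ?L\<bar> > e} \<subseteq> ?U n \<union> ?W n"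
      proof
        fix D assume D: "D \<in> {D \<in> dissections n. \<bar>real (mdeg n D) / ln (real n) - 1 / ?L\<bar> > e}"
        then have "real (mdeg n D) / ln (real n) > 1 / ?L + e \<or> real (mdeg n D) / ln (real n) \<le> 1 / ?L - h"
          using h(2) by (auto simp: abs_if split: if_splits)
        then have "real (mdeg n D) > (1 / ?L + e) * ln (real n) \<or> real (mdeg n D) \<le> (1 / ?L - h) * ln (real n)"
          using ln by (simp add: pos_less_divide_eq pos_divide_le_eq)
        then show "D \<in> ?U n \<union> ?W n" using D by blast
      qed
      then have "card {D \<in> dissections n. \<bar>real (mdeg n D) / ln (real n) - 1 / ?L\<bar> > e} \<le> card (?U n \<union> ?W n)"
        by (intro card_mono) (auto simp: finite_Diss)
      also have "\<dots> \<le> card (?U n) + card (?W n)" by (rule card_Un_le)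
      finally have "real (card {D \<in> dissections n. \<bar>real (mdeg n D) / ln (real n) - 1 / ?L\<bar> > e})
        \<le> real (card (?U n)) + real (card (?W n))" by linarith
      then show "real (card {D \<in> dissections n. \<bar>real (mdeg n D) / ln (real n) - 1 / ?L\<bar> > e}) / ?b n
         \<le> real (card (?U n)) / ?b n + real (card (?W n)) / ?b n"
        unfolding add_divide_distrib[symmetric] by (intro divide_right_mono) auto
    qed
  qed simp
qed

text \<open>Concentration controls the mean only from below; large values could still dominate it,
  so the upper half returns to the exponential moment through \<open>mean_upper\<close>.\<close>

lemma mean_asymptotics:
  "(\<lambda>n. (\<Sum>D\<in>dissections n. real (mdeg n D)) / real (card (dissections n)) / ln (real n))
     \<longlonglongrightarrow> 1 / ln (sqrt 2 + 1)"
proof (rule order_tendstoI)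
  let ?L = "ln (sqrt 2 + 1)" and ?b = "\<lambda>n. real (card (dissections n))"
  let ?E = "\<lambda>n. (\<Sum>D\<in>dissections n. real (mdeg n D)) / ?b n"
  note L = ln_silver_pos
  {
    fix a assume a: "1 / ?L < a"
    then have a0: "a > 0" using L by (meson divide_pos_pos less_trans zero_less_one)
    then have "1 / a < ?L" using a L by (simp add: field_simps)
    then obtain t where t: "1 / a < t" "t < ?L" using dense by blast
    have t0: "t > 0" using t(1) a0 by (meson divide_pos_pos less_trans zero_less_one)
    define z where "z = exp t"
    have "z * q = exp (t + ln q)" using q_pos by (simp add: z_def exp_add)
    then have z: "1 < z" "z * q < 1" using t0 t(2) ln_q by (auto simp: z_def)
    obtain M where M: "M > 0" "\<And>n. n \<ge> 3 \<Longrightarrow> (\<Sum>D\<in>dissections n. z ^ mdeg n D) \<le> real n * M * ?b n"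
      using exp_moment[OF z] by blast
    have "(\<lambda>n. ln (real n * M) / t / ln (real n)) \<longlonglongrightarrow> inverse t"
      using M(1) t0 by real_asymp
    moreover have "inverse t < a" using t(1) a0 t0 by (simp add: field_simps)
    ultimately have "\<forall>\<^sub>F n in sequentially. ln (real n * M) / t / ln (real n) < a"
      by (rule order_tendstoD)
    then show "\<forall>\<^sub>F n in sequentially. ?E n / ln (real n) < a"
      using eventually_ge_at_top[of 3]
    proof eventually_elim
      case (elim n)
      have "?E n \<le> ln (real n * M) / t"
        using mean_upper[OF z(1) elim(2) M(1) M(2)[OF elim(2)]] by (simp add: z_def)
      then have "?E n / ln (real n) \<le> ln (real n * M) / t / ln (real n)"
        using elim(2) by (intro divide_right_mono) auto
      then show ?case using elim(1) by linarith
    qed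
  }
  {
    fix a assume a: "a < 1 / ?L"
    \<comment> \<open>The threshold constant is chosen positive, as \<open>lower_probability\<close>
      demands, even if \<open>a\<close> is negative.\<close>
    then have "max a 0 < 1 / ?L" using L by simp
    then obtain c where c: "max a 0 < c" "c < 1 / ?L" using dense by blast
    let ?W = "\<lambda>n. {D \<in> dissections n. real (mdeg n D) \<le> c * ln (real n)}"
    have "(\<lambda>n. c * (1 - real (card (?W n)) / ?b n)) \<longlonglongrightarrow> c * (1 - 0)"
      using c by (intro tendsto_intros lower_probability) auto
    then have "\<forall>\<^sub>F n in sequentially. a < c * (1 - real (card (?W n)) / ?b n)"
      using c by (intro order_tendstoD) auto
    then show "\<forall>\<^sub>F n in sequentially. a < ?E n / ln (real n)"
      using eventually_ge_at_top[of 3]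
    proof eventually_elim
      case (elim n)
      have ln: "ln (real n) > 0" using elim(2) by simp
      have b: "?b n > 0" using card_dissections_pos elim(2) by blast
      \<comment> \<open>Dissections outside \<open>?W n\<close> contribute more than c ln n each;
        those in \<open>?W n\<close> are bounded below by 0.\<close>
      have "c * ln (real n) * (?b n - real (card (?W n))) = (\<Sum>D\<in>dissections n - ?W n. c * ln (real n))"
        by (simp add: card_Diff_subset finite_Diss of_nat_diff card_mono)
      also have "\<dots> \<le> (\<Sum>D\<in>dissections n - ?W n. real (mdeg n D))"
        by (intro sum_mono) auto
      also have "\<dots> \<le> (\<Sum>D\<in>dissections n. real (mdeg n D))"
        by (intro sum_mono2) (auto simp: finite_Diss)
      finally have le: "c * ln (real n) * (?b n - real (card (?W n))) \<le> (\<Sum>D\<in>dissections n. real (mdeg n D))" .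
      have "c * (1 - real (card (?W n)) / ?b n) = c * ln (real n) * (?b n - real (card (?W n))) / (?b n * ln (real n))"
        using ln b by (simp add: field_simps)
      also have "\<dots> \<le> (\<Sum>D\<in>dissections n. real (mdeg n D)) / (?b n * ln (real n))"
        using le ln by (intro divide_right_mono) auto
      finally have "c * (1 - real (card (?W n)) / ?b n) \<le> ?E n / ln (real n)" by simp
      then show ?case using elim(1) by linarith
    qed
  }
qed

theorem theorem2:
  "(\<forall>\<epsilon>>0. ((\<lambda>n. real (card {E \<in> TCO n.
        \<bar>real (max_degree n E) / ln (real n) - 1 / ln (sqrt 2 + 1)\<bar> > \<epsilon>})
        / real (card (TCO n))) \<longlongrightarrow> 0) at_top)
   \<and> (\<lambda>n. (\<Sum>E\<in>TCO n. real (max_degree n E)) / real (card (TCO n)))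
       \<sim>[at_top] (\<lambda>n. ln (real n) / ln (sqrt 2 + 1))"
proof (intro conjI allI impI)
  fix \<epsilon> :: real assume "\<epsilon> > 0"
  \<comment> \<open>The passage from graphs to dissections holds for \<open>n \<ge> 3\<close>, so
    the two sequences agree eventually.\<close>
  have "\<forall>\<^sub>F n in sequentially.
     real (card {D \<in> dissections n. \<bar>real (mdeg n D) / ln (real n) - 1 / ln (sqrt 2 + 1)\<bar> > \<epsilon>}) / real (card (dissections n)) =
     real (card {E \<in> TCO n. \<bar>real (max_degree n E) / ln (real n) - 1 / ln (sqrt 2 + 1)\<bar> > \<epsilon>}) / real (card (TCO n))"
    using TCO_frequency[of _ "\<lambda>d. \<bar>real d / ln (real _) - 1 / ln (sqrt 2 + 1)\<bar> > \<epsilon>"]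
    by (intro eventually_sequentiallyI[of 3]) simp
  from Lim_transform_eventually[OF concentration[OF \<open>\<epsilon> > 0\<close>] this]
  show "((\<lambda>n. real (card {E \<in> TCO n. \<bar>real (max_degree n E) / ln (real n) - 1 / ln (sqrt 2 + 1)\<bar> > \<epsilon>})
        / real (card (TCO n))) \<longlongrightarrow> 0) at_top" .
next
  let ?L = "ln (sqrt 2 + 1)"
  have "(\<lambda>n. (\<Sum>D\<in>dissections n. real (mdeg n D)) / real (card (dissections n)) / ln (real n) * ?L) \<longlonglongrightarrow> 1 / ?L * ?L"
    by (intro tendsto_mult mean_asymptotics tendsto_const)
  then have lim: "(\<lambda>n. (\<Sum>D\<in>dissections n. real (mdeg n D)) / real (card (dissections n)) / ln (real n) * ?L) \<longlonglongrightarrow> 1"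
    using ln_silver_pos by simp
  have "\<forall>\<^sub>F n in sequentially.
     (\<Sum>D\<in>dissections n. real (mdeg n D)) / real (card (dissections n)) / ln (real n) * ?L =
     (\<Sum>E\<in>TCO n. real (max_degree n E)) / real (card (TCO n)) / (ln (real n) / ?L)"
    using TCO_average[of _ real] by (intro eventually_sequentiallyI[of 3]) simp
  from Lim_transform_eventually[OF lim this]
  show "(\<lambda>n. (\<Sum>E\<in>TCO n. real (max_degree n E)) / real (card (TCO n))) \<sim>[at_top] (\<lambda>n. ln (real n) / ?L)"
    by (rule asymp_equivI')
qed

end
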